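(* Let $(R,\mathfrak m)$ be an $F$-finite complete reduced Noetherian local ring of characteristic $p>0$, and let $(-)^\vee=\operatorname{Hom}_R(-,E_R(R/\mathfrak m))$ denote the Matlis duality functor. Let $L$ be either an Artinian or a finitely generated $R$-module (or any other Matlis-dualizable module, i.e. one for which the natural map $L\to L^{\vee\vee}$ is an isomorphism). Then $$(L_* )^\vee \cong L^\vee / 0^*_{L^\vee} \quad \text{ and } \quad (L^\vee)_* \cong (L / 0^*_L)^\vee.$$
   Context: A ring is $F$-finite if its Frobenius endomorphism is a finite map. $R^\circ$ is the set of elements of $R$ not contained in any minimal prime. For $e\ge 0$, ${}^eR=\{{}^ex : x\in R\}$ is $R$ as an abelian group, with $R$-module structure $r\cdot{}^ex={}^e(r^{p^e}x)$. For an $R$-module $M$, $c\in R^\circ$ and $e_0\ge 0$ put $M_*[c,p^{e_0}]=\sum_{e\ge e_0}\operatorname{im}(\operatorname{Hom}_R({}^eR,M)\to M,\ g\mapsto g({}^ec))$. The tight interior of $M$ is $M_*=\bigcap_{c\in R^\circ}\bigcap_{e_0\ge0}M_*[c,p^{e_0}]$. The tight closure $0^*_M$ of $0$ in $M$ is the set of $z\in M$ for which there is $c\in R^\circ$ with ${}^ec\otimes z=0$ in ${}^eR\otimes_RM$ for all $e\gg0$. $E_R(R/\mathfrak m)$ is the injective hull of $R/\mathfrak m$. *)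

theory Defs
  imports "HOL-Algebra.Algebra"
begin

section \<open>Modules\<close>

text \<open>In HOL-Algebra a module record extends a ring record.  For a module, only the fields
  carrier, add, zero and smult carry information; the fields mult and one are left undefined
  in the constructions below.\<close>

definition mod_hom :: "('a, 'r) ring_scheme \<Rightarrow> ('a, 'b) module \<Rightarrow> ('a, 'c) module \<Rightarrow> ('b \<Rightarrow> 'c) set"
  where "mod_hom R M N =
    {f \<in> carrier M \<rightarrow>\<^sub>E carrier N.
       (\<forall>x\<in>carrier M. \<forall>y\<in>carrier M. f (x \<oplus>\<^bsub>M\<^esub> y) = f x \<oplus>\<^bsub>N\<^esub> f y) \<and>
       (\<forall>r\<in>carrier R. \<forall>x\<in>carrier M. f (r \<odot>\<^bsub>M\<^esub> x) = r \<odot>\<^bsub>N\<^esub> f x)}"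

definition mod_iso :: "('a, 'r) ring_scheme \<Rightarrow> ('a, 'b) module \<Rightarrow> ('a, 'c) module \<Rightarrow> ('b \<Rightarrow> 'c) set"
  where "mod_iso R M N = {f \<in> mod_hom R M N. bij_betw f (carrier M) (carrier N)}"

definition mod_isomorphic :: "('a, 'r) ring_scheme \<Rightarrow> ('a, 'b) module \<Rightarrow> ('a, 'c) module \<Rightarrow> bool"
  where "mod_isomorphic R M N \<longleftrightarrow> mod_iso R M N \<noteq> {}"

definition hom_module :: "('a, 'r) ring_scheme \<Rightarrow> ('a, 'b) module \<Rightarrow> ('a, 'c) module \<Rightarrow> ('a, 'b \<Rightarrow> 'c) module"
  where "hom_module R M N =
    \<lparr>carrier = mod_hom R M N, monoid.mult = undefined, one = undefined,
     ring.zero = (\<lambda>x\<in>carrier M. \<zero>\<^bsub>N\<^esub>),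
     ring.add = (\<lambda>f g. \<lambda>x\<in>carrier M. f x \<oplus>\<^bsub>N\<^esub> g x),
     smult = (\<lambda>r f. \<lambda>x\<in>carrier M. r \<odot>\<^bsub>N\<^esub> f x)\<rparr>"

definition quotient_module :: "('a, 'b) module \<Rightarrow> 'b set \<Rightarrow> ('a, 'b set) module"
  where "quotient_module M N =
    \<lparr>carrier = a_rcosets\<^bsub>M\<^esub> N, monoid.mult = undefined, one = undefined,
     ring.zero = N,
     ring.add = set_add M,
     smult = (\<lambda>r C. \<Union>x\<in>C. N +>\<^bsub>M\<^esub> (r \<odot>\<^bsub>M\<^esub> x))\<rparr>"

definition submodule_generated :: "('a, 'r) ring_scheme \<Rightarrow> ('a, 'b) module \<Rightarrow> 'b set \<Rightarrow> 'b set"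
  where "submodule_generated R M S = \<Inter>{H. submodule H R M \<and> S \<subseteq> H}"

definition fin_gen_module :: "('a, 'r) ring_scheme \<Rightarrow> ('a, 'b) module \<Rightarrow> bool"
  where "fin_gen_module R M \<longleftrightarrow>
    (\<exists>S. finite S \<and> S \<subseteq> carrier M \<and> submodule_generated R M S = carrier M)"

definition artinian_module :: "('a, 'r) ring_scheme \<Rightarrow> ('a, 'b) module \<Rightarrow> bool"
  where "artinian_module R M \<longleftrightarrow>
    (\<forall>N :: nat \<Rightarrow> 'b set. (\<forall>n. submodule (N n) R M) \<and> (\<forall>n. N (Suc n) \<subseteq> N n)
       \<longrightarrow> (\<exists>k. \<forall>n\<ge>k. N n = N k))"

definition ring_module :: "('a, 'r) ring_scheme \<Rightarrow> ('a, 'a) module"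
  where "ring_module R =
    \<lparr>carrier = carrier R, monoid.mult = monoid.mult R, one = \<one>\<^bsub>R\<^esub>, ring.zero = \<zero>\<^bsub>R\<^esub>, ring.add = ring.add R, smult = monoid.mult R\<rparr>"

text \<open>The test modules A and B live on the type of elements of R, since a definition cannot
  quantify over types.  This is no restriction: by Baer's criterion, E then has the extension
  property with respect to test modules over arbitrary types, see
  \<open>injective_module_extension\<close> below.\<close>

definition injective_module :: "('a, 'r) ring_scheme \<Rightarrow> ('a, 'e) module \<Rightarrow> bool"
  where "injective_module R E \<longleftrightarrow> module R E \<and>
    (\<forall>(A :: ('a, 'a) module) (B :: ('a, 'a) module) f g.
       module R A \<and> module R B \<and> f \<in> mod_hom R A B \<and> inj_on f (carrier A) \<and> g \<in> mod_hom R A E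
       \<longrightarrow> (\<exists>h\<in>mod_hom R B E. \<forall>x\<in>carrier A. h (f x) = g x))"

lemma ring_module_ideal_module:
  assumes "cring R" and "ideal I R"
  shows "module R ((ring_module R)\<lparr>carrier := I\<rparr>)"
proof -
  interpret cring R by fact
  interpret I: ideal I R by fact
  show ?thesis
  proof (rule moduleI)
    show "abelian_group ((ring_module R)\<lparr>carrier := I\<rparr>)"
    proof (rule abelian_groupI)
      fix x assume "x \<in> carrier ((ring_module R)\<lparr>carrier := I\<rparr>)"
      then show "\<exists>y\<in>carrier ((ring_module R)\<lparr>carrier := I\<rparr>).
          y \<oplus>\<^bsub>(ring_module R)\<lparr>carrier := I\<rparr>\<^esub> x = \<zero>\<^bsub>(ring_module R)\<lparr>carrier := I\<rparr>\<^esub>"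
        by (intro bexI[of _ "\<ominus>\<^bsub>R\<^esub> x"]) (auto simp: ring_module_def I.Icarr l_neg)
    qed (auto simp: ring_module_def I.Icarr a_ac)
  qed (auto simp: ring_module_def I.Icarr I.I_l_closed l_distr r_distr m_assoc assms)
qed

lemma module_diff_eq_iff:
  assumes "module R M" "x \<in> carrier M" "y \<in> carrier M" "z \<in> carrier M" "w \<in> carrier M"
    and "x \<oplus>\<^bsub>M\<^esub> y = z \<oplus>\<^bsub>M\<^esub> w"
  shows "w \<ominus>\<^bsub>M\<^esub> y = x \<ominus>\<^bsub>M\<^esub> z"
proof -
  interpret module R M by fact
  have w: "w = \<ominus>\<^bsub>M\<^esub> z \<oplus>\<^bsub>M\<^esub> (x \<oplus>\<^bsub>M\<^esub> y)"
    using assms by (simp add: M.r_neg2 M.r_neg1)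
  have "w \<ominus>\<^bsub>M\<^esub> y = (\<ominus>\<^bsub>M\<^esub> z \<oplus>\<^bsub>M\<^esub> (x \<oplus>\<^bsub>M\<^esub> y)) \<ominus>\<^bsub>M\<^esub> y"
    by (rule arg_cong[OF w])
  also have "\<dots> = x \<ominus>\<^bsub>M\<^esub> z"
    using assms(2-4) by (simp add: M.minus_eq M.a_ac M.r_neg1 M.r_neg2)
  finally show ?thesis .
qed

lemma injective_module_extension:
  fixes R :: "('a, 'r) ring_scheme" and E :: "('a, 'e) module"
    and A :: "('a, 'b) module" and B :: "('a, 'c) module"
  assumes inj: "injective_module R E" and A: "module R A" and B: "module R B"
    and f: "f \<in> mod_hom R A B" "inj_on f (carrier A)" and g: "g \<in> mod_hom R A E"
  shows "\<exists>h\<in>mod_hom R B E. \<forall>x\<in>carrier A. h (f x) = g x"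
proof -
  interpret R: cring R using A by (simp add: module_def)
  interpret A: module R A by fact
  interpret B: module R B by fact
  interpret E: module R E using inj by (simp add: injective_module_def)
  define \<G> where "\<G> = {G. G \<subseteq> carrier B \<times> carrier E \<and> single_valued G \<and>
    (\<forall>a\<in>carrier A. (f a, g a) \<in> G) \<and>
    (\<forall>x y x' y'. (x, y) \<in> G \<and> (x', y') \<in> G \<longrightarrow> (x \<oplus>\<^bsub>B\<^esub> x', y \<oplus>\<^bsub>E\<^esub> y') \<in> G) \<and>
    (\<forall>r\<in>carrier R. \<forall>x y. (x, y) \<in> G \<longrightarrow> (r \<odot>\<^bsub>B\<^esub> x, r \<odot>\<^bsub>E\<^esub> y) \<in> G)}"
  have \<G>I: "G \<in> \<G>"
    if "G \<subseteq> carrier B \<times> carrier E" "single_valued G" "\<forall>a\<in>carrier A. (f a, g a) \<in> G"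
      "\<And>x y x' y'. (x, y) \<in> G \<Longrightarrow> (x', y') \<in> G \<Longrightarrow> (x \<oplus>\<^bsub>B\<^esub> x', y \<oplus>\<^bsub>E\<^esub> y') \<in> G"
      "\<And>r x y. r \<in> carrier R \<Longrightarrow> (x, y) \<in> G \<Longrightarrow> (r \<odot>\<^bsub>B\<^esub> x, r \<odot>\<^bsub>E\<^esub> y) \<in> G" for G
    unfolding \<G>_def using that(1-3) by (simp add: that(4,5))
  have \<G>sub: "x \<in> carrier B \<and> y \<in> carrier E" if "G \<in> \<G>" "(x, y) \<in> G" for G x y
    using that unfolding \<G>_def by auto
  have \<G>sv: "y = z" if "G \<in> \<G>" "(x, y) \<in> G" "(x, z) \<in> G" for G x y z
    using that unfolding \<G>_def by (auto dest: single_valuedD)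
  have \<G>fg: "(f a, g a) \<in> G" if "G \<in> \<G>" "a \<in> carrier A" for G a
    using that unfolding \<G>_def by simp
  have \<G>add: "(x \<oplus>\<^bsub>B\<^esub> x', y \<oplus>\<^bsub>E\<^esub> y') \<in> G"
    if "G \<in> \<G>" "(x, y) \<in> G" "(x', y') \<in> G" for G x y x' y'
    using that unfolding \<G>_def by simp
  have \<G>sm: "(r \<odot>\<^bsub>B\<^esub> x, r \<odot>\<^bsub>E\<^esub> y) \<in> G" if "G \<in> \<G>" "r \<in> carrier R" "(x, y) \<in> G" for G r x y
    using that unfolding \<G>_def by simp
  have fB: "f a \<in> carrier B" and gE: "g a \<in> carrier E" if "a \<in> carrier A" for a
    using f g that by (auto simp: mod_hom_def)
  have G0: "(\<lambda>a. (f a, g a)) ` carrier A \<in> \<G>"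
  proof -
    let ?G = "(\<lambda>a. (f a, g a)) ` carrier A"
    have "?G \<subseteq> carrier B \<times> carrier E" using fB gE by auto
    moreover have "single_valued ?G"
      using f(2) by (auto simp: single_valued_def inj_on_def)
    moreover have "(x \<oplus>\<^bsub>B\<^esub> x', y \<oplus>\<^bsub>E\<^esub> y') \<in> ?G" if "(x, y) \<in> ?G" "(x', y') \<in> ?G" for x y x' y'
    proof -
      from that obtain a a' where "a \<in> carrier A" "a' \<in> carrier A" "x = f a" "y = g a" "x' = f a'" "y' = g a'"
        by auto
      then show ?thesis using f g by (intro image_eqI[of _ _ "a \<oplus>\<^bsub>A\<^esub> a'"]) (auto simp: mod_hom_def)
    qed
    moreover have "(r \<odot>\<^bsub>B\<^esub> x, r \<odot>\<^bsub>E\<^esub> y) \<in> ?G" if "r \<in> carrier R" "(x, y) \<in> ?G" for r x y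
    proof -
      from that obtain a where "a \<in> carrier A" "x = f a" "y = g a" by auto
      then show ?thesis using f g that(1) by (intro image_eqI[of _ _ "r \<odot>\<^bsub>A\<^esub> a"]) (auto simp: mod_hom_def)
    qed
    moreover have "\<forall>a\<in>carrier A. (f a, g a) \<in> ?G" by simp
    ultimately show ?thesis by (intro \<G>I)
  qed
  have "\<exists>M\<in>\<G>. \<forall>K\<in>\<G>. M \<subseteq> K \<longrightarrow> K = M"
  proof (rule subset_Zorn_nonempty)
    show "\<G> \<noteq> {}" using G0 by blast
    fix C assume C: "C \<noteq> {}" "subset.chain \<G> C"
    have CG: "G \<in> \<G>" if "G \<in> C" for G using C(2) that by (auto simp: subset_chain_def)
    have two: "\<exists>G\<in>C. u \<in> G \<and> v \<in> G" if "u \<in> \<Union>C" "v \<in> \<Union>C" for u v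
    proof -
      from that obtain G H where GH: "G \<in> C" "u \<in> G" "H \<in> C" "v \<in> H" by blast
      moreover have "G \<subseteq> H \<or> H \<subseteq> G" using C(2) GH(1,3) by (auto simp: subset_chain_def)
      ultimately show ?thesis by blast
    qed
    have "\<Union>C \<subseteq> carrier B \<times> carrier E"
    proof clarify
      fix x y G assume "G \<in> C" "(x, y) \<in> G"
      then show "x \<in> carrier B \<and> y \<in> carrier E" using \<G>sub[OF CG] by simp
    qed
    moreover have "single_valued (\<Union>C)"
      unfolding single_valued_def
    proof (intro allI impI)
      fix x y z assume "(x, y) \<in> \<Union>C" "(x, z) \<in> \<Union>C"
      then obtain G where "G \<in> C" "(x, y) \<in> G" "(x, z) \<in> G" using two by meson
      then show "y = z" using \<G>sv[OF CG] by simp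
    qed
    moreover have "\<forall>a\<in>carrier A. (f a, g a) \<in> \<Union>C"
    proof -
      obtain G where "G \<in> C" using C(1) by auto
      then show ?thesis using \<G>fg[OF CG] by auto
    qed
    moreover have "(x \<oplus>\<^bsub>B\<^esub> x', y \<oplus>\<^bsub>E\<^esub> y') \<in> \<Union>C" if "(x, y) \<in> \<Union>C" "(x', y') \<in> \<Union>C" for x y x' y'
    proof -
      from two[OF that] obtain G where "G \<in> C" "(x, y) \<in> G" "(x', y') \<in> G" by auto
      then show ?thesis using \<G>add[OF CG, of G x y x' y'] by auto
    qed
    moreover have "(r \<odot>\<^bsub>B\<^esub> x, r \<odot>\<^bsub>E\<^esub> y) \<in> \<Union>C" if "r \<in> carrier R" "(x, y) \<in> \<Union>C" for r x y
    proof -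
      from that(2) obtain G where "G \<in> C" "(x, y) \<in> G" by auto
      then show ?thesis using \<G>sm[OF CG that(1), of G x y] by auto
    qed
    ultimately show "\<Union>C \<in> \<G>" by (intro \<G>I)
  qed
  then obtain G where GG: "G \<in> \<G>" and Gmax: "\<And>K. K \<in> \<G> \<Longrightarrow> G \<subseteq> K \<Longrightarrow> K = G" by blast
  have Gsub: "x \<in> carrier B" "y \<in> carrier E" if "(x, y) \<in> G" for x y
    using \<G>sub[OF GG that] by simp_all
  note Gsv = \<G>sv[OF GG] and Gfg = \<G>fg[OF GG] and Gadd = \<G>add[OF GG] and Gsm = \<G>sm[OF GG]
  have G00: "(\<zero>\<^bsub>B\<^esub>, \<zero>\<^bsub>E\<^esub>) \<in> G"
  proof -
    have 1: "(f \<zero>\<^bsub>A\<^esub>, g \<zero>\<^bsub>A\<^esub>) \<in> G" by (rule Gfg) simp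
    show ?thesis using Gsm[OF _ 1, of "\<zero>\<^bsub>R\<^esub>"] Gsub[OF 1] by simp
  qed
  have Gdiff: "(x \<ominus>\<^bsub>B\<^esub> x', y \<ominus>\<^bsub>E\<^esub> y') \<in> G" if "(x, y) \<in> G" "(x', y') \<in> G" for x y x' y'
  proof -
    have "(\<ominus>\<^bsub>R\<^esub> \<one>\<^bsub>R\<^esub> \<odot>\<^bsub>B\<^esub> x', \<ominus>\<^bsub>R\<^esub> \<one>\<^bsub>R\<^esub> \<odot>\<^bsub>E\<^esub> y') \<in> G"
      using that by (intro Gsm) auto
    then have "(\<ominus>\<^bsub>B\<^esub> x', \<ominus>\<^bsub>E\<^esub> y') \<in> G"
      using Gsub[OF that(2)] by (simp add: B.smult_l_minus E.smult_l_minus)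
    then show ?thesis using Gadd[OF that(1)] by (simp add: a_minus_def)
  qed
  have dom: "\<exists>y. (b, y) \<in> G" if b: "b \<in> carrier B" for b
  proof -
    define I where "I = {r \<in> carrier R. \<exists>y. (r \<odot>\<^bsub>B\<^esub> b, y) \<in> G}"
    have I: "ideal I R"
    proof (rule idealI)
      show "ring R" by (rule R.ring_axioms)
      show "subgroup I (add_monoid R)"
      proof (rule R.add.subgroupI)
        show "I \<subseteq> carrier R" unfolding I_def by blast
        have "\<zero>\<^bsub>R\<^esub> \<in> I" using G00 b unfolding I_def by auto
        then show "I \<noteq> {}" by blast
        fix r assume "r \<in> I"
        then obtain y where r: "r \<in> carrier R" "(r \<odot>\<^bsub>B\<^esub> b, y) \<in> G" unfolding I_def by blast
        have "(\<ominus>\<^bsub>R\<^esub> r \<odot>\<^bsub>B\<^esub> b, \<ominus>\<^bsub>E\<^esub> y) \<in> G"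
          using Gdiff[OF G00 r(2)] Gsub[OF r(2)] r b by (simp add: B.smult_l_minus a_minus_def)
        then show "\<ominus>\<^bsub>R\<^esub> r \<in> I" using r(1) unfolding I_def by auto
        fix s assume "s \<in> I"
        then obtain z where s: "s \<in> carrier R" "(s \<odot>\<^bsub>B\<^esub> b, z) \<in> G" unfolding I_def by blast
        show "r \<oplus>\<^bsub>R\<^esub> s \<in> I"
          using Gadd[OF r(2) s(2)] r(1) s(1) b unfolding I_def by (auto simp: B.smult_l_distr)
      qed
      fix a x assume a: "a \<in> I" and x: "x \<in> carrier R"
      from a obtain y where r: "a \<in> carrier R" "(a \<odot>\<^bsub>B\<^esub> b, y) \<in> G" unfolding I_def by blast
      show "x \<otimes>\<^bsub>R\<^esub> a \<in> I"
        using Gsm[OF x r(2)] x r(1) b unfolding I_def by (auto simp: B.smult_assoc1)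
      then show "a \<otimes>\<^bsub>R\<^esub> x \<in> I" using x r(1) by (simp add: R.m_comm)
    qed
    define \<phi> where "\<phi> = (\<lambda>r\<in>I. THE y. (r \<odot>\<^bsub>B\<^esub> b, y) \<in> G)"
    have \<phi>: "\<phi> r = y" if "r \<in> carrier R" "(r \<odot>\<^bsub>B\<^esub> b, y) \<in> G" for r y
      using that Gsv unfolding \<phi>_def I_def by (auto intro!: the_equality)
    let ?I = "(ring_module R)\<lparr>carrier := I\<rparr>"
    let ?R = "ring_module R"
    have mI: "module R ?I" by (rule ring_module_ideal_module[OF R.is_cring I])
    have "?R\<lparr>carrier := carrier R\<rparr> = ?R" by (simp add: ring_module_def)
    then have mR: "module R ?R"
      using ring_module_ideal_module[OF R.is_cring R.oneideal] by simp
    have IR: "r \<in> carrier R" if "r \<in> I" for r using that unfolding I_def by blast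
    have inc: "(\<lambda>r\<in>I. r) \<in> mod_hom R ?I ?R" "inj_on (\<lambda>r\<in>I. r) (carrier ?I)"
      using ideal.I_l_closed[OF I] additive_subgroup.a_closed[OF ideal.axioms(1)[OF I]] IR
      by (auto simp: mod_hom_def ring_module_def inj_on_def)
    have \<phi>hom: "\<phi> \<in> mod_hom R ?I E"
    proof -
      have "\<phi> \<in> extensional I" unfolding \<phi>_def by simp
      moreover have "\<phi> r \<in> carrier E" if "r \<in> I" for r
        using that \<phi> Gsub unfolding I_def by auto
      moreover have "\<phi> (r \<oplus>\<^bsub>R\<^esub> s) = \<phi> r \<oplus>\<^bsub>E\<^esub> \<phi> s" if rs: "r \<in> I" "s \<in> I" for r s
      proof -
        from rs obtain y z where r: "r \<in> carrier R" "(r \<odot>\<^bsub>B\<^esub> b, y) \<in> G"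
          and s: "s \<in> carrier R" "(s \<odot>\<^bsub>B\<^esub> b, z) \<in> G" unfolding I_def by blast
        have "((r \<oplus>\<^bsub>R\<^esub> s) \<odot>\<^bsub>B\<^esub> b, y \<oplus>\<^bsub>E\<^esub> z) \<in> G"
          using Gadd[OF r(2) s(2)] r(1) s(1) b by (simp add: B.smult_l_distr)
        then show ?thesis using \<phi> r s by auto
      qed
      moreover have "\<phi> (t \<otimes>\<^bsub>R\<^esub> r) = t \<odot>\<^bsub>E\<^esub> \<phi> r" if tr: "t \<in> carrier R" "r \<in> I" for r t
      proof -
        from tr obtain y where r: "r \<in> carrier R" "(r \<odot>\<^bsub>B\<^esub> b, y) \<in> G" unfolding I_def by blast
        have "((t \<otimes>\<^bsub>R\<^esub> r) \<odot>\<^bsub>B\<^esub> b, t \<odot>\<^bsub>E\<^esub> y) \<in> G"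
          using Gsm[OF tr(1) r(2)] r(1) tr(1) b by (simp add: B.smult_assoc1)
        then show ?thesis using \<phi> r tr(1) by auto
      qed
      ultimately show ?thesis by (auto simp: mod_hom_def ring_module_def PiE_def)
    qed
    obtain h where h: "h \<in> mod_hom R ?R E" "\<forall>r\<in>I. h r = \<phi> r"
      using inj mI mR inc \<phi>hom unfolding injective_module_def
      by (fastforce simp: restrict_apply)
    define e where "e = h \<one>\<^bsub>R\<^esub>"
    have e: "e \<in> carrier E" using h(1) by (auto simp: e_def mod_hom_def ring_module_def)
    have key: "y = r \<odot>\<^bsub>E\<^esub> e" if r: "r \<in> carrier R" "(r \<odot>\<^bsub>B\<^esub> b, y) \<in> G" for r y
    proof -
      have "h (r \<otimes>\<^bsub>R\<^esub> \<one>\<^bsub>R\<^esub>) = r \<odot>\<^bsub>E\<^esub> e"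
        using h(1) r(1) by (auto simp: e_def mod_hom_def ring_module_def simp del: R.r_one)
      moreover have "r \<in> I" using r unfolding I_def by blast
      ultimately show ?thesis using \<phi>[OF r] h(2) r(1) by simp
    qed
    define G' where "G' = {(x \<oplus>\<^bsub>B\<^esub> r \<odot>\<^bsub>B\<^esub> b, y \<oplus>\<^bsub>E\<^esub> r \<odot>\<^bsub>E\<^esub> e) | x y r. (x, y) \<in> G \<and> r \<in> carrier R}"
    have sub: "G \<subseteq> G'"
    proof
      fix u assume "u \<in> G"
      then obtain x y where u: "u = (x, y)" "(x, y) \<in> G" by (cases u) auto
      have "u = (x \<oplus>\<^bsub>B\<^esub> \<zero>\<^bsub>R\<^esub> \<odot>\<^bsub>B\<^esub> b, y \<oplus>\<^bsub>E\<^esub> \<zero>\<^bsub>R\<^esub> \<odot>\<^bsub>E\<^esub> e)"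
        using u Gsub[OF u(2)] b e by simp
      then show "u \<in> G'" using u(2) R.zero_closed unfolding G'_def by blast
    qed
    have "G' \<in> \<G>"
    proof -
      have "G' \<subseteq> carrier B \<times> carrier E" using Gsub b e unfolding G'_def by auto
      moreover have "single_valued G'"
        unfolding single_valued_def
      proof (intro allI impI)
        fix u v w assume "(u, v) \<in> G'" "(u, w) \<in> G'"
        then obtain x y r x' y' r' where 1: "(x, y) \<in> G" "r \<in> carrier R" "(x', y') \<in> G" "r' \<in> carrier R"
          and u: "u = x \<oplus>\<^bsub>B\<^esub> r \<odot>\<^bsub>B\<^esub> b" "u = x' \<oplus>\<^bsub>B\<^esub> r' \<odot>\<^bsub>B\<^esub> b"
          and vw: "v = y \<oplus>\<^bsub>E\<^esub> r \<odot>\<^bsub>E\<^esub> e" "w = y' \<oplus>\<^bsub>E\<^esub> r' \<odot>\<^bsub>E\<^esub> e" unfolding G'_def by auto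
        note c = Gsub[OF 1(1)] Gsub[OF 1(3)] 1(2,4) b e
        have "r' \<odot>\<^bsub>B\<^esub> b \<ominus>\<^bsub>B\<^esub> r \<odot>\<^bsub>B\<^esub> b = x \<ominus>\<^bsub>B\<^esub> x'"
          using u c by (intro module_diff_eq_iff[OF B]) auto
        then have "(r' \<ominus>\<^bsub>R\<^esub> r) \<odot>\<^bsub>B\<^esub> b = x \<ominus>\<^bsub>B\<^esub> x'"
          using c by (simp add: a_minus_def B.smult_l_distr B.smult_l_minus)
        then have "((r' \<ominus>\<^bsub>R\<^esub> r) \<odot>\<^bsub>B\<^esub> b, y \<ominus>\<^bsub>E\<^esub> y') \<in> G" using Gdiff[OF 1(1) 1(3)] by simp
        then have "y \<ominus>\<^bsub>E\<^esub> y' = (r' \<ominus>\<^bsub>R\<^esub> r) \<odot>\<^bsub>E\<^esub> e" using c by (intro key) auto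
        then have *: "y \<ominus>\<^bsub>E\<^esub> y' = r' \<odot>\<^bsub>E\<^esub> e \<ominus>\<^bsub>E\<^esub> r \<odot>\<^bsub>E\<^esub> e"
          using c by (simp add: a_minus_def E.smult_l_distr E.smult_l_minus)
        have "y = (y \<ominus>\<^bsub>E\<^esub> y') \<oplus>\<^bsub>E\<^esub> y'" using c by (simp add: E.M.minus_eq E.M.a_assoc E.M.l_neg)
        then have "v = ((r' \<odot>\<^bsub>E\<^esub> e \<ominus>\<^bsub>E\<^esub> r \<odot>\<^bsub>E\<^esub> e) \<oplus>\<^bsub>E\<^esub> y') \<oplus>\<^bsub>E\<^esub> r \<odot>\<^bsub>E\<^esub> e"
          using vw * by simp
        also have "\<dots> = w"
          using c by (simp add: vw E.M.minus_eq E.M.a_ac E.M.r_neg E.M.r_neg1 E.M.r_neg2)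
        finally show "v = w" .
      qed
      moreover have "\<forall>a\<in>carrier A. (f a, g a) \<in> G'" using Gfg sub by blast
      moreover have "(u \<oplus>\<^bsub>B\<^esub> u', v \<oplus>\<^bsub>E\<^esub> v') \<in> G'" if uv: "(u, v) \<in> G'" "(u', v') \<in> G'" for u v u' v'
      proof -
        from uv obtain x y r x' y' r' where 1: "(x, y) \<in> G" "r \<in> carrier R" "(x', y') \<in> G" "r' \<in> carrier R"
          and u: "u = x \<oplus>\<^bsub>B\<^esub> r \<odot>\<^bsub>B\<^esub> b" "u' = x' \<oplus>\<^bsub>B\<^esub> r' \<odot>\<^bsub>B\<^esub> b"
          and v: "v = y \<oplus>\<^bsub>E\<^esub> r \<odot>\<^bsub>E\<^esub> e" "v' = y' \<oplus>\<^bsub>E\<^esub> r' \<odot>\<^bsub>E\<^esub> e" unfolding G'_def by auto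
        note c = Gsub[OF 1(1)] Gsub[OF 1(3)] 1(2,4) b e
        have "u \<oplus>\<^bsub>B\<^esub> u' = (x \<oplus>\<^bsub>B\<^esub> x') \<oplus>\<^bsub>B\<^esub> (r \<oplus>\<^bsub>R\<^esub> r') \<odot>\<^bsub>B\<^esub> b"
          using c by (simp add: u B.smult_l_distr B.M.a_ac)
        moreover have "v \<oplus>\<^bsub>E\<^esub> v' = (y \<oplus>\<^bsub>E\<^esub> y') \<oplus>\<^bsub>E\<^esub> (r \<oplus>\<^bsub>R\<^esub> r') \<odot>\<^bsub>E\<^esub> e"
          using c by (simp add: v E.smult_l_distr E.M.a_ac)
        ultimately show ?thesis using Gadd[OF 1(1) 1(3)] c unfolding G'_def by auto
      qed
      moreover have "(t \<odot>\<^bsub>B\<^esub> u, t \<odot>\<^bsub>E\<^esub> v) \<in> G'" if uv: "t \<in> carrier R" "(u, v) \<in> G'" for t u v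
      proof -
        from uv obtain x y r where 1: "(x, y) \<in> G" "r \<in> carrier R"
          and u: "u = x \<oplus>\<^bsub>B\<^esub> r \<odot>\<^bsub>B\<^esub> b" "v = y \<oplus>\<^bsub>E\<^esub> r \<odot>\<^bsub>E\<^esub> e" unfolding G'_def by auto
        note c = Gsub[OF 1(1)] 1(2) b e uv(1)
        have "t \<odot>\<^bsub>B\<^esub> u = t \<odot>\<^bsub>B\<^esub> x \<oplus>\<^bsub>B\<^esub> (t \<otimes>\<^bsub>R\<^esub> r) \<odot>\<^bsub>B\<^esub> b"
          using c by (simp add: u B.smult_r_distr B.smult_assoc1)
        moreover have "t \<odot>\<^bsub>E\<^esub> v = t \<odot>\<^bsub>E\<^esub> y \<oplus>\<^bsub>E\<^esub> (t \<otimes>\<^bsub>R\<^esub> r) \<odot>\<^bsub>E\<^esub> e"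
          using c by (simp add: u E.smult_r_distr E.smult_assoc1)
        ultimately show ?thesis using Gsm[OF uv(1) 1(1)] c unfolding G'_def by auto
      qed
      ultimately show ?thesis by (intro \<G>I)
    qed
    then have "G' = G" using Gmax sub by blast
    moreover have "(b, e) \<in> G'"
    proof -
      have "(b, e) = (\<zero>\<^bsub>B\<^esub> \<oplus>\<^bsub>B\<^esub> \<one>\<^bsub>R\<^esub> \<odot>\<^bsub>B\<^esub> b, \<zero>\<^bsub>E\<^esub> \<oplus>\<^bsub>E\<^esub> \<one>\<^bsub>R\<^esub> \<odot>\<^bsub>E\<^esub> e)" using b e by simp
      then show ?thesis using G00 R.one_closed unfolding G'_def by blast
    qed
    ultimately show ?thesis by blast
  qed
  define h where "h = (\<lambda>b\<in>carrier B. THE y. (b, y) \<in> G)"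
  have h: "h b = y" if "(b, y) \<in> G" for b y
    using that Gsv Gsub unfolding h_def by (auto intro!: the_equality)
  have hG: "(b, h b) \<in> G" if "b \<in> carrier B" for b
    using dom[OF that] h by auto
  have "h \<in> mod_hom R B E"
  proof -
    have "h \<in> carrier B \<rightarrow>\<^sub>E carrier E"
    proof (rule PiE_I)
      show "h b \<in> carrier E" if "b \<in> carrier B" for b using Gsub(2)[OF hG[OF that]] .
      show "h b = undefined" if "b \<notin> carrier B" for b using that by (simp add: h_def)
    qed
    moreover have "h (x \<oplus>\<^bsub>B\<^esub> y) = h x \<oplus>\<^bsub>E\<^esub> h y" if "x \<in> carrier B" "y \<in> carrier B" for x y
      by (rule h[OF Gadd[OF hG[OF that(1)] hG[OF that(2)]]])
    moreover have "h (r \<odot>\<^bsub>B\<^esub> x) = r \<odot>\<^bsub>E\<^esub> h x" if "r \<in> carrier R" "x \<in> carrier B" for r x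
      by (rule h[OF Gsm[OF that(1) hG[OF that(2)]]])
    ultimately show ?thesis by (simp add: mod_hom_def)
  qed
  moreover have "\<forall>x\<in>carrier A. h (f x) = g x" using Gfg h by blast
  ultimately show ?thesis by blast
qed

text \<open>An injective hull is an injective essential extension.\<close>

definition injective_hull :: "('a, 'r) ring_scheme \<Rightarrow> ('a, 'b) module \<Rightarrow> ('a, 'e) module \<Rightarrow> bool"
  where "injective_hull R M E \<longleftrightarrow> injective_module R E \<and>
    (\<exists>i\<in>mod_hom R M E. inj_on i (carrier M) \<and>
       (\<forall>N. submodule N R E \<and> N \<inter> i ` carrier M = {\<zero>\<^bsub>E\<^esub>} \<longrightarrow> N = {\<zero>\<^bsub>E\<^esub>}))"

text \<open>The tensor product over R, as an abelian group: the free abelian group on pairs modulo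
  the bilinearity relations.  Its R-action is not needed here.\<close>

definition tensor_relations ::
    "('a, 'r) ring_scheme \<Rightarrow> ('a, 'b) module \<Rightarrow> ('a, 'c) module \<Rightarrow> (('b \<times> 'c) \<Rightarrow>\<^sub>0 int) set"
  where "tensor_relations R M N =
    {frag_of (x \<oplus>\<^bsub>M\<^esub> x', y) - frag_of (x, y) - frag_of (x', y) | x x' y.
       x \<in> carrier M \<and> x' \<in> carrier M \<and> y \<in> carrier N} \<union>
    {frag_of (x, y \<oplus>\<^bsub>N\<^esub> y') - frag_of (x, y) - frag_of (x, y') | x y y'.
       x \<in> carrier M \<and> y \<in> carrier N \<and> y' \<in> carrier N} \<union>
    {frag_of (r \<odot>\<^bsub>M\<^esub> x, y) - frag_of (x, r \<odot>\<^bsub>N\<^esub> y) | r x y.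
       r \<in> carrier R \<and> x \<in> carrier M \<and> y \<in> carrier N}"

definition tensor_kernel ::
    "('a, 'r) ring_scheme \<Rightarrow> ('a, 'b) module \<Rightarrow> ('a, 'c) module \<Rightarrow> (('b \<times> 'c) \<Rightarrow>\<^sub>0 int) set"
  where "tensor_kernel R M N =
    generate (free_Abelian_group (carrier M \<times> carrier N)) (tensor_relations R M N)"

definition tensor_product ::
    "('a, 'r) ring_scheme \<Rightarrow> ('a, 'b) module \<Rightarrow> ('a, 'c) module \<Rightarrow> (('b \<times> 'c) \<Rightarrow>\<^sub>0 int) set monoid"
  where "tensor_product R M N =
    free_Abelian_group (carrier M \<times> carrier N) Mod tensor_kernel R M N"

definition pure_tensor ::
    "('a, 'r) ring_scheme \<Rightarrow> ('a, 'b) module \<Rightarrow> ('a, 'c) module \<Rightarrow> 'b \<Rightarrow> 'c \<Rightarrow> (('b \<times> 'c) \<Rightarrow>\<^sub>0 int) set"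
  where "pure_tensor R M N x y =
    tensor_kernel R M N #>\<^bsub>free_Abelian_group (carrier M \<times> carrier N)\<^esub> frag_of (x, y)"


section \<open>Rings\<close>

definition local_ring :: "('a, 'r) ring_scheme \<Rightarrow> 'a set \<Rightarrow> bool"
  where "local_ring R \<mm> \<longleftrightarrow> cring R \<and> maximalideal \<mm> R \<and> (\<forall>J. maximalideal J R \<longrightarrow> J = \<mm>)"

definition reduced_ring :: "('a, 'r) ring_scheme \<Rightarrow> bool"
  where "reduced_ring R \<longleftrightarrow>
    (\<forall>x\<in>carrier R. \<forall>n::nat. x [^]\<^bsub>R\<^esub> n = \<zero>\<^bsub>R\<^esub> \<longrightarrow> x = \<zero>\<^bsub>R\<^esub>)"

text \<open>Bijectivity of the canonical map from R to the inverse limit of the quotients of R by the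
  powers of I, an element of the limit being given by a sequence of representatives.  The powers
  are taken in the monoid of ideals; the power with exponent 0 is the unit ideal.\<close>

definition adic_complete :: "('a, 'r) ring_scheme \<Rightarrow> 'a set \<Rightarrow> bool"
  where "adic_complete R I \<longleftrightarrow>
    (\<forall>x :: nat \<Rightarrow> 'a.
       (\<forall>n. x n \<in> carrier R \<and> x (Suc n) \<ominus>\<^bsub>R\<^esub> x n \<in> I [^]\<^bsub>ideals_set R\<^esub> n)
       \<longrightarrow> (\<exists>!y. y \<in> carrier R \<and> (\<forall>n. y \<ominus>\<^bsub>R\<^esub> x n \<in> I [^]\<^bsub>ideals_set R\<^esub> n)))"

definition has_characteristic :: "('a, 'r) ring_scheme \<Rightarrow> nat \<Rightarrow> bool"
  where "has_characteristic R p \<longleftrightarrow> (\<forall>n::nat. [n] \<cdot>\<^bsub>R\<^esub> \<one>\<^bsub>R\<^esub> = \<zero>\<^bsub>R\<^esub> \<longleftrightarrow> p dvd n)"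

definition minimal_prime :: "('a, 'r) ring_scheme \<Rightarrow> 'a set \<Rightarrow> bool"
  where "minimal_prime R P \<longleftrightarrow> primeideal P R \<and> (\<forall>Q. primeideal Q R \<and> Q \<subseteq> P \<longrightarrow> Q = P)"

definition ring_circ :: "('a, 'r) ring_scheme \<Rightarrow> 'a set"
  where "ring_circ R = {c \<in> carrier R. \<forall>P. minimal_prime R P \<longrightarrow> c \<notin> P}"


section \<open>Frobenius, tight closure and tight interior\<close>

definition frob_module :: "('a, 'r) ring_scheme \<Rightarrow> nat \<Rightarrow> nat \<Rightarrow> ('a, 'a) module"
  where "frob_module R p e =
    \<lparr>carrier = carrier R, monoid.mult = monoid.mult R, one = \<one>\<^bsub>R\<^esub>, ring.zero = \<zero>\<^bsub>R\<^esub>, ring.add = ring.add R,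
     smult = (\<lambda>r x. r [^]\<^bsub>R\<^esub> (p ^ e) \<otimes>\<^bsub>R\<^esub> x)\<rparr>"

definition F_finite :: "('a, 'r) ring_scheme \<Rightarrow> nat \<Rightarrow> bool"
  where "F_finite R p \<longleftrightarrow> fin_gen_module R (frob_module R p 1)"

definition tight_image :: "('a, 'r) ring_scheme \<Rightarrow> nat \<Rightarrow> ('a, 'b) module \<Rightarrow> 'a \<Rightarrow> nat \<Rightarrow> 'b set"
  where "tight_image R p M c e\<^sub>0 =
    submodule_generated R M (\<Union>e\<in>{e\<^sub>0..}. (\<lambda>g. g c) ` mod_hom R (frob_module R p e) M)"

definition tight_interior :: "('a, 'r) ring_scheme \<Rightarrow> nat \<Rightarrow> ('a, 'b) module \<Rightarrow> 'b set"
  where "tight_interior R p M = (\<Inter>c\<in>ring_circ R. \<Inter>e\<^sub>0. tight_image R p M c e\<^sub>0)"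

definition tight_closure_zero :: "('a, 'r) ring_scheme \<Rightarrow> nat \<Rightarrow> ('a, 'b) module \<Rightarrow> 'b set"
  where "tight_closure_zero R p M =
    {z \<in> carrier M. \<exists>c\<in>ring_circ R. \<forall>\<^sub>F e in sequentially.
       pure_tensor R (frob_module R p e) M c z = \<one>\<^bsub>tensor_product R (frob_module R p e) M\<^esub>}"


section \<open>Matlis duality\<close>

text \<open>In the following, E is meant to be an injective hull of the residue field.\<close>

definition matlis_dual :: "('a, 'r) ring_scheme \<Rightarrow> ('a, 'e) module \<Rightarrow> ('a, 'b) module \<Rightarrow> ('a, 'b \<Rightarrow> 'e) module"
  where "matlis_dual R E M = hom_module R M E"

definition matlis_dualizable :: "('a, 'r) ring_scheme \<Rightarrow> ('a, 'e) module \<Rightarrow> ('a, 'b) module \<Rightarrow> bool"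
  where "matlis_dualizable R E M \<longleftrightarrow>
    (\<lambda>x\<in>carrier M. \<lambda>\<phi>\<in>carrier (matlis_dual R E M). \<phi> x)
      \<in> mod_iso R M (matlis_dual R E (matlis_dual R E M))"

end

theory Submission
  imports Defs
begin

text \<open>
  Write \<open>M\<^sup>\<or>\<close> for \<open>Hom(M, E)\<close>.  The statement is formal as soon as \<open>L\<close> is reflexive, that is,
  as soon as \<open>L\<close> and \<open>L\<^sup>\<or>\<close> are in perfect duality through evaluation.

  Let \<open>V\<close> and \<open>W\<close> be modules with a perfect pairing to \<open>E\<close>.  By Hom-tensor adjunction, and since
  \<open>E\<close> separates the points of \<open>\<^sup>eR \<otimes> V\<close>, the element \<open>c \<otimes> z\<close> is zero if and only if \<open>z\<close> is
  orthogonal to all \<open>g c\<close> with \<open>g \<in> Hom(\<^sup>eR, W)\<close> (\<open>pure_tensor_zero_iff_pairing\<close>).  Every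
  submodule of \<open>W\<close> is the annihilator of its annihilator in \<open>V\<close>.  Applied to the submodule
  \<open>W\<^sub>*[c, p\<^sup>e]\<close>, generated by elements \<open>g c\<close>, this describes it as an annihilator; intersecting over \<open>c\<close>
  and \<open>e\<close> shows that the tight interior of \<open>W\<close> is the annihilator of \<open>0\<^sup>*\<close> in \<open>V\<close>
  (\<open>tight_interior_eq_perp\<close>).  The annihilator of a submodule \<open>Z\<close> of \<open>V\<close> is the dual of \<open>V / Z\<close>, and
  its dual is \<open>V / Z\<close>.  With \<open>V = L\<close>, \<open>W = L\<^sup>\<or>\<close> the former is the second isomorphism; with
  \<open>V = L\<^sup>\<or>\<close>, \<open>W = L\<close> the latter is the first.

  It remains to see that finitely generated and Artinian modules are reflexive.  The key is that
  every endomorphism of \<open>E\<close> is multiplication by a scalar (\<open>endomorphism_is_mult\<close>).  On the part of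
  \<open>E\<close> killed by a power of \<open>\<mm>\<close> this follows by Noetherian induction from the one-dimensionality of
  the socle; these parts exhaust \<open>E\<close>, and completeness glues the scalars.  Then linear algebra with
  functionals works as over a field: a functional vanishing on the common kernel of finitely many
  others is a combination of them (\<open>common_kernel_span\<close>).  For finitely generated \<open>M\<close> this is applied
  to the evaluations at the generators, as functionals on \<open>M\<^sup>\<or>\<close>.  For Artinian \<open>M\<close> it
  shows that \<open>M\<^sup>\<or>\<close> is finitely generated, hence reflexive, and then so is \<open>M\<close>.
\<close>

section \<open>Homomorphisms, quotients and submodules\<close>

lemma mod_homI:
  assumes "f \<in> extensional (carrier M)"
    and "\<And>x. x \<in> carrier M \<Longrightarrow> f x \<in> carrier N"
    and "\<And>x y. x \<in> carrier M \<Longrightarrow> y \<in> carrier M \<Longrightarrow> f (x \<oplus>\<^bsub>M\<^esub> y) = f x \<oplus>\<^bsub>N\<^esub> f y"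
    and "\<And>r x. r \<in> carrier R \<Longrightarrow> x \<in> carrier M \<Longrightarrow> f (r \<odot>\<^bsub>M\<^esub> x) = r \<odot>\<^bsub>N\<^esub> f x"
  shows "f \<in> mod_hom R M N"
  using assms by (auto simp: mod_hom_def PiE_def)

lemma mod_hom_extensional: "f \<in> mod_hom R M N \<Longrightarrow> f \<in> extensional (carrier M)"
  and mod_hom_closed: "f \<in> mod_hom R M N \<Longrightarrow> x \<in> carrier M \<Longrightarrow> f x \<in> carrier N"
  and mod_hom_add: "f \<in> mod_hom R M N \<Longrightarrow> x \<in> carrier M \<Longrightarrow> y \<in> carrier M \<Longrightarrow>
    f (x \<oplus>\<^bsub>M\<^esub> y) = f x \<oplus>\<^bsub>N\<^esub> f y"
  and mod_hom_smult: "f \<in> mod_hom R M N \<Longrightarrow> r \<in> carrier R \<Longrightarrow> x \<in> carrier M \<Longrightarrow>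
    f (r \<odot>\<^bsub>M\<^esub> x) = r \<odot>\<^bsub>N\<^esub> f x"
  by (auto simp: mod_hom_def PiE_def)

lemmas mod_hom_simps = mod_hom_closed mod_hom_add mod_hom_smult

lemma mod_hom_eqI:
  assumes "f \<in> mod_hom R M N" "g \<in> mod_hom R M P" "\<And>x. x \<in> carrier M \<Longrightarrow> f x = g x"
  shows "f = g"
  using assms by (meson extensionalityI mod_hom_extensional)

lemma (in abelian_group) minus_eq_zero_iff:
  assumes "x \<in> carrier G" "y \<in> carrier G"
  shows "x \<ominus> y = \<zero> \<longleftrightarrow> x = y"
  using assms by (metis a_minus_def add.inv_closed add.inv_equality add.inv_inv r_neg)

lemma (in abelian_group) minus_add_cancel:
  assumes "x \<in> carrier G" "y \<in> carrier G"
  shows "(x \<ominus> y) \<oplus> y = x"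
  using assms by (simp add: a_minus_def a_assoc l_neg)

lemma (in module) smult_left_commute:
  assumes "a \<in> carrier R" "b \<in> carrier R" "x \<in> carrier M"
  shows "a \<odot>\<^bsub>M\<^esub> (b \<odot>\<^bsub>M\<^esub> x) = b \<odot>\<^bsub>M\<^esub> (a \<odot>\<^bsub>M\<^esub> x)"
  using assms by (metis R.m_comm smult_assoc1)

lemma mod_hom_zero:
  assumes "module R M" "module R N" "f \<in> mod_hom R M N"
  shows "f \<zero>\<^bsub>M\<^esub> = \<zero>\<^bsub>N\<^esub>"
proof -
  interpret M: module R M by fact
  interpret N: module R N by fact
  have "f (\<zero>\<^bsub>R\<^esub> \<odot>\<^bsub>M\<^esub> \<zero>\<^bsub>M\<^esub>) = \<zero>\<^bsub>R\<^esub> \<odot>\<^bsub>N\<^esub> f \<zero>\<^bsub>M\<^esub>"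
    using assms(3) by (intro mod_hom_smult) auto
  then show ?thesis using assms(3) by (simp add: mod_hom_closed)
qed

lemma mod_hom_uminus:
  assumes "module R M" "module R N" "f \<in> mod_hom R M N" "x \<in> carrier M"
  shows "f (\<ominus>\<^bsub>M\<^esub> x) = \<ominus>\<^bsub>N\<^esub> f x"
proof -
  interpret M: module R M by fact
  interpret N: module R N by fact
  have "f (\<ominus>\<^bsub>R\<^esub> \<one>\<^bsub>R\<^esub> \<odot>\<^bsub>M\<^esub> x) = \<ominus>\<^bsub>R\<^esub> \<one>\<^bsub>R\<^esub> \<odot>\<^bsub>N\<^esub> f x"
    using assms(3,4) by (intro mod_hom_smult) auto
  then show ?thesis using assms(3,4) by (simp add: mod_hom_closed M.smult_l_minus N.smult_l_minus)
qed

lemma mod_hom_diff: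
  assumes "module R M" "module R N" "f \<in> mod_hom R M N" "x \<in> carrier M" "y \<in> carrier M"
  shows "f (x \<ominus>\<^bsub>M\<^esub> y) = f x \<ominus>\<^bsub>N\<^esub> f y"
proof -
  interpret M: module R M by fact
  show ?thesis using assms by (simp add: a_minus_def mod_hom_add mod_hom_uminus)
qed

lemma mod_hom_comp:
  assumes "f \<in> mod_hom R M N" "g \<in> mod_hom R N P" "abelian_group M"
    and "\<And>r x. r \<in> carrier R \<Longrightarrow> x \<in> carrier M \<Longrightarrow> r \<odot>\<^bsub>M\<^esub> x \<in> carrier M"
  shows "(\<lambda>x\<in>carrier M. g (f x)) \<in> mod_hom R M P"
proof -
  interpret M: abelian_group M by fact
  show ?thesis using assms by (intro mod_homI) (auto simp: mod_hom_simps)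
qed

lemma mod_hom_compose:
  assumes "f \<in> mod_hom R M N" "g \<in> mod_hom R N P" "module R M"
  shows "(\<lambda>x\<in>carrier M. g (f x)) \<in> mod_hom R M P"
  using assms by (intro mod_hom_comp) (auto simp: module_def module_axioms_def)

lemma submodule_closed:
  assumes "submodule H R M"
  shows "x \<in> H \<Longrightarrow> x \<in> carrier M" and "x \<in> H \<Longrightarrow> y \<in> H \<Longrightarrow> x \<oplus>\<^bsub>M\<^esub> y \<in> H"
    and "r \<in> carrier R \<Longrightarrow> x \<in> H \<Longrightarrow> r \<odot>\<^bsub>M\<^esub> x \<in> H" and "\<zero>\<^bsub>M\<^esub> \<in> H"
  using subgroup.subset[OF submodule.axioms(1)[OF assms]]
    subgroup.m_closed[OF submodule.axioms(1)[OF assms]]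
    subgroup.one_closed[OF submodule.axioms(1)[OF assms]] submodule.smult_closed[OF assms]
  by auto

lemma mod_hom_restrict:
  assumes "f \<in> mod_hom R M N" "submodule H R M"
  shows "restrict f H \<in> mod_hom R (M\<lparr>carrier := H\<rparr>) N"
  by (rule mod_homI) (use assms(1) submodule_closed[OF assms(2)] in \<open>simp_all add: mod_hom_simps\<close>)

lemma mod_hom_inclusion:
  assumes "submodule H R M"
  shows "(\<lambda>x\<in>H. x) \<in> mod_hom R (M\<lparr>carrier := H\<rparr>) M"
  by (rule mod_homI) (use submodule_closed[OF assms] in simp_all)

lemma mod_hom_image_submodule:
  assumes "module R M" "module R N" "f \<in> mod_hom R M N"
  shows "submodule (f ` carrier M) R N"
proof -
  interpret M: module R M by fact
  interpret N: module R N by fact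
  show ?thesis
  proof (rule N.submoduleI)
    show "f ` carrier M \<subseteq> carrier N" using assms(3) by (auto simp: mod_hom_closed)
    show "\<zero>\<^bsub>N\<^esub> \<in> f ` carrier M" using mod_hom_zero[OF assms] by (metis M.zero_closed imageI)
  next
    fix a assume "a \<in> f ` carrier M"
    then obtain x where "x \<in> carrier M" "a = f x" by blast
    then show "\<ominus>\<^bsub>N\<^esub> a \<in> f ` carrier M"
      using mod_hom_uminus[OF assms] by (intro image_eqI[of _ f "\<ominus>\<^bsub>M\<^esub> x"]) auto
  next
    fix a b assume "a \<in> f ` carrier M" "b \<in> f ` carrier M"
    then obtain x y where "x \<in> carrier M" "a = f x" "y \<in> carrier M" "b = f y" by blast
    then show "a \<oplus>\<^bsub>N\<^esub> b \<in> f ` carrier M"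
      using assms(3) by (intro image_eqI[of _ f "x \<oplus>\<^bsub>M\<^esub> y"]) (auto simp: mod_hom_add)
  next
    fix r a assume "r \<in> carrier R" "a \<in> f ` carrier M"
    then obtain x where "r \<in> carrier R" "x \<in> carrier M" "a = f x" by blast
    then show "r \<odot>\<^bsub>N\<^esub> a \<in> f ` carrier M"
      using assms(3) by (intro image_eqI[of _ f "r \<odot>\<^bsub>M\<^esub> x"]) (auto simp: mod_hom_smult)
  qed
qed

lemma mod_hom_kernel_submodule:
  assumes "module R M" "module R N" "f \<in> mod_hom R M N"
  shows "submodule {x \<in> carrier M. f x = \<zero>\<^bsub>N\<^esub>} R M"
proof -
  interpret M: module R M by fact
  interpret N: module R N by fact
  show ?thesis
    by (rule M.submoduleI)
      (use assms in \<open>auto simp: mod_hom_zero[OF assms] mod_hom_uminus mod_hom_simps\<close>)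
qed

lemma submodule_Inter:
  assumes "module R M" "\<And>i. i \<in> I \<Longrightarrow> submodule (H i) R M"
  shows "submodule {x \<in> carrier M. \<forall>i\<in>I. x \<in> H i} R M"
proof -
  interpret M: module R M by fact
  have "\<zero>\<^bsub>M\<^esub> \<in> H i" if "i \<in> I" for i
    using submodule.axioms(1)[OF assms(2)[OF that], THEN subgroup.one_closed] by simp
  with M.submoduleE[OF assms(2)] show ?thesis by (intro M.submoduleI) simp_all
qed

lemma submodule_generated_subset: "S \<subseteq> submodule_generated R M S"
  and submodule_generated_least:
    "submodule H R M \<Longrightarrow> S \<subseteq> H \<Longrightarrow> submodule_generated R M S \<subseteq> H"
  by (auto simp: submodule_generated_def)

lemma submodule_generated_submodule:
  assumes "module R M" "S \<subseteq> carrier M"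
  shows "submodule (submodule_generated R M S) R M"
proof -
  interpret M: module R M by fact
  have "submodule_generated R M S = {x \<in> carrier M. \<forall>H\<in>{H. submodule H R M \<and> S \<subseteq> H}. x \<in> H}"
    using M.carrier_is_submodule assms(2) by (auto simp: submodule_generated_def)
  then show ?thesis using submodule_Inter[OF assms(1), of "{H. submodule H R M \<and> S \<subseteq> H}" id] by simp
qed

lemma ring_module_module: "cring R \<Longrightarrow> module R (ring_module R)"
  using ring_module_ideal_module[of R "carrier R"] ring.oneideal[of R]
  by (simp add: ring_module_def cring_def)

lemma ideal_submodule:
  assumes "cring R" "ideal I R"
  shows "submodule I R (ring_module R)"
proof -
  interpret I: ideal I R by fact
  interpret M: module R "ring_module R" by (rule ring_module_module[OF assms(1)])
  show ?thesis
    by (rule M.module_incl_imp_submodule[OF _ ring_module_ideal_module[OF assms]])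
      (auto simp: ring_module_def)
qed

lemma colon_ideal:
  assumes "module R M" "submodule N R M" "x \<in> carrier M"
  shows "ideal {r \<in> carrier R. r \<odot>\<^bsub>M\<^esub> x \<in> N} R"
proof -
  interpret M: module R M by fact
  note N = submodule_closed[OF assms(2)] M.submoduleE(3)[OF assms(2)]
  show ?thesis
  proof (rule idealI)
    show "ring R" by (rule M.R.ring_axioms)
    show "subgroup {r \<in> carrier R. r \<odot>\<^bsub>M\<^esub> x \<in> N} (add_monoid R)"
      by (rule M.R.add.subgroupI)
        (use assms(3) N in
          \<open>auto simp: M.smult_l_distr M.smult_l_minus intro: exI[of _ "\<zero>\<^bsub>R\<^esub>"]\<close>)
    fix a r assume *: "a \<in> {r \<in> carrier R. r \<odot>\<^bsub>M\<^esub> x \<in> N}" "r \<in> carrier R"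
    then show "r \<otimes>\<^bsub>R\<^esub> a \<in> {r \<in> carrier R. r \<odot>\<^bsub>M\<^esub> x \<in> N}"
      using assms(3) N(3) by (simp add: M.smult_assoc1)
    then show "a \<otimes>\<^bsub>R\<^esub> r \<in> {r \<in> carrier R. r \<odot>\<^bsub>M\<^esub> x \<in> N}" using * by (simp add: M.R.m_comm)
  qed
qed

lemma mod_hom_cyclic:
  assumes "module R M" "x \<in> carrier M"
  shows "(\<lambda>r\<in>carrier R. r \<odot>\<^bsub>M\<^esub> x) \<in> mod_hom R (ring_module R) M"
proof -
  interpret M: module R M by fact
  show ?thesis using assms(2)
    by (intro mod_homI) (auto simp: ring_module_def M.smult_l_distr M.smult_assoc1)
qed

lemma mod_hom_mult:
  assumes "module R M" "r \<in> carrier R"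
  shows "(\<lambda>x\<in>carrier M. r \<odot>\<^bsub>M\<^esub> x) \<in> mod_hom R M M"
proof -
  interpret M: module R M by fact
  show ?thesis using assms(2)
    by (intro mod_homI) (auto simp: M.smult_r_distr M.R.m_comm simp flip: M.smult_assoc1)
qed

text \<open>Homomorphisms that vanish on the kernel of a surjection factor through it.  Quotients, images
  and inverses of isomorphisms are all treated through this property, so that cosets need to be
  handled only once.\<close>

lemma mod_hom_descend:
  assumes "module R A" "module R B" "module R P" "f \<in> mod_hom R A B" "f ` carrier A = carrier B"
    and "g \<in> mod_hom R A P" "\<And>x. x \<in> carrier A \<Longrightarrow> f x = \<zero>\<^bsub>B\<^esub> \<Longrightarrow> g x = \<zero>\<^bsub>P\<^esub>"
  obtains h where "h \<in> mod_hom R B P" "\<And>x. x \<in> carrier A \<Longrightarrow> h (f x) = g x"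
proof -
  interpret A: module R A by fact
  interpret B: module R B by fact
  interpret P: module R P by fact
  define h where "h = (\<lambda>b\<in>carrier B. g (inv_into (carrier A) f b))"
  have hf: "h (f x) = g x" if x: "x \<in> carrier A" for x
  proof -
    define y where "y = inv_into (carrier A) f (f x)"
    have y: "y \<in> carrier A" "f y = f x"
      using x by (auto simp: y_def inv_into_into f_inv_into_f)
    have "f (y \<ominus>\<^bsub>A\<^esub> x) = \<zero>\<^bsub>B\<^esub>"
      unfolding mod_hom_diff[OF assms(1,2,4) y(1) x]
      using x y assms(4) by (simp add: mod_hom_closed a_minus_def B.r_neg)
    then have "g y \<ominus>\<^bsub>P\<^esub> g x = \<zero>\<^bsub>P\<^esub>"
      using x y assms(7)[of "y \<ominus>\<^bsub>A\<^esub> x"] by (simp add: mod_hom_diff[OF assms(1,3,6)])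
    then have "g y = g x" using x y assms(6) by (simp add: mod_hom_closed P.minus_eq_zero_iff)
    then show ?thesis using x assms(4) by (simp add: h_def y_def mod_hom_closed)
  qed
  have "h \<in> mod_hom R B P"
  proof (rule mod_homI)
    show "h \<in> extensional (carrier B)" by (simp add: h_def)
  next
    fix b assume "b \<in> carrier B"
    then obtain x where "x \<in> carrier A" "b = f x" using assms(5) by blast
    then show "h b \<in> carrier P" using assms(6) hf by (simp add: mod_hom_closed)
  next
    fix b c assume "b \<in> carrier B" "c \<in> carrier B"
    then obtain x y where "x \<in> carrier A" "y \<in> carrier A" "b = f x" "c = f y" using assms(5) by blast
    then show "h (b \<oplus>\<^bsub>B\<^esub> c) = h b \<oplus>\<^bsub>P\<^esub> h c"
      using hf[of x] hf[of y] hf[of "x \<oplus>\<^bsub>A\<^esub> y"] assms(4,6) by (simp add: mod_hom_simps)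
  next
    fix r b assume "r \<in> carrier R" "b \<in> carrier B"
    then obtain x where "r \<in> carrier R" "x \<in> carrier A" "b = f x" using assms(5) by blast
    then show "h (r \<odot>\<^bsub>B\<^esub> b) = r \<odot>\<^bsub>P\<^esub> h b"
      using hf[of x] hf[of "r \<odot>\<^bsub>A\<^esub> x"] assms(4,6) by (simp add: mod_hom_simps)
  qed
  then show thesis using hf that by blast
qed

lemma hom_module_simps [simp]:
  "carrier (hom_module R M N) = mod_hom R M N"
  "\<zero>\<^bsub>hom_module R M N\<^esub> = (\<lambda>x\<in>carrier M. \<zero>\<^bsub>N\<^esub>)"
  "f \<oplus>\<^bsub>hom_module R M N\<^esub> g = (\<lambda>x\<in>carrier M. f x \<oplus>\<^bsub>N\<^esub> g x)"
  "r \<odot>\<^bsub>hom_module R M N\<^esub> f = (\<lambda>x\<in>carrier M. r \<odot>\<^bsub>N\<^esub> f x)"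
  by (simp_all add: hom_module_def)

lemma hom_module_module:
  assumes "module R M" "module R N"
  shows "module R (hom_module R M N)"
proof -
  interpret M: module R M by fact
  interpret N: module R N by fact
  have add: "f \<oplus>\<^bsub>hom_module R M N\<^esub> g \<in> mod_hom R M N"
    if "f \<in> mod_hom R M N" "g \<in> mod_hom R M N" for f g
    using that by (intro mod_homI) (auto simp: mod_hom_simps N.a_ac N.smult_r_distr)
  have smult: "r \<odot>\<^bsub>hom_module R M N\<^esub> f \<in> mod_hom R M N"
    if "r \<in> carrier R" "f \<in> mod_hom R M N" for r f
    using that
    by (intro mod_homI)
      (auto simp: mod_hom_simps N.smult_r_distr M.R.m_comm simp flip: N.smult_assoc1)
  have zero: "(\<lambda>x\<in>carrier M. \<zero>\<^bsub>N\<^esub>) \<in> mod_hom R M N"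
    by (intro mod_homI) auto
  show ?thesis
  proof (rule moduleI)
    show "cring R" by (rule M.R.cring_axioms)
    show "abelian_group (hom_module R M N)"
    proof (rule abelian_groupI)
      fix f assume f: "f \<in> carrier (hom_module R M N)"
      show "\<exists>g\<in>carrier (hom_module R M N). g \<oplus>\<^bsub>hom_module R M N\<^esub> f = \<zero>\<^bsub>hom_module R M N\<^esub>"
        using smult[of "\<ominus>\<^bsub>R\<^esub> \<one>\<^bsub>R\<^esub>" f] f
        by (intro bexI[of _ "\<ominus>\<^bsub>R\<^esub> \<one>\<^bsub>R\<^esub> \<odot>\<^bsub>hom_module R M N\<^esub> f"])
          (auto simp: mod_hom_simps N.smult_l_minus N.l_neg fun_eq_iff restrict_def)
      show "\<zero>\<^bsub>hom_module R M N\<^esub> \<oplus>\<^bsub>hom_module R M N\<^esub> f = f"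
        using f add[OF zero, of f] by (intro mod_hom_eqI) (auto simp: mod_hom_simps)
    qed (auto simp: add[simplified] zero mod_hom_simps N.a_ac intro!: restrict_ext)
    show "\<one>\<^bsub>R\<^esub> \<odot>\<^bsub>hom_module R M N\<^esub> f = f" if "f \<in> carrier (hom_module R M N)" for f
      using that smult[of "\<one>\<^bsub>R\<^esub>" f] by (intro mod_hom_eqI) (auto simp: mod_hom_closed)
  qed (auto simp: smult[simplified] mod_hom_simps N.smult_l_distr N.smult_r_distr
        N.smult_assoc1 intro!: restrict_ext)
qed

lemma hom_module_minus:
  assumes "module R M" "module R N" "f \<in> mod_hom R M N" "g \<in> mod_hom R M N" "x \<in> carrier M"
  shows "(f \<ominus>\<^bsub>hom_module R M N\<^esub> g) x = f x \<ominus>\<^bsub>N\<^esub> g x"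
proof -
  interpret M: module R M by fact
  interpret N: module R N by fact
  interpret H: module R "hom_module R M N" by (rule hom_module_module) fact+
  have "\<ominus>\<^bsub>hom_module R M N\<^esub> g = \<ominus>\<^bsub>R\<^esub> \<one>\<^bsub>R\<^esub> \<odot>\<^bsub>hom_module R M N\<^esub> g"
    using assms(4) by (simp add: H.smult_l_minus del: hom_module_simps(4))
  then have "(\<ominus>\<^bsub>hom_module R M N\<^esub> g) x = \<ominus>\<^bsub>N\<^esub> g x"
    using assms by (simp add: N.smult_l_minus mod_hom_closed)
  then show ?thesis using assms(5) by (simp add: a_minus_def)
qed

lemma mod_hom_eval:
  assumes "module R M" "module R N" "x \<in> carrier M"
  shows "(\<lambda>f\<in>mod_hom R M N. f x) \<in> mod_hom R (hom_module R M N) N"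
proof -
  interpret H: module R "hom_module R M N" by (rule hom_module_module) fact+
  show ?thesis
    using assms(3) H.a_closed H.smult_closed by (intro mod_homI) (auto simp: mod_hom_simps)
qed

text \<open>The axioms are only required modulo \<open>K\<close>.  In this form the lemma serves for quotients of
  modules and for the tensor product alike: the scalars act on the free abelian group of pairs,
  but that action becomes a module structure only modulo the bilinearity relations.\<close>

lemma quotient_module_module:
  fixes M :: "('a, 'b) module"
  assumes R: "cring R" and M: "abelian_group M" and K: "subgroup K (add_monoid M)"
    and closed: "\<And>r x. r \<in> carrier R \<Longrightarrow> x \<in> carrier M \<Longrightarrow> r \<odot>\<^bsub>M\<^esub> x \<in> carrier M"
    and distr: "\<And>r x y. r \<in> carrier R \<Longrightarrow> x \<in> carrier M \<Longrightarrow> y \<in> carrier M \<Longrightarrow>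
      r \<odot>\<^bsub>M\<^esub> (x \<oplus>\<^bsub>M\<^esub> y) = r \<odot>\<^bsub>M\<^esub> x \<oplus>\<^bsub>M\<^esub> r \<odot>\<^bsub>M\<^esub> y"
    and stable: "\<And>r x. r \<in> carrier R \<Longrightarrow> x \<in> K \<Longrightarrow> r \<odot>\<^bsub>M\<^esub> x \<in> K"
    and l_distr: "\<And>r t x. r \<in> carrier R \<Longrightarrow> t \<in> carrier R \<Longrightarrow> x \<in> carrier M \<Longrightarrow>
      (r \<oplus>\<^bsub>R\<^esub> t) \<odot>\<^bsub>M\<^esub> x \<ominus>\<^bsub>M\<^esub> (r \<odot>\<^bsub>M\<^esub> x \<oplus>\<^bsub>M\<^esub> t \<odot>\<^bsub>M\<^esub> x) \<in> K"
    and assoc: "\<And>r t x. r \<in> carrier R \<Longrightarrow> t \<in> carrier R \<Longrightarrow> x \<in> carrier M \<Longrightarrow>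
      (r \<otimes>\<^bsub>R\<^esub> t) \<odot>\<^bsub>M\<^esub> x \<ominus>\<^bsub>M\<^esub> r \<odot>\<^bsub>M\<^esub> (t \<odot>\<^bsub>M\<^esub> x) \<in> K"
    and one: "\<And>x. x \<in> carrier M \<Longrightarrow> \<one>\<^bsub>R\<^esub> \<odot>\<^bsub>M\<^esub> x \<ominus>\<^bsub>M\<^esub> x \<in> K"
  shows "module R (quotient_module M K)"
    and "(\<lambda>x\<in>carrier M. K +>\<^bsub>M\<^esub> x) \<in> mod_hom R M (quotient_module M K)"
    and "(\<lambda>x\<in>carrier M. K +>\<^bsub>M\<^esub> x) ` carrier M = carrier (quotient_module M K)"
    and "\<And>x. x \<in> carrier M \<Longrightarrow> K +>\<^bsub>M\<^esub> x = \<zero>\<^bsub>quotient_module M K\<^esub> \<longleftrightarrow> x \<in> K"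
proof -
  interpret R: cring R by fact
  interpret M: abelian_group M by fact
  interpret K: abelian_subgroup K M by (rule abelian_subgroupI3) (use K M in \<open>auto simp: additive_subgroup_def\<close>)
  let ?Q = "quotient_module M K"
  have cos: "K +>\<^bsub>M\<^esub> x = K +>\<^bsub>M\<^esub> y \<longleftrightarrow> x \<ominus>\<^bsub>M\<^esub> y \<in> K" if "x \<in> carrier M" "y \<in> carrier M" for x y
    using that K.a_rcos_module[of y x] K.a_rcos_self[of x] K.a_repr_independence'[of x y]
    by (auto simp: a_minus_def)
  have carr: "carrier ?Q = (\<lambda>x. K +>\<^bsub>M\<^esub> x) ` carrier M"
    by (auto simp: quotient_module_def A_RCOSETS_def')
  have add: "(K +>\<^bsub>M\<^esub> x) \<oplus>\<^bsub>?Q\<^esub> (K +>\<^bsub>M\<^esub> y) = K +>\<^bsub>M\<^esub> (x \<oplus>\<^bsub>M\<^esub> y)" if "x \<in> carrier M" "y \<in> carrier M" for x y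
    using that by (simp add: quotient_module_def K.a_rcos_sum)
  have zero: "\<zero>\<^bsub>?Q\<^esub> = K +>\<^bsub>M\<^esub> \<zero>\<^bsub>M\<^esub>"
    by (simp add: quotient_module_def M.a_coset_add_zero[OF K.a_subset])
  have smult: "r \<odot>\<^bsub>?Q\<^esub> (K +>\<^bsub>M\<^esub> x) = K +>\<^bsub>M\<^esub> (r \<odot>\<^bsub>M\<^esub> x)" if r: "r \<in> carrier R" and x: "x \<in> carrier M" for r x
  proof -
    have "K +>\<^bsub>M\<^esub> (r \<odot>\<^bsub>M\<^esub> y) = K +>\<^bsub>M\<^esub> (r \<odot>\<^bsub>M\<^esub> x)" if "y \<in> K +>\<^bsub>M\<^esub> x" for y
    proof -
      from that obtain k where k: "k \<in> K" "y = k \<oplus>\<^bsub>M\<^esub> x" by (auto simp: a_r_coset_def')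
      then have "r \<odot>\<^bsub>M\<^esub> y = r \<odot>\<^bsub>M\<^esub> k \<oplus>\<^bsub>M\<^esub> r \<odot>\<^bsub>M\<^esub> x" using distr r x by auto
      then have "r \<odot>\<^bsub>M\<^esub> y \<ominus>\<^bsub>M\<^esub> r \<odot>\<^bsub>M\<^esub> x = r \<odot>\<^bsub>M\<^esub> k"
        using k r x closed by (simp add: a_minus_def M.a_assoc M.r_neg)
      then show ?thesis using cos closed r x k stable by auto
    qed
    then have "r \<odot>\<^bsub>?Q\<^esub> (K +>\<^bsub>M\<^esub> x) = (\<Union>y\<in>K +>\<^bsub>M\<^esub> x. K +>\<^bsub>M\<^esub> (r \<odot>\<^bsub>M\<^esub> x))"
      unfolding quotient_module_def by simp
    also have "\<dots> = K +>\<^bsub>M\<^esub> (r \<odot>\<^bsub>M\<^esub> x)" using K.a_rcos_self[OF x] by blast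
    finally show ?thesis .
  qed
  have inv: "(K +>\<^bsub>M\<^esub> (\<ominus>\<^bsub>M\<^esub> x)) \<oplus>\<^bsub>?Q\<^esub> (K +>\<^bsub>M\<^esub> x) = \<zero>\<^bsub>?Q\<^esub>" if "x \<in> carrier M" for x
    using that by (simp add: add zero M.l_neg)
  show "module R ?Q"
  proof (rule moduleI)
    show "abelian_group ?Q"
    proof (rule abelian_groupI)
      fix C assume "C \<in> carrier ?Q"
      then show "\<exists>D\<in>carrier ?Q. D \<oplus>\<^bsub>?Q\<^esub> C = \<zero>\<^bsub>?Q\<^esub>" using inv unfolding carr by blast
    qed (auto simp: carr add zero M.a_ac)
    show "(r \<oplus>\<^bsub>R\<^esub> t) \<odot>\<^bsub>?Q\<^esub> C = r \<odot>\<^bsub>?Q\<^esub> C \<oplus>\<^bsub>?Q\<^esub> t \<odot>\<^bsub>?Q\<^esub> C"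
      if rt: "r \<in> carrier R" "t \<in> carrier R" and C: "C \<in> carrier ?Q" for r t C
    proof -
      obtain x where x: "x \<in> carrier M" "C = K +>\<^bsub>M\<^esub> x" using C carr by blast
      show ?thesis using cos l_distr[OF rt x(1)] rt x(1) by (simp add: x(2) smult add closed)
    qed
    show "(r \<otimes>\<^bsub>R\<^esub> t) \<odot>\<^bsub>?Q\<^esub> C = r \<odot>\<^bsub>?Q\<^esub> (t \<odot>\<^bsub>?Q\<^esub> C)"
      if rt: "r \<in> carrier R" "t \<in> carrier R" and C: "C \<in> carrier ?Q" for r t C
    proof -
      obtain x where x: "x \<in> carrier M" "C = K +>\<^bsub>M\<^esub> x" using C carr by blast
      show ?thesis using cos assoc[OF rt x(1)] rt x(1) by (simp add: x(2) smult closed)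
    qed
    show "\<one>\<^bsub>R\<^esub> \<odot>\<^bsub>?Q\<^esub> C = C" if C: "C \<in> carrier ?Q" for C
    proof -
      obtain x where x: "x \<in> carrier M" "C = K +>\<^bsub>M\<^esub> x" using C carr by blast
      show ?thesis using cos one[OF x(1)] x(1) by (simp add: x(2) smult closed)
    qed
  qed (auto simp: carr smult add closed distr R)
  show "(\<lambda>x\<in>carrier M. K +>\<^bsub>M\<^esub> x) \<in> mod_hom R M ?Q"
    by (rule mod_homI) (auto simp: carr smult add closed)
  show "(\<lambda>x\<in>carrier M. K +>\<^bsub>M\<^esub> x) ` carrier M = carrier ?Q" by (auto simp: carr)
  have m0: "\<ominus>\<^bsub>M\<^esub> \<zero>\<^bsub>M\<^esub> = \<zero>\<^bsub>M\<^esub>"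
    using M.r_neg[OF M.zero_closed] M.l_zero[OF M.a_inv_closed[OF M.zero_closed]] by metis
  show "K +>\<^bsub>M\<^esub> x = \<zero>\<^bsub>?Q\<^esub> \<longleftrightarrow> x \<in> K" if "x \<in> carrier M" for x
    using that cos[of x "\<zero>\<^bsub>M\<^esub>"] by (simp add: zero a_minus_def m0)
qed

lemma quotient_by_submodule:
  assumes "module R M" "submodule K R M"
  shows "module R (quotient_module M K)"
    and "(\<lambda>x\<in>carrier M. K +>\<^bsub>M\<^esub> x) \<in> mod_hom R M (quotient_module M K)"
    and "(\<lambda>x\<in>carrier M. K +>\<^bsub>M\<^esub> x) ` carrier M = carrier (quotient_module M K)"
    and "\<And>x. x \<in> carrier M \<Longrightarrow> K +>\<^bsub>M\<^esub> x = \<zero>\<^bsub>quotient_module M K\<^esub> \<longleftrightarrow> x \<in> K"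
proof -
  interpret M: module R M by fact
  interpret K: submodule K R M by fact
  have "x \<ominus>\<^bsub>M\<^esub> x \<in> K" if "x \<in> carrier M" for x
    using that K.one_closed by (simp add: a_minus_def M.r_neg)
  then show "module R (quotient_module M K)"
    and "(\<lambda>x\<in>carrier M. K +>\<^bsub>M\<^esub> x) \<in> mod_hom R M (quotient_module M K)"
    and "(\<lambda>x\<in>carrier M. K +>\<^bsub>M\<^esub> x) ` carrier M = carrier (quotient_module M K)"
    and "\<And>x. x \<in> carrier M \<Longrightarrow> K +>\<^bsub>M\<^esub> x = \<zero>\<^bsub>quotient_module M K\<^esub> \<longleftrightarrow> x \<in> K"
    using quotient_module_module[of R M K] M.R.cring_axioms M.M.abelian_group_axioms K.subgroup_axioms
    by (simp_all add: M.smult_l_distr M.smult_r_distr M.smult_assoc1)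
qed

lemma mod_isomorphic_sym:
  assumes M: "module R M" and N: "module R N" and iso: "mod_isomorphic R M N"
  shows "mod_isomorphic R N M"
proof -
  obtain f where f: "f \<in> mod_hom R M N" "bij_betw f (carrier M) (carrier N)"
    using iso by (auto simp: mod_isomorphic_def mod_iso_def)
  have id: "(\<lambda>x\<in>carrier M. x) \<in> mod_hom R M M"
    using mod_hom_inclusion[OF module.carrier_is_submodule[OF M]] by simp
  have ker: "(\<lambda>x\<in>carrier M. x) x = \<zero>\<^bsub>M\<^esub>" if "x \<in> carrier M" "f x = \<zero>\<^bsub>N\<^esub>" for x
  proof -
    interpret M: module R M by (rule M)
    have "f x = f \<zero>\<^bsub>M\<^esub>" using that mod_hom_zero[OF M N f(1)] by simp
    then have "x = \<zero>\<^bsub>M\<^esub>" using f(2) that(1) by (auto simp: bij_betw_def dest: inj_onD)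
    then show ?thesis using that(1) by simp
  qed
  obtain h where h: "h \<in> mod_hom R N M" "\<And>x. x \<in> carrier M \<Longrightarrow> h (f x) = (\<lambda>x\<in>carrier M. x) x"
    by (rule mod_hom_descend[OF M N M f(1) bij_betw_imp_surj_on[OF f(2)] id]) (use ker in auto)
  have "bij_betw h (carrier N) (carrier M)"
  proof (rule bij_betw_byWitness[of _ f])
    show "\<forall>y\<in>carrier N. f (h y) = y"
    proof
      fix y assume "y \<in> carrier N"
      then obtain x where "x \<in> carrier M" "y = f x" using bij_betw_imp_surj_on[OF f(2)] by blast
      then show "f (h y) = y" using h(2) by simp
    qed
  qed (use h f(1) in \<open>auto simp: mod_hom_closed\<close>)
  then show ?thesis using h(1) by (auto simp: mod_isomorphic_def mod_iso_def)
qed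

lemma first_isomorphism:
  assumes "module R M" "module R P" "submodule K R M" "g \<in> mod_hom R M P"
    and "g ` carrier M = carrier P" "\<And>x. x \<in> carrier M \<Longrightarrow> g x = \<zero>\<^bsub>P\<^esub> \<longleftrightarrow> x \<in> K"
  shows "mod_isomorphic R P (quotient_module M K)"
proof -
  interpret M: module R M by fact
  note Q = quotient_by_submodule[OF assms(1,3)]
  let ?\<pi> = "\<lambda>x\<in>carrier M. K +>\<^bsub>M\<^esub> x"
  obtain h where h: "h \<in> mod_hom R P (quotient_module M K)" "\<And>x. x \<in> carrier M \<Longrightarrow> h (g x) = ?\<pi> x"
    by (rule mod_hom_descend[OF assms(1,2) Q(1) assms(4,5) Q(2)]) (use assms(6) Q(4) in auto)
  have surj: "h ` carrier P = carrier (quotient_module M K)"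
  proof
    show "h ` carrier P \<subseteq> carrier (quotient_module M K)" using h(1) by (auto simp: mod_hom_closed)
    show "carrier (quotient_module M K) \<subseteq> h ` carrier P"
    proof
      fix C assume "C \<in> carrier (quotient_module M K)"
      then obtain x where x: "x \<in> carrier M" "C = ?\<pi> x" unfolding Q(3)[symmetric] by (rule imageE)
      then have "C = h (g x)" by (simp only: h(2))
      then show "C \<in> h ` carrier P" using mod_hom_closed[OF assms(4) x(1)] by (rule image_eqI)
    qed
  qed
  have inj: "inj_on h (carrier P)"
  proof (rule inj_onI)
    fix a b assume ab: "a \<in> carrier P" "b \<in> carrier P" "h a = h b"
    have "\<exists>x\<in>carrier M. c = g x" if "c \<in> carrier P" for c
      using that unfolding assms(5)[symmetric] by blast
    then obtain x y where xy: "x \<in> carrier M" "y \<in> carrier M" "a = g x" "b = g y"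
      using ab(1,2) by meson
    interpret P: module R P by fact
    interpret Q: module R "quotient_module M K" by (rule Q(1))
    have "?\<pi> (x \<ominus>\<^bsub>M\<^esub> y) = ?\<pi> x \<ominus>\<^bsub>quotient_module M K\<^esub> ?\<pi> y"
      by (rule mod_hom_diff[OF assms(1) Q(1,2) xy(1,2)])
    also have "?\<pi> x = ?\<pi> y" using ab(3) h(2)[OF xy(1)] h(2)[OF xy(2)] xy(3,4) by simp
    also have "?\<pi> y \<ominus>\<^bsub>quotient_module M K\<^esub> ?\<pi> y = \<zero>\<^bsub>quotient_module M K\<^esub>"
      using mod_hom_closed[OF Q(2) xy(2)] by (simp add: a_minus_def Q.r_neg del: restrict_apply)
    finally have "x \<ominus>\<^bsub>M\<^esub> y \<in> K" using Q(4) xy by simp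
    then have "g x \<ominus>\<^bsub>P\<^esub> g y = \<zero>\<^bsub>P\<^esub>"
      using assms(6)[of "x \<ominus>\<^bsub>M\<^esub> y"] xy by (simp add: mod_hom_diff[OF assms(1,2,4)])
    then show "a = b" using ab xy by (simp add: P.minus_eq_zero_iff)
  qed
  have "h \<in> mod_iso R P (quotient_module M K)"
    using h(1) surj inj by (simp add: mod_iso_def bij_betw_def)
  then show ?thesis by (auto simp: mod_isomorphic_def)
qed

section \<open>The injective hull of the residue field as a cogenerator\<close>

lemma (in noetherian_ring) maximal_ideal_in_set:
  assumes "S \<noteq> {}" "\<And>I. I \<in> S \<Longrightarrow> ideal I R"
  obtains I where "I \<in> S" "\<And>J. J \<in> S \<Longrightarrow> I \<subseteq> J \<Longrightarrow> J = I"
proof -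
  have "\<exists>I\<in>S. \<forall>J\<in>S. I \<subseteq> J \<longrightarrow> J = I"
  proof (rule subset_Zorn_nonempty[OF assms(1)])
    fix C assume C: "C \<noteq> {}" "subset.chain S C"
    then have "subset.chain {I. ideal I R} C" using assms(2) by (auto simp: subset_chain_def)
    with C show "\<Union>C \<in> S" using ideal_chain_is_trivial[of C] by (auto simp: subset_chain_def)
  qed
  then show thesis using that by blast
qed

text \<open>In a Noetherian ring a maximal ideal above a proper ideal comes from the chain condition.\<close>

lemma noetherian_local_ideal_le:
  assumes "noetherian_ring R" "local_ring R \<mm>" "ideal I R" "\<one>\<^bsub>R\<^esub> \<notin> I"
  shows "I \<subseteq> \<mm>"
proof -
  interpret noetherian_ring R by fact
  let ?S = "{J. ideal J R \<and> I \<subseteq> J \<and> \<one>\<^bsub>R\<^esub> \<notin> J}"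
  obtain J where J: "J \<in> ?S" and max: "\<And>K. K \<in> ?S \<Longrightarrow> J \<subseteq> K \<Longrightarrow> K = J"
    by (rule maximal_ideal_in_set[of ?S]) (use assms(3,4) in auto)
  have "maximalideal J R"
  proof (rule maximalidealI)
    show "ideal J R" "carrier R \<noteq> J" using J by auto
    fix K assume K: "ideal K R" "J \<subseteq> K" "K \<subseteq> carrier R"
    show "K = J \<or> K = carrier R"
    proof (cases "\<one>\<^bsub>R\<^esub> \<in> K")
      case True
      then show ?thesis using ideal.one_imp_carrier[OF K(1)] by simp
    next
      case False
      then show ?thesis using max[of K] K J by blast
    qed
  qed
  then have "J = \<mm>" using assms(2) by (simp add: local_ring_def)
  then show ?thesis using J by blast
qed

text \<open>Injectivity for a map \<open>f\<close> that need not be injective: \<open>g\<close> descends to the image of \<open>f\<close>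
  and extends from there.\<close>

lemma injective_factor:
  assumes E: "injective_module R E" and A: "module R A" and B: "module R B"
    and f: "f \<in> mod_hom R A B" and g: "g \<in> mod_hom R A E"
    and ker: "\<And>x. x \<in> carrier A \<Longrightarrow> f x = \<zero>\<^bsub>B\<^esub> \<Longrightarrow> g x = \<zero>\<^bsub>E\<^esub>"
  obtains h where "h \<in> mod_hom R B E" "\<And>x. x \<in> carrier A \<Longrightarrow> h (f x) = g x"
proof -
  have ME: "module R E" using E by (simp add: injective_module_def)
  let ?C = "B\<lparr>carrier := f ` carrier A\<rparr>"
  have sub: "submodule (f ` carrier A) R B" by (rule mod_hom_image_submodule[OF A B f])
  have C: "module R ?C" by (rule submodule.submodule_is_module[OF sub B])
  have fC: "f \<in> mod_hom R A ?C"
    by (rule mod_homI) (use f in \<open>simp_all add: mod_hom_simps mod_hom_extensional\<close>)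
  obtain k where k: "k \<in> mod_hom R ?C E" "\<And>x. x \<in> carrier A \<Longrightarrow> k (f x) = g x"
    by (rule mod_hom_descend[OF A C ME fC _ g]) (use ker in auto)
  obtain h where "h \<in> mod_hom R B E" "\<forall>y\<in>carrier ?C. h ((\<lambda>y\<in>f ` carrier A. y) y) = k y"
    using injective_module_extension[OF E C B mod_hom_inclusion[OF sub] _ k(1)]
    by (auto simp: inj_on_def)
  then show thesis using k(2) that by auto
qed

text \<open>The injective hull enters only through its injectivity and an element \<open>s\<close> that spans a copy of
  the residue field meeting every nonzero submodule.\<close>

locale matlis_setting =
  fixes R :: "('a, 'r) ring_scheme" and \<mm> :: "'a set" and E :: "('a, 'e) module" and s :: 'e
  assumes local: "local_ring R \<mm>" and noetherian: "noetherian_ring R"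
    and injective: "injective_module R E"
    and s_closed: "s \<in> carrier E" and s_nonzero: "s \<noteq> \<zero>\<^bsub>E\<^esub>"
    and s_killed: "\<And>r. r \<in> \<mm> \<Longrightarrow> r \<odot>\<^bsub>E\<^esub> s = \<zero>\<^bsub>E\<^esub>"
    and essential: "\<And>e. e \<in> carrier E \<Longrightarrow> e \<noteq> \<zero>\<^bsub>E\<^esub> \<Longrightarrow>
      \<exists>r\<in>carrier R. r \<odot>\<^bsub>E\<^esub> e \<noteq> \<zero>\<^bsub>E\<^esub> \<and> (\<exists>t\<in>carrier R. r \<odot>\<^bsub>E\<^esub> e = t \<odot>\<^bsub>E\<^esub> s)"
begin

lemma cring: "cring R" using local by (simp add: local_ring_def)

lemma module_E: "module R E" using injective by (simp add: injective_module_def)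

sublocale R: cring R by (rule cring)

sublocale R: noetherian_ring R by (rule noetherian)

sublocale E: module R E by (rule module_E)

lemma max_ideal: "maximalideal \<mm> R" using local by (simp add: local_ring_def)

lemma ideal_max: "ideal \<mm> R" using max_ideal by (rule maximalideal.axioms)

lemma max_closed: "r \<in> \<mm> \<Longrightarrow> r \<in> carrier R" by (rule ideal.Icarr[OF ideal_max])

lemma proper_ideal_le: "ideal I R \<Longrightarrow> \<one>\<^bsub>R\<^esub> \<notin> I \<Longrightarrow> I \<subseteq> \<mm>"
  using noetherian_local_ideal_le[OF noetherian local] .

lemma notin_max_invertible:
  assumes "r \<in> carrier R" "r \<notin> \<mm>"
  obtains u where "u \<in> carrier R" "u \<otimes>\<^bsub>R\<^esub> r = \<one>\<^bsub>R\<^esub>"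
proof -
  have "\<one>\<^bsub>R\<^esub> \<in> PIdl\<^bsub>R\<^esub> r"
    using proper_ideal_le[OF R.cgenideal_ideal[OF assms(1)]] R.cgenideal_self[OF assms(1)] assms(2)
    by blast
  then show thesis using that by (auto simp: cgenideal_def)
qed

text \<open>Essentiality moves a socle element \<open>e\<close> into \<open>R s\<close> by some scalar \<open>r\<close>; as \<open>\<mm>\<close> kills
  \<open>e\<close>, this \<open>r\<close> is a unit.\<close>

lemma socle_generated:
  assumes e: "e \<in> carrier E" and killed: "\<And>r. r \<in> \<mm> \<Longrightarrow> r \<odot>\<^bsub>E\<^esub> e = \<zero>\<^bsub>E\<^esub>"
  obtains t where "t \<in> carrier R" "e = t \<odot>\<^bsub>E\<^esub> s"
proof (cases "e = \<zero>\<^bsub>E\<^esub>")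
  case True
  then show thesis using that[of "\<zero>\<^bsub>R\<^esub>"] s_closed by simp
next
  case False
  then obtain r t where rt: "r \<in> carrier R" "t \<in> carrier R" "r \<odot>\<^bsub>E\<^esub> e \<noteq> \<zero>\<^bsub>E\<^esub>" "r \<odot>\<^bsub>E\<^esub> e = t \<odot>\<^bsub>E\<^esub> s"
    using essential[OF e] by metis
  then have "r \<notin> \<mm>" using killed by blast
  then obtain u where u: "u \<in> carrier R" "u \<otimes>\<^bsub>R\<^esub> r = \<one>\<^bsub>R\<^esub>" by (rule notin_max_invertible[OF rt(1)])
  have "e = (u \<otimes>\<^bsub>R\<^esub> r) \<odot>\<^bsub>E\<^esub> e" using u(2) e by simp
  also have "\<dots> = (u \<otimes>\<^bsub>R\<^esub> t) \<odot>\<^bsub>E\<^esub> s" using u(1) rt e s_closed by (simp add: E.smult_assoc1)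
  finally show thesis using u(1) rt(2) by (intro that[of "u \<otimes>\<^bsub>R\<^esub> t"]) auto
qed

text \<open>\<open>E\<close> is a cogenerator: the annihilator of the class of \<open>x\<close> in \<open>M / N\<close> is a proper ideal, hence
  lies in \<open>\<mm>\<close>, which kills \<open>s\<close>; so the cyclic module generated by the class maps to \<open>E\<close> by
  sending the class to \<open>s\<close>, and this map extends to \<open>M / N\<close>.\<close>

lemma separation:
  assumes M: "module R M" and N: "submodule N R M" and x: "x \<in> carrier M" "x \<notin> N"
  obtains \<phi> where "\<phi> \<in> mod_hom R M E" "\<And>n. n \<in> N \<Longrightarrow> \<phi> n = \<zero>\<^bsub>E\<^esub>" "\<phi> x \<noteq> \<zero>\<^bsub>E\<^esub>"
proof -
  interpret M: module R M by fact
  let ?Q = "quotient_module M N" and ?\<pi> = "\<lambda>x\<in>carrier M. N +>\<^bsub>M\<^esub> x"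
  note Q = quotient_by_submodule[OF M N]
  interpret Q: module R ?Q by (rule Q(1))
  let ?f = "\<lambda>r\<in>carrier R. r \<odot>\<^bsub>?Q\<^esub> ?\<pi> x" and ?g = "\<lambda>r\<in>carrier R. r \<odot>\<^bsub>E\<^esub> s"
  have RR: "module R (ring_module R)" by (rule ring_module_module[OF cring])
  have f: "?f \<in> mod_hom R (ring_module R) ?Q"
    by (rule mod_hom_cyclic[OF Q(1) mod_hom_closed[OF Q(2) x(1)]])
  have g: "?g \<in> mod_hom R (ring_module R) E" by (rule mod_hom_cyclic[OF module_E s_closed])
  let ?I = "{r \<in> carrier R. r \<odot>\<^bsub>M\<^esub> x \<in> N}"
  have fI: "?f r = \<zero>\<^bsub>?Q\<^esub> \<longleftrightarrow> r \<in> ?I" if "r \<in> carrier R" for r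
    using that x(1) Q(4)[of "r \<odot>\<^bsub>M\<^esub> x"] mod_hom_smult[OF Q(2) that x(1)] by simp
  have "?I \<subseteq> \<mm>" using x by (intro proper_ideal_le colon_ideal[OF M N x(1)]) simp
  then have "?g r = \<zero>\<^bsub>E\<^esub>" if "r \<in> carrier (ring_module R)" "?f r = \<zero>\<^bsub>?Q\<^esub>" for r
    using that fI[of r] s_killed by (auto simp: ring_module_def)
  then obtain h where h: "h \<in> mod_hom R ?Q E" "\<And>r. r \<in> carrier (ring_module R) \<Longrightarrow> h (?f r) = ?g r"
    using injective_factor[OF injective RR Q(1) f g] by blast
  let ?\<phi> = "\<lambda>y\<in>carrier M. h (?\<pi> y)"
  show thesis
  proof (rule that[of ?\<phi>])
    show "?\<phi> \<in> mod_hom R M E" by (rule mod_hom_compose[OF Q(2) h(1) M])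
    show "?\<phi> n = \<zero>\<^bsub>E\<^esub>" if "n \<in> N" for n
      using that submodule_closed(1)[OF N that] Q(4)[of n] mod_hom_zero[OF Q(1) module_E h(1)] by simp
    have "h (?f \<one>\<^bsub>R\<^esub>) = s" using h(2)[of "\<one>\<^bsub>R\<^esub>"] s_closed by (simp add: ring_module_def)
    then have "?\<phi> x = s" using x(1) mod_hom_closed[OF Q(2) x(1)] by simp
    then show "?\<phi> x \<noteq> \<zero>\<^bsub>E\<^esub>" using s_nonzero by simp
  qed
qed

lemma separation_zero:
  assumes "module R M" "x \<in> carrier M" "x \<noteq> \<zero>\<^bsub>M\<^esub>"
  obtains \<phi> where "\<phi> \<in> mod_hom R M E" "\<phi> x \<noteq> \<zero>\<^bsub>E\<^esub>"
proof -
  interpret M: module R M by fact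
  have "submodule {\<zero>\<^bsub>M\<^esub>} R M" by (rule M.submoduleI) auto
  then show thesis using separation[OF assms(1)] assms(2,3) that by blast
qed

end

text \<open>The image of \<open>\<one>\<close> under the embedding of \<open>R / \<mm>\<close> generates the socle of \<open>E\<close>.\<close>

lemma injective_hull_matlis_setting:
  assumes loc: "local_ring R \<mm>" and "noetherian_ring R"
    and hull: "injective_hull R (quotient_module (ring_module R) \<mm>) E"
  obtains s where "matlis_setting R \<mm> E s"
proof -
  let ?RR = "ring_module R" let ?Q = "quotient_module ?RR \<mm>"
  have cr: "cring R" and mx: "maximalideal \<mm> R" using loc by (simp_all add: local_ring_def)
  interpret R: cring R by fact
  interpret m: maximalideal \<mm> R by fact
  have inj: "injective_module R E" using hull by (simp add: injective_hull_def)
  then interpret E: module R E by (simp add: injective_module_def)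
  obtain i where i: "i \<in> mod_hom R ?Q E" "inj_on i (carrier ?Q)"
    and ess: "\<And>N. submodule N R E \<Longrightarrow> N \<inter> i ` carrier ?Q = {\<zero>\<^bsub>E\<^esub>} \<Longrightarrow> N = {\<zero>\<^bsub>E\<^esub>}"
    using hull unfolding injective_hull_def by blast
  have RR: "module R ?RR" by (rule ring_module_module[OF cr])
  have carr: "carrier ?RR = carrier R" "smult ?RR = monoid.mult R" by (simp_all add: ring_module_def)
  note Q = quotient_by_submodule[OF RR ideal_submodule[OF cr m.is_ideal], unfolded carr]
  interpret Q: module R ?Q by (rule Q(1))
  let ?\<pi> = "\<lambda>r\<in>carrier R. \<mm> +>\<^bsub>?RR\<^esub> r"
  define s where "s = i (?\<pi> \<one>\<^bsub>R\<^esub>)"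
  have pi_mult: "?\<pi> r = r \<odot>\<^bsub>?Q\<^esub> ?\<pi> \<one>\<^bsub>R\<^esub>" if "r \<in> carrier R" for r
    using mod_hom_smult[OF Q(2) that, unfolded carr, of "\<one>\<^bsub>R\<^esub>"] that by simp
  have pi_closed: "?\<pi> r \<in> carrier ?Q" if "r \<in> carrier R" for r
    using mod_hom_closed[OF Q(2), unfolded carr] that by simp
  have i_pi: "i (?\<pi> r) = r \<odot>\<^bsub>E\<^esub> s" if "r \<in> carrier R" for r
    using mod_hom_smult[OF i(1) that pi_closed[OF R.one_closed]] pi_mult[OF that] by (simp add: s_def)
  have i0: "i \<zero>\<^bsub>?Q\<^esub> = \<zero>\<^bsub>E\<^esub>" by (rule mod_hom_zero[OF Q(1) E.module_axioms i(1)])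
  have s: "s \<in> carrier E" using i(1) pi_closed[of "\<one>\<^bsub>R\<^esub>"] by (simp add: s_def mod_hom_closed)
  have rs: "r \<odot>\<^bsub>E\<^esub> s = \<zero>\<^bsub>E\<^esub> \<longleftrightarrow> r \<in> \<mm>" if r: "r \<in> carrier R" for r
  proof -
    have "r \<odot>\<^bsub>E\<^esub> s = \<zero>\<^bsub>E\<^esub> \<longleftrightarrow> ?\<pi> r = \<zero>\<^bsub>?Q\<^esub>"
      using inj_on_eq_iff[OF i(2) pi_closed[OF r] Q.zero_closed] i0 i_pi[OF r] by simp
    then show ?thesis using Q(4)[OF r] r by simp
  qed
  have image: "i ` carrier ?Q = (\<lambda>r. r \<odot>\<^bsub>E\<^esub> s) ` carrier R"
    unfolding Q(3)[symmetric] image_image by (rule image_cong) (use i_pi in auto)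
  have "matlis_setting R \<mm> E s"
  proof (rule matlis_setting.intro)
    show "local_ring R \<mm>" "noetherian_ring R" "injective_module R E" "s \<in> carrier E" by fact+
    show "s \<noteq> \<zero>\<^bsub>E\<^esub>" using rs[of "\<one>\<^bsub>R\<^esub>"] s m.one_imp_carrier m.I_notcarr by auto
    show "r \<odot>\<^bsub>E\<^esub> s = \<zero>\<^bsub>E\<^esub>" if "r \<in> \<mm>" for r using rs that m.Icarr by blast
    fix e assume e: "e \<in> carrier E" "e \<noteq> \<zero>\<^bsub>E\<^esub>"
    let ?N = "(\<lambda>r\<in>carrier R. r \<odot>\<^bsub>E\<^esub> e) ` carrier ?RR"
    have N: "submodule ?N R E"
      by (rule mod_hom_image_submodule[OF RR E.module_axioms mod_hom_cyclic[OF E.module_axioms e(1)]])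
    have "e \<in> ?N" using e(1) by (intro image_eqI[of _ _ "\<one>\<^bsub>R\<^esub>"]) (auto simp: carr)
    then have "?N \<inter> i ` carrier ?Q \<noteq> {\<zero>\<^bsub>E\<^esub>}" using ess[OF N] e(2) by blast
    moreover have "\<zero>\<^bsub>E\<^esub> \<in> ?N \<inter> i ` carrier ?Q"
      using submodule_closed(4)[OF N] i0 Q.zero_closed by (metis IntI imageI)
    ultimately obtain y where "y \<in> ?N" "y \<in> i ` carrier ?Q" "y \<noteq> \<zero>\<^bsub>E\<^esub>" by blast
    then show "\<exists>r\<in>carrier R. r \<odot>\<^bsub>E\<^esub> e \<noteq> \<zero>\<^bsub>E\<^esub> \<and> (\<exists>t\<in>carrier R. r \<odot>\<^bsub>E\<^esub> e = t \<odot>\<^bsub>E\<^esub> s)"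
      unfolding image carr by auto
  qed
  then show thesis by (rule that)
qed

section \<open>Endomorphisms of the injective hull\<close>

context matlis_setting
begin

definition annihilated :: "'a set \<Rightarrow> 'e set"
  where "annihilated I = {e \<in> carrier E. \<forall>r\<in>I. r \<odot>\<^bsub>E\<^esub> e = \<zero>\<^bsub>E\<^esub>}"

lemma annihilated_submodule:
  assumes "I \<subseteq> carrier R"
  shows "submodule (annihilated I) R E"
proof (rule E.submoduleI)
  show "a \<odot>\<^bsub>E\<^esub> x \<in> annihilated I" if "a \<in> carrier R" "x \<in> annihilated I" for a x
  proof -
    have "r \<odot>\<^bsub>E\<^esub> (a \<odot>\<^bsub>E\<^esub> x) = a \<odot>\<^bsub>E\<^esub> (r \<odot>\<^bsub>E\<^esub> x)" if "r \<in> I" for r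
      using that assms \<open>a \<in> carrier R\<close> \<open>x \<in> annihilated I\<close>
      by (intro E.smult_left_commute) (auto simp: annihilated_def)
    then show ?thesis using that by (auto simp: annihilated_def)
  qed
qed (use assms in \<open>auto simp: annihilated_def E.smult_r_distr E.smult_r_minus subset_iff\<close>)

text \<open>The double annihilator of an ideal is the ideal, because \<open>E\<close> separates the points of
  \<open>R / I\<close>.\<close>

lemma ideal_separation:
  assumes "ideal I R" "r \<in> carrier R" "r \<notin> I"
  obtains e where "e \<in> annihilated I" "r \<odot>\<^bsub>E\<^esub> e \<noteq> \<zero>\<^bsub>E\<^esub>"
proof -
  have carr: "carrier (ring_module R) = carrier R" "smult (ring_module R) = monoid.mult R"
    by (simp_all add: ring_module_def)
  obtain \<phi> where \<phi>: "\<phi> \<in> mod_hom R (ring_module R) E"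
    and 0: "\<And>n. n \<in> I \<Longrightarrow> \<phi> n = \<zero>\<^bsub>E\<^esub>" and r: "\<phi> r \<noteq> \<zero>\<^bsub>E\<^esub>"
    using separation[OF ring_module_module[OF cring] ideal_submodule[OF cring assms(1)], of r] assms
    by (auto simp: carr)
  have mult: "\<phi> t = t \<odot>\<^bsub>E\<^esub> \<phi> \<one>\<^bsub>R\<^esub>" if "t \<in> carrier R" for t
    using mod_hom_smult[OF \<phi> that, of "\<one>\<^bsub>R\<^esub>"] that by (simp add: carr)
  show thesis
  proof (rule that[of "\<phi> \<one>\<^bsub>R\<^esub>"])
    show "\<phi> \<one>\<^bsub>R\<^esub> \<in> annihilated I"
      using mod_hom_closed[OF \<phi>, of "\<one>\<^bsub>R\<^esub>"] 0 ideal.Icarr[OF assms(1)]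
      by (simp add: annihilated_def carr flip: mult)
    show "r \<odot>\<^bsub>E\<^esub> \<phi> \<one>\<^bsub>R\<^esub> \<noteq> \<zero>\<^bsub>E\<^esub>" using r mult[OF assms(2)] by simp
  qed
qed

definition max_power :: "nat \<Rightarrow> 'a set"
  where "max_power n = \<mm> [^]\<^bsub>ideals_set R\<^esub> n"

lemma max_power_simps:
  "max_power 0 = carrier R" "max_power (Suc n) = ideal_prod R (max_power n) \<mm>"
  by (simp_all add: max_power_def nat_pow_def ideals_set_def)

lemma max_power_ideal: "ideal (max_power n) R"
proof (induction n)
  case 0
  show ?case by (simp add: max_power_simps(1) R.oneideal)
next
  case (Suc n)
  then show ?case using R.ideal_prod_is_ideal[OF _ ideal_max] by (simp only: max_power_simps(2))
qed

lemma max_power_closed: "r \<in> max_power n \<Longrightarrow> r \<in> carrier R"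
  by (rule ideal.Icarr[OF max_power_ideal])

lemma max_power_antimono: "m \<le> n \<Longrightarrow> max_power n \<subseteq> max_power m"
proof (induction rule: inc_induct)
  case (step k)
  have "max_power (Suc k) \<subseteq> max_power k"
    unfolding max_power_simps(2) using R.ideal_prod_inter[OF max_power_ideal ideal_max] by blast
  with step show ?case by blast
qed auto

lemma annihilated_max_power_mono: "m \<le> n \<Longrightarrow> annihilated (max_power m) \<subseteq> annihilated (max_power n)"
  using max_power_antimono by (auto simp: annihilated_def)

lemma annihilated_max_power_Suc:
  assumes e: "e \<in> carrier E" and x: "\<And>x. x \<in> \<mm> \<Longrightarrow> x \<odot>\<^bsub>E\<^esub> e \<in> annihilated (max_power n)"
  shows "e \<in> annihilated (max_power (Suc n))"
proof -
  have "r \<odot>\<^bsub>E\<^esub> e = \<zero>\<^bsub>E\<^esub>" if "r \<in> ideal_prod R (max_power n) \<mm>" for r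
    using that
  proof induction
    case (prod i j)
    then show ?case
      using x[of j] e by (simp add: E.smult_assoc1 max_closed max_power_closed annihilated_def)
  next
    case (sum a b)
    then have "a \<in> carrier R" "b \<in> carrier R"
      using R.ideal_prod_in_carrier[OF max_power_ideal ideal_max] by auto
    with sum show ?case using e by (simp add: E.smult_l_distr)
  qed
  then show ?thesis using e by (simp add: annihilated_def max_power_simps(2))
qed

text \<open>Every proper ideal \<open>I\<close> containing a power of \<open>\<mm>\<close> leaves room for a socle element of
  \<open>R / I\<close>: take an element of the last power of \<open>\<mm>\<close> that is not contained in \<open>I\<close>.\<close>

lemma quotient_socle:
  assumes I: "ideal I R" "\<one>\<^bsub>R\<^esub> \<notin> I" and n: "max_power n \<subseteq> I"
  obtains x where "x \<in> carrier R" "x \<notin> I" "\<And>y. y \<in> \<mm> \<Longrightarrow> x \<otimes>\<^bsub>R\<^esub> y \<in> I"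
proof -
  define k where "k = (LEAST k. max_power k \<subseteq> I)"
  have k: "max_power k \<subseteq> I" unfolding k_def using n by (rule LeastI)
  then have "k \<noteq> 0" using I(2) R.one_closed by (metis max_power_simps(1) subsetD)
  then obtain j where j: "k = Suc j" by (cases k) auto
  then have "\<not> max_power j \<subseteq> I" unfolding k_def using not_less_Least by (metis k_def lessI)
  then obtain x where x: "x \<in> max_power j" "x \<notin> I" by blast
  have "x \<otimes>\<^bsub>R\<^esub> y \<in> I" if "y \<in> \<mm>" for y
    using k ideal_prod.prod[OF x(1) that, of R] by (auto simp: j max_power_simps(2))
  then show thesis using that x max_power_closed by blast
qed

text \<open>Noetherian induction on \<open>I\<close>.  With \<open>x\<close> as in the preceding lemma, the claim for
  \<open>I + Rx\<close> gives a scalar \<open>r\<close> that agrees with \<open>f\<close> on the kernel of multiplication by \<open>x\<close>.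
  Hence \<open>f - r\<close> factors through multiplication by \<open>x\<close>, whose image lies in the socle; and
  since the socle is generated by \<open>s\<close>, homomorphisms act on it by scalars.\<close>

lemma hom_annihilated_is_mult:
  assumes I: "ideal I R" and n: "max_power n \<subseteq> I"
    and f: "f \<in> mod_hom R (E\<lparr>carrier := annihilated I\<rparr>) E"
  shows "\<exists>r\<in>carrier R. \<forall>e\<in>annihilated I. f e = r \<odot>\<^bsub>E\<^esub> e"
proof (rule ccontr)
  assume contra: "\<not> ?thesis"
  let ?S = "{I. ideal I R \<and> max_power n \<subseteq> I \<and> (\<exists>f\<in>mod_hom R (E\<lparr>carrier := annihilated I\<rparr>) E.
    \<not> (\<exists>r\<in>carrier R. \<forall>e\<in>annihilated I. f e = r \<odot>\<^bsub>E\<^esub> e))}"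
  have "I \<in> ?S" by (intro CollectI conjI bexI[of _ f] I n f contra)
  then have "?S \<noteq> {}" by (metis empty_iff)
  then obtain I where IS: "I \<in> ?S" and max: "\<And>J. J \<in> ?S \<Longrightarrow> I \<subseteq> J \<Longrightarrow> J = I"
    by (rule R.maximal_ideal_in_set) simp_all
  from CollectD[OF IS] obtain f where I: "ideal I R" and n: "max_power n \<subseteq> I"
    and f: "f \<in> mod_hom R (E\<lparr>carrier := annihilated I\<rparr>) E"
    and no: "\<not> (\<exists>r\<in>carrier R. \<forall>e\<in>annihilated I. f e = r \<odot>\<^bsub>E\<^esub> e)"
    by (elim conjE bexE)
  let ?A = "E\<lparr>carrier := annihilated I\<rparr>"
  have IR: "I \<subseteq> carrier R" using ideal.Icarr[OF I] by blast
  have subA: "submodule (annihilated I) R E" by (rule annihilated_submodule[OF IR])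
  have A: "module R ?A" by (rule submodule.submodule_is_module[OF subA module_E])
  have AE: "e \<in> carrier E" if "e \<in> annihilated I" for e using that by (simp add: annihilated_def)
  have f_closed: "f e \<in> carrier E" if "e \<in> annihilated I" for e using mod_hom_closed[OF f] that by simp
  have f0: "f \<zero>\<^bsub>E\<^esub> = \<zero>\<^bsub>E\<^esub>" using mod_hom_zero[OF A module_E f] by simp
  have "\<one>\<^bsub>R\<^esub> \<notin> I"
  proof
    assume "\<one>\<^bsub>R\<^esub> \<in> I"
    then have "e = \<zero>\<^bsub>E\<^esub>" if "e \<in> annihilated I" for e using that by (auto simp: annihilated_def)
    then have "\<forall>e\<in>annihilated I. f e = \<zero>\<^bsub>R\<^esub> \<odot>\<^bsub>E\<^esub> e" using f0 E.smult_l_null[OF E.zero_closed] by metis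
    then show False using no R.zero_closed by blast
  qed
  then obtain x where x: "x \<in> carrier R" "x \<notin> I" and xm: "\<And>y. y \<in> \<mm> \<Longrightarrow> x \<otimes>\<^bsub>R\<^esub> y \<in> I"
    using quotient_socle[OF I _ n] by blast
  \<comment> \<open>By maximality of \<open>I\<close> the claim holds for the larger ideal.\<close>
  let ?J = "I <+>\<^bsub>R\<^esub> PIdl\<^bsub>R\<^esub> x"
  have J: "ideal ?J R" by (rule R.add_ideals[OF I R.cgenideal_ideal[OF x(1)]])
  have J_mem: "i \<oplus>\<^bsub>R\<^esub> a \<otimes>\<^bsub>R\<^esub> x \<in> ?J" if "i \<in> I" "a \<in> carrier R" for i a
    using that unfolding set_add_def' cgenideal_def by blast
  have IJ: "I \<subseteq> ?J"
  proof
    fix i assume "i \<in> I"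
    then show "i \<in> ?J" using J_mem[of i "\<zero>\<^bsub>R\<^esub>"] IR x(1) by auto
  qed
  have "\<zero>\<^bsub>R\<^esub> \<in> I" using I additive_subgroup.zero_closed ideal.axioms(1) by blast
  then have "x \<in> ?J" using J_mem[of "\<zero>\<^bsub>R\<^esub>" "\<one>\<^bsub>R\<^esub>"] x(1) by simp
  then have J_notin: "?J \<notin> ?S" using max[OF _ IJ] x(2) by metis
  have J_ann: "e \<in> annihilated ?J" if e: "e \<in> annihilated I" and xe: "x \<odot>\<^bsub>E\<^esub> e = \<zero>\<^bsub>E\<^esub>" for e
  proof -
    have "r \<odot>\<^bsub>E\<^esub> e = \<zero>\<^bsub>E\<^esub>" if "r \<in> ?J" for r
    proof -
      from that obtain i a where ia: "i \<in> I" "a \<in> carrier R" "r = i \<oplus>\<^bsub>R\<^esub> a \<otimes>\<^bsub>R\<^esub> x"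
        unfolding set_add_def' cgenideal_def by blast
      then have "i \<in> carrier R" using IR by blast
      with ia show ?thesis
        using x(1) AE[OF e] xe e by (simp add: E.smult_l_distr E.smult_assoc1 annihilated_def)
    qed
    then show ?thesis using AE[OF e] by (simp add: annihilated_def)
  qed
  have JA: "annihilated ?J \<subseteq> annihilated I" using IJ by (auto simp: annihilated_def)
  have JR: "?J \<subseteq> carrier R" using ideal.Icarr[OF J] by blast
  have "restrict f (annihilated ?J) \<in> mod_hom R (E\<lparr>carrier := annihilated ?J\<rparr>) E"
    by (rule mod_homI)
      (use f JA submodule_closed[OF annihilated_submodule[OF JR]] mod_hom_add[OF f] mod_hom_smult[OF f]
        in \<open>auto simp: f_closed subset_iff\<close>)
  then have "\<exists>r\<in>carrier R. \<forall>e\<in>annihilated ?J. restrict f (annihilated ?J) e = r \<odot>\<^bsub>E\<^esub> e"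
    using J_notin J subset_trans[OF n IJ] by blast
  then obtain r where r: "r \<in> carrier R" "\<And>e. e \<in> annihilated ?J \<Longrightarrow> f e = r \<odot>\<^bsub>E\<^esub> e"
    by auto
  let ?H = "hom_module R ?A E"
  interpret H: module R ?H by (rule hom_module_module[OF A module_E])
  define \<mu> where "\<mu> t = (\<lambda>e\<in>annihilated I. t \<odot>\<^bsub>E\<^esub> e)" for t
  have \<mu>: "\<mu> t \<in> mod_hom R ?A E" if "t \<in> carrier R" for t
    unfolding \<mu>_def using mod_hom_restrict[OF mod_hom_mult[OF module_E that] subA] AE
    by (simp add: restrict_def cong: if_cong)
  let ?g = "f \<ominus>\<^bsub>?H\<^esub> \<mu> r"
  have g: "?g \<in> mod_hom R ?A E" using H.minus_closed[of f "\<mu> r"] f \<mu>[OF r(1)] by simp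
  have g_app: "?g e = f e \<ominus>\<^bsub>E\<^esub> r \<odot>\<^bsub>E\<^esub> e" if "e \<in> annihilated I" for e
    using hom_module_minus[OF A module_E f \<mu>[OF r(1)], of e] that by (simp add: \<mu>_def)
  obtain h where h: "h \<in> mod_hom R E E" "\<And>e. e \<in> annihilated I \<Longrightarrow> h (x \<odot>\<^bsub>E\<^esub> e) = ?g e"
  proof (rule injective_factor[OF injective A module_E \<mu>[OF x(1)] g])
    fix e assume "e \<in> carrier ?A" "\<mu> x e = \<zero>\<^bsub>E\<^esub>"
    then have "e \<in> annihilated I" "e \<in> annihilated ?J" using J_ann by (auto simp: \<mu>_def)
    then show "?g e = \<zero>\<^bsub>E\<^esub>" using r g_app AE by (simp add: E.minus_eq_zero_iff)
  qed (auto simp: \<mu>_def)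
  \<comment> \<open>\<open>h\<close> preserves the socle, which is spanned by \<open>s\<close>.\<close>
  have hs: "h s \<in> carrier E" using mod_hom_closed[OF h(1) s_closed] .
  have "y \<odot>\<^bsub>E\<^esub> h s = \<zero>\<^bsub>E\<^esub>" if "y \<in> \<mm>" for y
    using mod_hom_smult[OF h(1) max_closed[OF that] s_closed] s_killed[OF that]
      mod_hom_zero[OF module_E module_E h(1)] by simp
  then obtain t where t: "t \<in> carrier R" "h s = t \<odot>\<^bsub>E\<^esub> s" by (rule socle_generated[OF hs])
  have "f e = (r \<oplus>\<^bsub>R\<^esub> t \<otimes>\<^bsub>R\<^esub> x) \<odot>\<^bsub>E\<^esub> e" if e: "e \<in> annihilated I" for e
  proof -
    have xe: "x \<odot>\<^bsub>E\<^esub> e \<in> carrier E" using x AE[OF e] by simp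
    have "y \<odot>\<^bsub>E\<^esub> (x \<odot>\<^bsub>E\<^esub> e) = \<zero>\<^bsub>E\<^esub>" if "y \<in> \<mm>" for y
    proof -
      have "y \<odot>\<^bsub>E\<^esub> (x \<odot>\<^bsub>E\<^esub> e) = (x \<otimes>\<^bsub>R\<^esub> y) \<odot>\<^bsub>E\<^esub> e"
        using x max_closed[OF that] AE[OF e] by (simp add: E.smult_assoc1 E.smult_left_commute)
      then show ?thesis using xm[OF that] e by (simp add: annihilated_def)
    qed
    then obtain a where a: "a \<in> carrier R" "x \<odot>\<^bsub>E\<^esub> e = a \<odot>\<^bsub>E\<^esub> s" by (rule socle_generated[OF xe])
    have "h (x \<odot>\<^bsub>E\<^esub> e) = a \<odot>\<^bsub>E\<^esub> (t \<odot>\<^bsub>E\<^esub> s)"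
      using mod_hom_smult[OF h(1) a(1) s_closed] a t by simp
    also have "\<dots> = t \<odot>\<^bsub>E\<^esub> (x \<odot>\<^bsub>E\<^esub> e)"
      unfolding a(2) using a(1) t(1) s_closed by (intro E.smult_left_commute)
    finally have eq: "f e \<ominus>\<^bsub>E\<^esub> r \<odot>\<^bsub>E\<^esub> e = t \<odot>\<^bsub>E\<^esub> (x \<odot>\<^bsub>E\<^esub> e)"
      using h(2)[OF e] g_app[OF e] by simp
    have "f e = (f e \<ominus>\<^bsub>E\<^esub> r \<odot>\<^bsub>E\<^esub> e) \<oplus>\<^bsub>E\<^esub> r \<odot>\<^bsub>E\<^esub> e"
      using f_closed[OF e] r(1) AE[OF e] by (simp add: E.minus_add_cancel)
    also have "\<dots> = (r \<oplus>\<^bsub>R\<^esub> t \<otimes>\<^bsub>R\<^esub> x) \<odot>\<^bsub>E\<^esub> e"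
      using r(1) t(1) x(1) AE[OF e] by (simp add: eq E.smult_l_distr E.smult_assoc1 E.M.a_comm)
    finally show ?thesis .
  qed
  then show False using no r(1) t(1) x(1) by blast
qed

text \<open>Among the elements that no power of \<open>\<mm>\<close> kills, choose \<open>e\<close> with maximal annihilator.
  For \<open>x\<close> in \<open>\<mm>\<close> the element \<open>x e\<close> has a strictly larger annihilator, as it contains the
  scalar that moves \<open>e\<close> into the socle.  So every such \<open>x e\<close> is killed by a power of \<open>\<mm>\<close>,
  and by the chain condition one power suffices for all \<open>x\<close>.\<close>

lemma killed_by_max_power:
  assumes "e \<in> carrier E"
  obtains n where "e \<in> annihilated (max_power n)"
proof (rule ccontr)
  assume contra: "\<not> thesis"
  let ?T = "{e \<in> carrier E. \<forall>n. e \<notin> annihilated (max_power n)}"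
  let ?ann = "\<lambda>e. {r \<in> carrier R. r \<odot>\<^bsub>E\<^esub> e = \<zero>\<^bsub>E\<^esub>}"
  have "submodule {\<zero>\<^bsub>E\<^esub>} R E" by (rule E.submoduleI) auto
  then have ann: "ideal (?ann e) R" if "e \<in> carrier E" for e
    using colon_ideal[OF module_E, of "{\<zero>\<^bsub>E\<^esub>}" e] that by simp
  have "?ann ` ?T \<noteq> {}" using assms contra that by blast
  then obtain I where "I \<in> ?ann ` ?T" and max: "\<And>J. J \<in> ?ann ` ?T \<Longrightarrow> I \<subseteq> J \<Longrightarrow> J = I"
    by (rule R.maximal_ideal_in_set) (use ann in auto)
  then obtain e where I: "I = ?ann e" and e: "e \<in> carrier E" and eT: "\<And>n. e \<notin> annihilated (max_power n)"
    by blast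
  have "e \<noteq> \<zero>\<^bsub>E\<^esub>" using eT[of 0] by (auto simp: annihilated_def max_power_simps(1))
  then obtain r t where r: "r \<in> carrier R" "r \<odot>\<^bsub>E\<^esub> e \<noteq> \<zero>\<^bsub>E\<^esub>" and t: "t \<in> carrier R" "r \<odot>\<^bsub>E\<^esub> e = t \<odot>\<^bsub>E\<^esub> s"
    using essential[OF e] by blast
  have xe: "\<exists>n. x \<odot>\<^bsub>E\<^esub> e \<in> annihilated (max_power n)" if x: "x \<in> \<mm>" for x
  proof (rule ccontr)
    note xR = max_closed[OF x]
    assume "\<not> ?thesis"
    then have "x \<odot>\<^bsub>E\<^esub> e \<in> ?T" using e xR by simp
    moreover have "?ann e \<subseteq> ?ann (x \<odot>\<^bsub>E\<^esub> e)"
    proof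
      fix a assume a: "a \<in> ?ann e"
      then have "a \<odot>\<^bsub>E\<^esub> (x \<odot>\<^bsub>E\<^esub> e) = x \<odot>\<^bsub>E\<^esub> (a \<odot>\<^bsub>E\<^esub> e)"
        using xR e by (intro E.smult_left_commute) auto
      then show "a \<in> ?ann (x \<odot>\<^bsub>E\<^esub> e)" using a xR by simp
    qed
    ultimately have "?ann (x \<odot>\<^bsub>E\<^esub> e) = ?ann e" using max I by blast
    moreover have "r \<odot>\<^bsub>E\<^esub> (x \<odot>\<^bsub>E\<^esub> e) = t \<odot>\<^bsub>E\<^esub> (x \<odot>\<^bsub>E\<^esub> s)"
    proof -
      have "r \<odot>\<^bsub>E\<^esub> (x \<odot>\<^bsub>E\<^esub> e) = x \<odot>\<^bsub>E\<^esub> (r \<odot>\<^bsub>E\<^esub> e)"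
        using xR e r(1) by (intro E.smult_left_commute)
      also have "\<dots> = t \<odot>\<^bsub>E\<^esub> (x \<odot>\<^bsub>E\<^esub> s)"
        unfolding t(2) using xR t(1) s_closed by (intro E.smult_left_commute)
      finally show ?thesis .
    qed
    ultimately show False using r t(1) s_killed[OF x] by auto
  qed
  define C where "C n = {r \<in> carrier R. r \<odot>\<^bsub>E\<^esub> e \<in> annihilated (max_power n)}" for n
  have C_ideal: "ideal (C n) R" for n
    unfolding C_def
    by (rule colon_ideal[OF module_E annihilated_submodule e]) (use max_power_closed in auto)
  have C_mono: "C m \<subseteq> C n" if "m \<le> n" for m n
    using annihilated_max_power_mono[OF that] by (auto simp: C_def)
  have "subset.chain {I. ideal I R} (range C)"
    using C_ideal C_mono by (auto simp: subset_chain_def) (meson nat_le_linear subsetD)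
  then have "\<Union>(range C) \<in> range C" by (intro R.ideal_chain_is_trivial) auto
  then obtain N where N: "\<Union>(range C) = C N" by blast
  have "x \<odot>\<^bsub>E\<^esub> e \<in> annihilated (max_power N)" if "x \<in> \<mm>" for x
  proof -
    have "x \<in> \<Union>(range C)" using xe[OF that] max_closed[OF that] by (auto simp: C_def)
    then show ?thesis unfolding N by (simp add: C_def)
  qed
  then show False using eT annihilated_max_power_Suc[OF e] by blast
qed

end

locale complete_matlis_setting = matlis_setting +
  assumes complete: "adic_complete R \<mm>"
begin

text \<open>On the elements killed by the \<open>n\<close>-th power of \<open>\<mm>\<close> an endomorphism is multiplication by
  some \<open>x n\<close>, which is determined modulo that power; completeness glues these scalars.\<close>

lemma endomorphism_is_mult:
  assumes f: "f \<in> mod_hom R E E"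
  obtains r where "r \<in> carrier R" "\<And>e. e \<in> carrier E \<Longrightarrow> f e = r \<odot>\<^bsub>E\<^esub> e"
proof -
  have sub: "submodule (annihilated (max_power n)) R E" for n
    by (rule annihilated_submodule) (use max_power_closed in auto)
  have "\<exists>x\<in>carrier R. \<forall>e\<in>annihilated (max_power n). f e = x \<odot>\<^bsub>E\<^esub> e" for n
    using hom_annihilated_is_mult[OF max_power_ideal _ mod_hom_restrict[OF f sub], of n n] by auto
  then obtain x where x: "\<And>n. x n \<in> carrier R"
    and fx: "\<And>n e. e \<in> annihilated (max_power n) \<Longrightarrow> f e = x n \<odot>\<^bsub>E\<^esub> e" by metis
  have "x (Suc n) \<ominus>\<^bsub>R\<^esub> x n \<in> max_power n" for n
  proof (rule ccontr)
    assume "x (Suc n) \<ominus>\<^bsub>R\<^esub> x n \<notin> max_power n"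
    then obtain e where e: "e \<in> annihilated (max_power n)" "(x (Suc n) \<ominus>\<^bsub>R\<^esub> x n) \<odot>\<^bsub>E\<^esub> e \<noteq> \<zero>\<^bsub>E\<^esub>"
      using ideal_separation[OF max_power_ideal, of "x (Suc n) \<ominus>\<^bsub>R\<^esub> x n" n] x by auto
    have "e \<in> annihilated (max_power (Suc n))"
      using e(1) annihilated_max_power_mono[of n "Suc n"] by auto
    then have "x (Suc n) \<odot>\<^bsub>E\<^esub> e = x n \<odot>\<^bsub>E\<^esub> e" using fx e(1) by metis
    moreover have "e \<in> carrier E" using e(1) by (simp add: annihilated_def)
    ultimately show False
      using e(2) x by (simp add: a_minus_def E.smult_l_distr E.smult_l_minus E.M.r_neg)
  qed
  then obtain y where y: "y \<in> carrier R" "\<And>n. y \<ominus>\<^bsub>R\<^esub> x n \<in> max_power n"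
    using complete x unfolding adic_complete_def max_power_def by metis
  have "f e = y \<odot>\<^bsub>E\<^esub> e" if e: "e \<in> carrier E" for e
  proof -
    obtain n where n: "e \<in> annihilated (max_power n)" by (rule killed_by_max_power[OF e])
    then have "(y \<ominus>\<^bsub>R\<^esub> x n) \<odot>\<^bsub>E\<^esub> e = \<zero>\<^bsub>E\<^esub>" using y(2) by (simp add: annihilated_def)
    then have "y \<odot>\<^bsub>E\<^esub> e \<ominus>\<^bsub>E\<^esub> x n \<odot>\<^bsub>E\<^esub> e = \<zero>\<^bsub>E\<^esub>"
      using y(1) x e by (simp add: a_minus_def E.smult_l_distr E.smult_l_minus)
    then show ?thesis using fx[OF n] y(1) x e by (simp add: E.minus_eq_zero_iff)
  qed
  then show thesis using that y(1) by blast
qed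

section \<open>Matlis duality for finitely generated and Artinian modules\<close>

text \<open>Linear algebra over the scalars \<open>R = End E\<close>: on the common kernel of the other
  functionals, \<open>\<psi>\<close> factors through the last one, hence is a multiple of it.\<close>

lemma common_kernel_span:
  assumes A: "module R A" and "finite \<Phi>" and "\<Phi> \<subseteq> mod_hom R A E" and "\<psi> \<in> mod_hom R A E"
    and "\<And>x. x \<in> carrier A \<Longrightarrow> \<forall>\<phi>\<in>\<Phi>. \<phi> x = \<zero>\<^bsub>E\<^esub> \<Longrightarrow> \<psi> x = \<zero>\<^bsub>E\<^esub>"
    and H: "submodule H R (hom_module R A E)" and "\<Phi> \<subseteq> H"
  shows "\<psi> \<in> H"
  using assms(2-5,7)
proof (induction \<Phi> arbitrary: \<psi> rule: finite_induct)
  case empty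
  interpret A: module R A by (rule A)
  have "\<psi> = (\<lambda>x\<in>carrier A. \<zero>\<^bsub>E\<^esub>)"
    using empty.prems(2,3) by (intro extensionalityI[OF mod_hom_extensional]) auto
  then show ?case using submodule_closed(4)[OF H] by (simp only: hom_module_simps)
next
  case (insert \<phi> \<Phi>)
  interpret A: module R A by (rule A)
  interpret D: module R "hom_module R A E" by (rule hom_module_module[OF A module_E])
  let ?N = "{x \<in> carrier A. \<forall>\<chi>\<in>\<Phi>. x \<in> {x \<in> carrier A. \<chi> x = \<zero>\<^bsub>E\<^esub>}}"
  have N: "submodule ?N R A"
    by (rule submodule_Inter[OF A], rule mod_hom_kernel_submodule[OF A module_E])
      (use insert.prems(1) in auto)
  have AN: "module R (A\<lparr>carrier := ?N\<rparr>)" by (rule submodule.submodule_is_module[OF N A])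
  have \<phi>: "\<phi> \<in> mod_hom R A E" using insert.prems(1) by simp
  obtain h where h: "h \<in> mod_hom R E E"
    "\<And>x. x \<in> carrier (A\<lparr>carrier := ?N\<rparr>) \<Longrightarrow> h (restrict \<phi> ?N x) = restrict \<psi> ?N x"
    by (rule injective_factor[OF injective AN module_E mod_hom_restrict[OF \<phi> N]
          mod_hom_restrict[OF insert.prems(2) N]]) (use insert.prems(3) in auto)
  obtain r where r: "r \<in> carrier R" "\<And>e. e \<in> carrier E \<Longrightarrow> h e = r \<odot>\<^bsub>E\<^esub> e"
    using endomorphism_is_mult[OF h(1)] by blast
  let ?r\<phi> = "r \<odot>\<^bsub>hom_module R A E\<^esub> \<phi>"
  have r\<phi>: "?r\<phi> \<in> mod_hom R A E" using D.smult_closed[OF r(1), of \<phi>] \<phi> by simp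
  have "\<psi> \<ominus>\<^bsub>hom_module R A E\<^esub> ?r\<phi> \<in> H"
  proof (rule insert.IH)
    show "\<psi> \<ominus>\<^bsub>hom_module R A E\<^esub> ?r\<phi> \<in> mod_hom R A E"
      using D.minus_closed[of \<psi> ?r\<phi>] insert.prems(2) r\<phi> by (simp del: hom_module_simps(4))
    fix x assume x: "x \<in> carrier A" "\<forall>\<chi>\<in>\<Phi>. \<chi> x = \<zero>\<^bsub>E\<^esub>"
    have "\<psi> x = r \<odot>\<^bsub>E\<^esub> \<phi> x" using h(2)[of x] x r(2)[OF mod_hom_closed[OF \<phi> x(1)]] by simp
    then show "(\<psi> \<ominus>\<^bsub>hom_module R A E\<^esub> ?r\<phi>) x = \<zero>\<^bsub>E\<^esub>"
      unfolding hom_module_minus[OF A module_E insert.prems(2) r\<phi> x(1)]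
      using x(1) r(1) mod_hom_closed[OF \<phi> x(1)] by (simp add: E.minus_eq_zero_iff)
  qed (use insert.prems in auto)
  moreover have "?r\<phi> \<in> H" using submodule_closed(3)[OF H r(1)] insert.prems(4) by simp
  ultimately have "(\<psi> \<ominus>\<^bsub>hom_module R A E\<^esub> ?r\<phi>) \<oplus>\<^bsub>hom_module R A E\<^esub> ?r\<phi> \<in> H"
    by (rule submodule_closed(2)[OF H])
  also have "(\<psi> \<ominus>\<^bsub>hom_module R A E\<^esub> ?r\<phi>) \<oplus>\<^bsub>hom_module R A E\<^esub> ?r\<phi> = \<psi>"
    using insert.prems(2) r\<phi> by (intro D.minus_add_cancel) (simp_all del: hom_module_simps(2-4))
  finally show ?case .
qed

end

text \<open>Half of reflexivity; the other half, injectivity of the canonical map to the bidual, holds for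
  every module when \<open>E\<close> separates points.\<close>

definition evaluation_surjective :: "('a, 'r) ring_scheme \<Rightarrow> ('a, 'e) module \<Rightarrow> ('a, 'b) module \<Rightarrow> bool"
  where "evaluation_surjective R E M \<longleftrightarrow>
    (\<forall>\<Psi>\<in>mod_hom R (hom_module R M E) E. \<exists>x\<in>carrier M. \<forall>\<phi>\<in>mod_hom R M E. \<Psi> \<phi> = \<phi> x)"

lemma mod_hom_evaluation:
  assumes "module R M" "module R E"
  shows "(\<lambda>x\<in>carrier M. \<lambda>\<phi>\<in>mod_hom R M E. \<phi> x)
    \<in> mod_hom R M (hom_module R (hom_module R M E) E)"
proof -
  interpret M: module R M by fact
  show ?thesis
    by (rule mod_homI) (use mod_hom_eval[OF assms] in \<open>auto simp: mod_hom_simps intro!: restrict_ext\<close>)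
qed

context complete_matlis_setting
begin

text \<open>A functional is determined by its values on generators.  So the evaluations at the generators
  have common kernel zero on the dual, and every element of the bidual is a combination of them.\<close>

lemma fin_gen_evaluation_surjective:
  assumes M: "module R M" and "fin_gen_module R M"
  shows "evaluation_surjective R E M"
  unfolding evaluation_surjective_def
proof
  fix \<Psi> assume \<Psi>: "\<Psi> \<in> mod_hom R (hom_module R M E) E"
  let ?D = "hom_module R M E" and ?ev = "\<lambda>x. \<lambda>\<phi>\<in>mod_hom R M E. \<phi> x"
  have D: "module R ?D" by (rule hom_module_module[OF M module_E])
  obtain S where S: "finite S" "S \<subseteq> carrier M" "submodule_generated R M S = carrier M"
    using assms(2) by (auto simp: fin_gen_module_def)
  have "\<Psi> \<in> (\<lambda>x\<in>carrier M. ?ev x) ` carrier M"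
  proof (rule common_kernel_span[OF D, of "?ev ` S"])
    show "finite (?ev ` S)" using S(1) by simp
    show "?ev ` S \<subseteq> mod_hom R ?D E" using mod_hom_eval[OF M module_E] S(2) by auto
    show "\<Psi> \<in> mod_hom R ?D E" by (rule \<Psi>)
    show "submodule ((\<lambda>x\<in>carrier M. ?ev x) ` carrier M) R (hom_module R ?D E)"
      by (rule mod_hom_image_submodule[OF M hom_module_module[OF D module_E]
            mod_hom_evaluation[OF M module_E]])
    show "?ev ` S \<subseteq> (\<lambda>x\<in>carrier M. ?ev x) ` carrier M" using S(2) by auto
    fix \<phi> assume \<phi>': "\<phi> \<in> carrier ?D" and 0: "\<forall>\<chi>\<in>?ev ` S. \<chi> \<phi> = \<zero>\<^bsub>E\<^esub>"
    then have \<phi>: "\<phi> \<in> mod_hom R M E" by simp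
    have "S \<subseteq> {x \<in> carrier M. \<phi> x = \<zero>\<^bsub>E\<^esub>}" using 0 \<phi> S(2) by auto
    then have "carrier M \<subseteq> {x \<in> carrier M. \<phi> x = \<zero>\<^bsub>E\<^esub>}"
      using submodule_generated_least[OF mod_hom_kernel_submodule[OF M module_E \<phi>], of S]
      unfolding S(3) by blast
    then have "\<phi> = \<zero>\<^bsub>?D\<^esub>"
      by (simp, intro extensionalityI[OF mod_hom_extensional[OF \<phi>]]) auto
    then show "\<Psi> \<phi> = \<zero>\<^bsub>E\<^esub>" using mod_hom_zero[OF D module_E \<Psi>] by simp
  qed
  then show "\<exists>x\<in>carrier M. \<forall>\<phi>\<in>mod_hom R M E. \<Psi> \<phi> = \<phi> x" by auto
qed

end

context matlis_setting
begin

text \<open>A functional on \<open>M\<^sup>\<or>\<close> that is no evaluation could be separated from all evaluations by a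
  functional on the bidual, which is itself evaluation at some \<open>\<phi>\<close>; but then \<open>\<phi>\<close> is zero.\<close>

lemma dual_evaluation_surjective:
  assumes M: "module R M" and dual: "evaluation_surjective R E (hom_module R M E)"
  shows "evaluation_surjective R E M"
  unfolding evaluation_surjective_def
proof (rule ballI, rule ccontr)
  fix \<Psi> assume \<Psi>: "\<Psi> \<in> mod_hom R (hom_module R M E) E"
    and no: "\<not> (\<exists>x\<in>carrier M. \<forall>\<phi>\<in>mod_hom R M E. \<Psi> \<phi> = \<phi> x)"
  let ?D = "hom_module R M E" and ?ev = "\<lambda>x\<in>carrier M. \<lambda>\<phi>\<in>mod_hom R M E. \<phi> x"
  have D: "module R ?D" by (rule hom_module_module[OF M module_E])
  have DD: "module R (hom_module R ?D E)" by (rule hom_module_module[OF D module_E])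
  have "\<Psi> \<notin> ?ev ` carrier M" using no by auto
  then obtain \<Lambda> where \<Lambda>: "\<Lambda> \<in> mod_hom R (hom_module R ?D E) E"
    "\<And>n. n \<in> ?ev ` carrier M \<Longrightarrow> \<Lambda> n = \<zero>\<^bsub>E\<^esub>" "\<Lambda> \<Psi> \<noteq> \<zero>\<^bsub>E\<^esub>"
    using separation[OF DD mod_hom_image_submodule[OF M DD mod_hom_evaluation[OF M module_E]], of \<Psi>] \<Psi>
    by auto
  then obtain \<phi> where \<phi>: "\<phi> \<in> mod_hom R M E" and ev: "\<And>\<Theta>. \<Theta> \<in> mod_hom R ?D E \<Longrightarrow> \<Lambda> \<Theta> = \<Theta> \<phi>"
    using dual unfolding evaluation_surjective_def by auto
  have "\<phi> x = \<zero>\<^bsub>E\<^esub>" if "x \<in> carrier M" for x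
    using \<Lambda>(2)[of "?ev x"] ev[OF mod_hom_eval[OF M module_E that]] that \<phi> by auto
  then have "\<phi> = \<zero>\<^bsub>?D\<^esub>"
    by (simp, intro extensionalityI[OF mod_hom_extensional[OF \<phi>]]) auto
  then have "\<Lambda> \<Psi> = \<zero>\<^bsub>E\<^esub>" using ev[OF \<Psi>] mod_hom_zero[OF D module_E \<Psi>] by simp
  then show False using \<Lambda>(3) by simp
qed

text \<open>If no finite set had common kernel zero, functionals could be added one by one, each
  shrinking the common kernel.\<close>

lemma artinian_finite_zero_kernel:
  assumes M: "module R M" and artin: "artinian_module R M"
  obtains \<Phi> where "finite \<Phi>" "\<Phi> \<subseteq> mod_hom R M E"
    "\<And>x. x \<in> carrier M \<Longrightarrow> \<forall>\<phi>\<in>\<Phi>. \<phi> x = \<zero>\<^bsub>E\<^esub> \<Longrightarrow> x = \<zero>\<^bsub>M\<^esub>"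
proof (rule ccontr)
  note assm = that
  assume contra: "\<not> thesis"
  have nonzero: "\<exists>x\<in>carrier M. (\<forall>\<phi>\<in>\<Phi>. \<phi> x = \<zero>\<^bsub>E\<^esub>) \<and> x \<noteq> \<zero>\<^bsub>M\<^esub>"
    if "finite \<Phi>" "\<Phi> \<subseteq> mod_hom R M E" for \<Phi>
    using assm[OF that] contra by blast
  define K where "K \<Phi> = {x \<in> carrier M. \<forall>\<phi>\<in>\<Phi>. x \<in> {x \<in> carrier M. \<phi> x = \<zero>\<^bsub>E\<^esub>}}" for \<Phi>
  have step: "\<exists>\<Phi>'. (finite \<Phi>' \<and> \<Phi>' \<subseteq> mod_hom R M E) \<and> K \<Phi>' \<subset> K \<Phi>"
    if \<Phi>: "finite \<Phi> \<and> \<Phi> \<subseteq> mod_hom R M E" for \<Phi>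
  proof -
    obtain x where x: "x \<in> carrier M" "\<forall>\<phi>\<in>\<Phi>. \<phi> x = \<zero>\<^bsub>E\<^esub>" "x \<noteq> \<zero>\<^bsub>M\<^esub>"
      using nonzero[of \<Phi>] \<Phi> by blast
    obtain \<chi> where \<chi>: "\<chi> \<in> mod_hom R M E" "\<chi> x \<noteq> \<zero>\<^bsub>E\<^esub>"
      by (rule separation_zero[OF M x(1,3)])
    have "K (insert \<chi> \<Phi>) \<subseteq> K \<Phi>" "x \<in> K \<Phi>" "x \<notin> K (insert \<chi> \<Phi>)"
      using x \<chi> by (auto simp: K_def)
    then show ?thesis using \<Phi> \<chi>(1) by (intro exI[of _ "insert \<chi> \<Phi>"]) auto
  qed
  obtain F where F: "\<And>n::nat. finite (F n) \<and> F n \<subseteq> mod_hom R M E" "\<And>n. K (F (Suc n)) \<subset> K (F n)"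
    using dependent_nat_choice[of "\<lambda>_ \<Phi>. finite \<Phi> \<and> \<Phi> \<subseteq> mod_hom R M E" "\<lambda>_ \<Phi> \<Phi>'. K \<Phi>' \<subset> K \<Phi>"] step
    by (metis finite.emptyI empty_subsetI)
  have "submodule (K (F n)) R M" for n
    unfolding K_def
    by (rule submodule_Inter[OF M], rule mod_hom_kernel_submodule[OF M module_E]) (use F(1) in auto)
  moreover have "K (F (Suc n)) \<subseteq> K (F n)" for n using F(2)[of n] by blast
  ultimately obtain k where "\<forall>n\<ge>k. K (F n) = K (F k)"
    using artin[unfolded artinian_module_def, rule_format, of "\<lambda>n. K (F n)"] by blast
  then show False using F(2)[of k] by (metis le_SucI order_refl psubsetE subset_refl)
qed

end

context complete_matlis_setting
begin

text \<open>Finitely many functionals with common kernel zero generate the dual, which is therefore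
  finitely generated, hence reflexive; and reflexivity passes from the dual to the module.\<close>

lemma artinian_evaluation_surjective:
  assumes M: "module R M" and artin: "artinian_module R M"
  shows "evaluation_surjective R E M"
proof (rule dual_evaluation_surjective[OF M])
  let ?D = "hom_module R M E"
  have D: "module R ?D" by (rule hom_module_module[OF M module_E])
  obtain \<Phi> where \<Phi>: "finite \<Phi>" "\<Phi> \<subseteq> mod_hom R M E"
    "\<And>x. x \<in> carrier M \<Longrightarrow> \<forall>\<phi>\<in>\<Phi>. \<phi> x = \<zero>\<^bsub>E\<^esub> \<Longrightarrow> x = \<zero>\<^bsub>M\<^esub>"
    using artinian_finite_zero_kernel[OF M artin] by blast
  have gen: "submodule (submodule_generated R ?D \<Phi>) R ?D"
    by (rule submodule_generated_submodule[OF D]) (use \<Phi>(2) in simp)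
  have "\<psi> \<in> submodule_generated R ?D \<Phi>" if \<psi>: "\<psi> \<in> mod_hom R M E" for \<psi>
    by (rule common_kernel_span[OF M \<Phi>(1,2) \<psi> _ gen submodule_generated_subset])
      (use \<Phi>(3) mod_hom_zero[OF M module_E \<psi>] in auto)
  then have "submodule_generated R ?D \<Phi> = carrier ?D"
    using submodule_closed(1)[OF gen] by auto
  then have "fin_gen_module R ?D" using \<Phi>(1,2) by (auto simp: fin_gen_module_def)
  then show "evaluation_surjective R E ?D" by (rule fin_gen_evaluation_surjective[OF D])
qed

lemma matlis_evaluation_surjective:
  assumes "module R M" "artinian_module R M \<or> fin_gen_module R M \<or> matlis_dualizable R E M"
  shows "evaluation_surjective R E M"
  using assms(2)
proof (elim disjE)
  assume "matlis_dualizable R E M"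
  then have surj: "(\<lambda>x\<in>carrier M. \<lambda>\<phi>\<in>mod_hom R M E. \<phi> x) ` carrier M = mod_hom R (hom_module R M E) E"
    by (auto simp: matlis_dualizable_def matlis_dual_def mod_iso_def bij_betw_def)
  show ?thesis
    unfolding evaluation_surjective_def surj[symmetric] by auto
qed (use artinian_evaluation_surjective fin_gen_evaluation_surjective assms(1) in auto)

end

section \<open>Vanishing of pure tensors\<close>

text \<open>The shape \<open>a - b - c\<close> is that of the two additivity relations of the tensor product.\<close>

lemma hom_free_Abelian_group_diff2:
  assumes h: "h \<in> hom (free_Abelian_group S) (add_monoid E)" and E: "abelian_group E"
    and keys: "Poly_Mapping.keys a \<subseteq> S" "Poly_Mapping.keys b \<subseteq> S" "Poly_Mapping.keys c \<subseteq> S"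
  shows "h (a - b - c) = \<zero>\<^bsub>E\<^esub> \<longleftrightarrow> h a = h b \<oplus>\<^bsub>E\<^esub> h c"
proof -
  interpret E: abelian_group E by fact
  have kd: "Poly_Mapping.keys (a - b - c) \<subseteq> S"
    using keys keys_diff[of "a - b" c] keys_diff[of a b] by blast
  have kbc: "Poly_Mapping.keys (b + c) \<subseteq> S" using keys keys_add[of b c] by blast
  have add: "h (u + v) = h u \<oplus>\<^bsub>E\<^esub> h v"
    if "Poly_Mapping.keys u \<subseteq> S" "Poly_Mapping.keys v \<subseteq> S" for u v
    using hom_mult[OF h, of u v] that by simp
  have closed: "h u \<in> carrier E" if "Poly_Mapping.keys u \<subseteq> S" for u
    using hom_in_carrier[OF h, of u] that by simp
  have "h a = h (a - b - c) \<oplus>\<^bsub>E\<^esub> h (b + c)"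
    using add[OF kd kbc] by simp
  also have "h (b + c) = h b \<oplus>\<^bsub>E\<^esub> h c" by (rule add[OF keys(2,3)])
  finally have "h a = h (a - b - c) \<oplus>\<^bsub>E\<^esub> (h b \<oplus>\<^bsub>E\<^esub> h c)" .
  then show ?thesis
    using closed[OF kd] closed[OF keys(2)] closed[OF keys(3)] by (auto simp: E.add.r_cancel_one)
qed

text \<open>The scalars act through the second factor.  The result is not a module, but
  \<open>quotient_module_module\<close> turns its quotient by the bilinearity relations into one.\<close>

definition free_pair_module :: "('a, 'b) module \<Rightarrow> ('a, 'c) module \<Rightarrow> ('a, ('b \<times> 'c) \<Rightarrow>\<^sub>0 int) module"
  where "free_pair_module N V =
    \<lparr>carrier = carrier (free_Abelian_group (carrier N \<times> carrier V)), monoid.mult = undefined,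
     one = undefined, ring.zero = 0, ring.add = (+),
     smult = (\<lambda>r. frag_extend (\<lambda>(x, y). frag_of (x, r \<odot>\<^bsub>V\<^esub> y)))\<rparr>"

context
  fixes R :: "('a, 'r) ring_scheme" and N :: "('a, 'b) module" and V :: "('a, 'c) module"
  assumes N: "abelian_group N" "\<forall>r\<in>carrier R. \<forall>x\<in>carrier N. r \<odot>\<^bsub>N\<^esub> x \<in> carrier N"
    and V: "module R V"
begin

private abbreviation "F \<equiv> free_Abelian_group (carrier N \<times> carrier V)"
private abbreviation "P \<equiv> free_pair_module N V"
private abbreviation "K \<equiv> tensor_kernel R N V"

lemma tensor_relations_subset: "tensor_relations R N V \<subseteq> carrier F"
proof -
  interpret N: abelian_group N by (rule N(1))
  interpret V: module R V by (rule V)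
  have diff: "a - b \<in> carrier F" if "a \<in> carrier F" "b \<in> carrier F" for a b
    using that keys_diff[of a b] by auto
  show ?thesis
    using N(2)
    by (auto simp: tensor_relations_def simp del: carrier_free_Abelian_group_iff intro!: diff)
qed

lemma tensor_kernel_subgroup: "subgroup K F"
  unfolding tensor_kernel_def
  by (rule group.generate_is_subgroup[OF group_free_Abelian_group tensor_relations_subset])

lemma pure_tensor_eq_one_iff:
  assumes "c \<in> carrier N" "z \<in> carrier V"
  shows "pure_tensor R N V c z = \<one>\<^bsub>tensor_product R N V\<^esub> \<longleftrightarrow> frag_of (c, z) \<in> K"
proof -
  have "frag_of (c, z) \<in> carrier F" using assms by simp
  then show ?thesis
    using group.coset_join1[OF group_free_Abelian_group _ _ tensor_kernel_subgroup]
      group.coset_join2[OF group_free_Abelian_group _ tensor_kernel_subgroup]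
    by (auto simp: pure_tensor_def tensor_product_def)
qed

text \<open>The universal property: bilinear maps vanish where the pure tensor does.\<close>

lemma bilinear_vanishes_on_zero_tensor:
  assumes E: "module R E" and zero: "frag_of (c, z) \<in> K" and c: "c \<in> carrier N" and z: "z \<in> carrier V"
    and g: "g \<in> mod_hom R N (hom_module R V E)"
  shows "g c z = \<zero>\<^bsub>E\<^esub>"
proof -
  interpret N: abelian_group N by (rule N(1))
  interpret V: module R V by (rule V)
  interpret E: module R E by fact
  let ?S = "carrier N \<times> carrier V"
  have gx: "g x \<in> mod_hom R V E" if "x \<in> carrier N" for x using mod_hom_closed[OF g that] by simp
  have g_closed: "g x y \<in> carrier E" if "x \<in> carrier N" "y \<in> carrier V" for x y
    using mod_hom_closed[OF gx[OF that(1)] that(2)] .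
  obtain h where h: "h \<in> hom F (add_monoid E)" "\<And>u. u \<in> ?S \<Longrightarrow> h (frag_of u) = (\<lambda>(x, y). g x y) u"
    by (rule comm_group.free_Abelian_group_universal[OF E.a_comm_group, of "\<lambda>(x, y). g x y" ?S]) (use g_closed in auto)
  interpret h: group_hom F "add_monoid E" h
    by (rule group_hom.intro) (use h(1) comm_group.axioms(2)[OF E.a_comm_group] in \<open>auto simp: group_hom_axioms_def\<close>)
  have "tensor_relations R N V \<subseteq> kernel F (add_monoid E) h"
  proof
    fix u assume u: "u \<in> tensor_relations R N V"
    then have "u \<in> carrier F"
      by (rule subsetD[OF tensor_relations_subset])
    moreover have "h u = \<zero>\<^bsub>E\<^esub>"
      using u unfolding tensor_relations_def
    proof (elim UnE CollectE exE conjE)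
      fix x x' y assume *: "u = frag_of (x \<oplus>\<^bsub>N\<^esub> x', y) - frag_of (x, y) - frag_of (x', y)"
        "x \<in> carrier N" "x' \<in> carrier N" "y \<in> carrier V"
      have "g (x \<oplus>\<^bsub>N\<^esub> x') y = g x y \<oplus>\<^bsub>E\<^esub> g x' y"
        using mod_hom_add[OF g *(2,3)] *(4) by simp
      then show "h u = \<zero>\<^bsub>E\<^esub>"
        unfolding *(1) using *(2-) h(2)
        by (subst hom_free_Abelian_group_diff2[OF h(1) E.M.abelian_group_axioms]) auto
    next
      fix x y y' assume *: "u = frag_of (x, y \<oplus>\<^bsub>V\<^esub> y') - frag_of (x, y) - frag_of (x, y')"
        "x \<in> carrier N" "y \<in> carrier V" "y' \<in> carrier V"
      then show "h u = \<zero>\<^bsub>E\<^esub>"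
        unfolding *(1) using *(2-) h(2) mod_hom_add[OF gx[OF *(2)] *(3,4)]
        by (subst hom_free_Abelian_group_diff2[OF h(1) E.M.abelian_group_axioms]) auto
    next
      fix r x y assume *: "u = frag_of (r \<odot>\<^bsub>N\<^esub> x, y) - frag_of (x, r \<odot>\<^bsub>V\<^esub> y)"
        "r \<in> carrier R" "x \<in> carrier N" "y \<in> carrier V"
      have "g (r \<odot>\<^bsub>N\<^esub> x) y = g x (r \<odot>\<^bsub>V\<^esub> y)"
        using mod_hom_smult[OF g *(2,3)] mod_hom_smult[OF gx[OF *(3)] *(2,4)] *(4) by simp
      moreover have "u = frag_of (r \<odot>\<^bsub>N\<^esub> x, y) - frag_of (x, r \<odot>\<^bsub>V\<^esub> y) - 0" by (simp add: *(1))
      moreover have "h 0 = \<zero>\<^bsub>E\<^esub>" using h.hom_one by simp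
      ultimately show "h u = \<zero>\<^bsub>E\<^esub>"
        using *(2-) h(2) g_closed N(2)
        by (simp only:, subst hom_free_Abelian_group_diff2[OF h(1) E.M.abelian_group_axioms]) auto
    qed
    ultimately show "u \<in> kernel F (add_monoid E) h" by (simp add: kernel_def)
  qed
  then have "tensor_kernel R N V \<subseteq> kernel F (add_monoid E) h"
    unfolding tensor_kernel_def
    by (rule group.generate_subgroup_incl[OF group_free_Abelian_group _ h.subgroup_kernel])
  then have "h (frag_of (c, z)) = \<zero>\<^bsub>E\<^esub>" using zero by (auto simp: kernel_def)
  then show ?thesis using h(2) c z by simp
qed

lemma free_pair_module_simps:
  "carrier P = {c. Poly_Mapping.keys c \<subseteq> carrier N \<times> carrier V}" "\<zero>\<^bsub>P\<^esub> = 0" "a \<oplus>\<^bsub>P\<^esub> b = a + b"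
  "r \<odot>\<^bsub>P\<^esub> a = frag_extend (\<lambda>(x, y). frag_of (x, r \<odot>\<^bsub>V\<^esub> y)) a"
  by (auto simp: free_pair_module_def free_Abelian_group_def)

lemma free_pair_module_abelian_group: "abelian_group P"
proof (rule abelian_groupI)
  fix a assume "a \<in> carrier P"
  then show "\<exists>b\<in>carrier P. b \<oplus>\<^bsub>P\<^esub> a = \<zero>\<^bsub>P\<^esub>"
    by (intro bexI[of _ "- a"]) (auto simp: free_pair_module_simps)
next
  fix a b assume "a \<in> carrier P" "b \<in> carrier P"
  then show "a \<oplus>\<^bsub>P\<^esub> b \<in> carrier P"
    using keys_add[of a b] by (auto simp: free_pair_module_simps)
qed (auto simp: free_pair_module_simps ac_simps)

lemma free_pair_module_uminus: "b \<in> carrier P \<Longrightarrow> \<ominus>\<^bsub>P\<^esub> b = - b"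
  by (rule abelian_group.minus_equality[OF free_pair_module_abelian_group])
    (simp_all add: free_pair_module_simps)

lemma free_pair_module_minus: "b \<in> carrier P \<Longrightarrow> a \<ominus>\<^bsub>P\<^esub> b = a - b"
  by (simp add: a_minus_def free_pair_module_uminus free_pair_module_simps(3))

lemma free_pair_module_smult_closed:
  assumes "r \<in> carrier R" "a \<in> carrier P"
  shows "r \<odot>\<^bsub>P\<^esub> a \<in> carrier P"
proof -
  interpret V: module R V by (rule V)
  have "Poly_Mapping.keys (r \<odot>\<^bsub>P\<^esub> a) \<subseteq>
    (\<Union>u\<in>Poly_Mapping.keys a. Poly_Mapping.keys ((\<lambda>(x, y). frag_of (x, r \<odot>\<^bsub>V\<^esub> y)) u))"
    unfolding free_pair_module_simps by (rule keys_frag_extend)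
  also have "\<dots> \<subseteq> carrier N \<times> carrier V"
    using assms by (auto simp: free_pair_module_simps)
  finally show ?thesis by (simp add: free_pair_module_simps(1))
qed

lemma tensor_kernel_closed: "0 \<in> K" "a \<in> K \<Longrightarrow> b \<in> K \<Longrightarrow> a + b \<in> K" "a \<in> K \<Longrightarrow> - a \<in> K"
  "a \<in> K \<Longrightarrow> b \<in> K \<Longrightarrow> a - b \<in> K" "u \<in> tensor_relations R N V \<Longrightarrow> u \<in> K"
proof -
  show "0 \<in> K" using subgroup.one_closed[OF tensor_kernel_subgroup] by simp
  show add: "a \<in> K \<Longrightarrow> b \<in> K \<Longrightarrow> a + b \<in> K" for a b
    using subgroup.m_closed[OF tensor_kernel_subgroup, of a b] by simp
  show minus: "a \<in> K \<Longrightarrow> - a \<in> K" for a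
    using subgroup.m_inv_closed[OF tensor_kernel_subgroup, of a] subgroup.subset[OF tensor_kernel_subgroup] by auto
  show "a \<in> K \<Longrightarrow> b \<in> K \<Longrightarrow> a - b \<in> K" for a b
    using add[of a "- b"] minus[of b] by simp
  show "u \<in> tensor_relations R N V \<Longrightarrow> u \<in> K" for u
    by (simp add: tensor_kernel_def generate.incl)
qed

lemma tensor_kernel_free_pair_module: "subgroup K (add_monoid P)"
proof -
  interpret P: abelian_group P by (rule free_pair_module_abelian_group)
  have sub: "K \<subseteq> carrier P"
    using subgroup.subset[OF tensor_kernel_subgroup] by (simp add: free_pair_module_def)
  show ?thesis
    by (rule P.add.subgroupI)
      (use sub tensor_kernel_closed(1-3) in \<open>auto simp: free_pair_module_uminus free_pair_module_simps(3)\<close>)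
qed

lemma tensor_kernel_relations:
  assumes "x \<in> carrier N" "y \<in> carrier V"
  shows "x' \<in> carrier N \<Longrightarrow> frag_of (x \<oplus>\<^bsub>N\<^esub> x', y) - frag_of (x, y) - frag_of (x', y) \<in> K"
    and "y' \<in> carrier V \<Longrightarrow> frag_of (x, y \<oplus>\<^bsub>V\<^esub> y') - frag_of (x, y) - frag_of (x, y') \<in> K"
    and "r \<in> carrier R \<Longrightarrow> frag_of (r \<odot>\<^bsub>N\<^esub> x, y) - frag_of (x, r \<odot>\<^bsub>V\<^esub> y) \<in> K"
  by (rule tensor_kernel_closed(5), unfold tensor_relations_def, use assms in blast)+

lemma tensor_kernel_smult:
  assumes r: "r \<in> carrier R" and a: "a \<in> K"
  shows "r \<odot>\<^bsub>P\<^esub> a \<in> K"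
  using a unfolding tensor_kernel_def
proof induction
  interpret V: module R V by (rule V)
  have rel: "r \<odot>\<^bsub>P\<^esub> u \<in> K" if "u \<in> tensor_relations R N V" for u
    using that unfolding tensor_relations_def
  proof (elim UnE CollectE exE conjE)
    fix x x' y assume "u = frag_of (x \<oplus>\<^bsub>N\<^esub> x', y) - frag_of (x, y) - frag_of (x', y)"
      "x \<in> carrier N" "x' \<in> carrier N" "y \<in> carrier V"
    then show ?thesis
      using tensor_kernel_relations(1)[of x "r \<odot>\<^bsub>V\<^esub> y" x'] r by (simp add: free_pair_module_simps frag_extend_diff)
  next
    fix x y y' assume "u = frag_of (x, y \<oplus>\<^bsub>V\<^esub> y') - frag_of (x, y) - frag_of (x, y')"
      "x \<in> carrier N" "y \<in> carrier V" "y' \<in> carrier V"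
    then show ?thesis
      using tensor_kernel_relations(2)[of x "r \<odot>\<^bsub>V\<^esub> y" "r \<odot>\<^bsub>V\<^esub> y'"] r
      by (simp add: free_pair_module_simps frag_extend_diff V.smult_r_distr)
  next
    fix t x y assume "u = frag_of (t \<odot>\<^bsub>N\<^esub> x, y) - frag_of (x, t \<odot>\<^bsub>V\<^esub> y)"
      "t \<in> carrier R" "x \<in> carrier N" "y \<in> carrier V"
    then show ?thesis
      using tensor_kernel_relations(3)[of x "r \<odot>\<^bsub>V\<^esub> y" t] r
      by (simp add: free_pair_module_simps frag_extend_diff V.smult_left_commute[of r t])
  qed
  {
    case one
    show ?case using tensor_kernel_closed(1) by (simp add: free_pair_module_simps tensor_kernel_def)
  next
    case (incl u)
    then show ?case using rel by (simp add: tensor_kernel_def)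
  next
    case (inv u)
    then show ?case
      using rel[of u] tensor_kernel_closed(3)[of "r \<odot>\<^bsub>P\<^esub> u"] tensor_relations_subset
      by (auto simp: tensor_kernel_def free_pair_module_simps frag_extend_minus subset_iff)
  next
    case (eng a b)
    then show ?case
      using tensor_kernel_closed(2)[of "r \<odot>\<^bsub>P\<^esub> a" "r \<odot>\<^bsub>P\<^esub> b"]
      by (simp add: tensor_kernel_def free_pair_module_simps frag_extend_add)
  }
qed

lemma tensor_kernel_induct:
  assumes "a \<in> carrier P" and "D 0 = 0" and "\<And>a b. D (a - b) = D a - D b"
    and "\<And>x y. x \<in> carrier N \<Longrightarrow> y \<in> carrier V \<Longrightarrow> D (frag_of (x, y)) \<in> K"
  shows "D a \<in> K"
proof -
  have "Poly_Mapping.keys a \<subseteq> carrier N \<times> carrier V" using assms(1) by (simp add: free_pair_module_simps)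
  then show ?thesis
    by (induction a rule: frag_induction) (use assms(2-4) tensor_kernel_closed in auto)
qed

lemma tensor_module_module:
  "module R (quotient_module P K)"
  "(\<lambda>x\<in>carrier P. K +>\<^bsub>P\<^esub> x) \<in> mod_hom R P (quotient_module P K)"
  "\<And>x. x \<in> carrier P \<Longrightarrow> K +>\<^bsub>P\<^esub> x = \<zero>\<^bsub>quotient_module P K\<^esub> \<longleftrightarrow> x \<in> K"
proof -
  interpret V: module R V by (rule V)
  interpret P: abelian_group P by (rule free_pair_module_abelian_group)
  note simps = free_pair_module_simps(2-4) frag_extend_add frag_extend_diff
  have P: "cring R" "abelian_group P" "subgroup K (add_monoid P)"
    using V.R.cring_axioms P.abelian_group_axioms tensor_kernel_free_pair_module by simp_all
  have distr: "r \<odot>\<^bsub>P\<^esub> (a \<oplus>\<^bsub>P\<^esub> b) = r \<odot>\<^bsub>P\<^esub> a \<oplus>\<^bsub>P\<^esub> r \<odot>\<^bsub>P\<^esub> b" for r a b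
    by (simp add: simps)
  have l_distr: "(r \<oplus>\<^bsub>R\<^esub> t) \<odot>\<^bsub>P\<^esub> a \<ominus>\<^bsub>P\<^esub> (r \<odot>\<^bsub>P\<^esub> a \<oplus>\<^bsub>P\<^esub> t \<odot>\<^bsub>P\<^esub> a) \<in> K"
    if "r \<in> carrier R" "t \<in> carrier R" "a \<in> carrier P" for r t a
  proof -
    have rel: "(r \<oplus>\<^bsub>R\<^esub> t) \<odot>\<^bsub>P\<^esub> a - r \<odot>\<^bsub>P\<^esub> a - t \<odot>\<^bsub>P\<^esub> a \<in> K"
      by (rule tensor_kernel_induct[OF that(3)])
        (use that(1,2) tensor_kernel_relations(2) in \<open>simp_all add: simps V.smult_l_distr\<close>)
    have c: "r \<odot>\<^bsub>P\<^esub> a \<oplus>\<^bsub>P\<^esub> t \<odot>\<^bsub>P\<^esub> a \<in> carrier P"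
      using that by (intro P.a_closed free_pair_module_smult_closed)
    show ?thesis
      using rel free_pair_module_minus[OF c, of "(r \<oplus>\<^bsub>R\<^esub> t) \<odot>\<^bsub>P\<^esub> a"]
      by (simp only: diff_diff_eq free_pair_module_simps(3))
  qed
  have assoc: "(r \<otimes>\<^bsub>R\<^esub> t) \<odot>\<^bsub>P\<^esub> a \<ominus>\<^bsub>P\<^esub> r \<odot>\<^bsub>P\<^esub> (t \<odot>\<^bsub>P\<^esub> a) \<in> K"
    if "r \<in> carrier R" "t \<in> carrier R" "a \<in> carrier P" for r t a
  proof -
    have "(r \<otimes>\<^bsub>R\<^esub> t) \<odot>\<^bsub>P\<^esub> a - r \<odot>\<^bsub>P\<^esub> (t \<odot>\<^bsub>P\<^esub> a) \<in> K"
      by (rule tensor_kernel_induct[OF that(3)])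
        (use that(1,2) tensor_kernel_closed(1) in \<open>simp_all add: simps V.smult_assoc1\<close>)
    then show ?thesis using that by (simp add: free_pair_module_minus free_pair_module_smult_closed)
  qed
  have one: "\<one>\<^bsub>R\<^esub> \<odot>\<^bsub>P\<^esub> a \<ominus>\<^bsub>P\<^esub> a \<in> K" if "a \<in> carrier P" for a
  proof -
    have "\<one>\<^bsub>R\<^esub> \<odot>\<^bsub>P\<^esub> a - a \<in> K"
      by (rule tensor_kernel_induct[OF that]) (use tensor_kernel_closed(1) in \<open>simp_all add: simps\<close>)
    then show ?thesis using that by (simp add: free_pair_module_minus)
  qed
  note Q = quotient_module_module[OF P free_pair_module_smult_closed distr tensor_kernel_smult l_distr assoc one]
  show "module R (quotient_module P K)" "(\<lambda>x\<in>carrier P. K +>\<^bsub>P\<^esub> x) \<in> mod_hom R P (quotient_module P K)"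
    "\<And>x. x \<in> carrier P \<Longrightarrow> K +>\<^bsub>P\<^esub> x = \<zero>\<^bsub>quotient_module P K\<^esub> \<longleftrightarrow> x \<in> K"
    by (rule Q(1,2,4); assumption)+
qed

end

context matlis_setting
begin

text \<open>Hom-tensor adjunction on the level of elements: \<open>E\<close> separates the points of \<open>N \<otimes> V\<close>, and
  the functionals on \<open>N \<otimes> V\<close> are the homomorphisms from \<open>N\<close> to the dual of \<open>V\<close>.\<close>

lemma pure_tensor_zero_iff:
  assumes N: "abelian_group N" "\<forall>r\<in>carrier R. \<forall>x\<in>carrier N. r \<odot>\<^bsub>N\<^esub> x \<in> carrier N"
    and V: "module R V" and c: "c \<in> carrier N" and z: "z \<in> carrier V"
  shows "pure_tensor R N V c z = \<one>\<^bsub>tensor_product R N V\<^esub>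
    \<longleftrightarrow> (\<forall>g\<in>mod_hom R N (hom_module R V E). g c z = \<zero>\<^bsub>E\<^esub>)"
proof -
  interpret N: abelian_group N by fact
  interpret V: module R V by fact
  let ?P = "free_pair_module N V" and ?K = "tensor_kernel R N V"
  let ?Q = "quotient_module ?P ?K" and ?\<pi> = "\<lambda>x\<in>carrier ?P. ?K +>\<^bsub>?P\<^esub> x"
  note Pcarr = free_pair_module_simps(1)[OF N V]
  have frag: "frag_of (x, y) \<in> carrier ?P" if "x \<in> carrier N" "y \<in> carrier V" for x y
    using that by (simp add: Pcarr)
  have "frag_of (c, z) \<in> ?K" if no: "\<forall>g\<in>mod_hom R N (hom_module R V E). g c z = \<zero>\<^bsub>E\<^esub>"
  proof (rule ccontr)
    assume notin: "frag_of (c, z) \<notin> ?K"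
    note Q = tensor_module_module[OF N V]
    have "?\<pi> (frag_of (c, z)) \<noteq> \<zero>\<^bsub>?Q\<^esub>" using Q(3)[OF frag[OF c z]] notin frag[OF c z] by simp
    then obtain \<phi> where \<phi>: "\<phi> \<in> mod_hom R ?Q E" "\<phi> (?\<pi> (frag_of (c, z))) \<noteq> \<zero>\<^bsub>E\<^esub>"
      using separation_zero[OF Q(1) mod_hom_closed[OF Q(2) frag[OF c z]]] by blast
    define h where "h = (\<lambda>a\<in>carrier ?P. \<phi> (?\<pi> a))"
    have h: "h \<in> mod_hom R ?P E"
      unfolding h_def
      by (rule mod_hom_comp[OF Q(2) \<phi>(1) free_pair_module_abelian_group[OF N V]
            free_pair_module_smult_closed[OF N V]])
    have hK: "h a = \<zero>\<^bsub>E\<^esub>" if "a \<in> ?K" for a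
    proof -
      have "a \<in> carrier ?P"
        using subsetD[OF subgroup.subset[OF tensor_kernel_subgroup[OF N V]] that] by (simp add: free_pair_module_def)
      then show ?thesis
        using Q(3)[of a] that mod_hom_zero[OF Q(1) module_E \<phi>(1)] by (simp add: h_def)
    qed
    have h_hom: "h \<in> hom (free_Abelian_group (carrier N \<times> carrier V)) (add_monoid E)"
    proof (rule homI)
      fix a b assume ab: "a \<in> carrier (free_Abelian_group (carrier N \<times> carrier V))"
        "b \<in> carrier (free_Abelian_group (carrier N \<times> carrier V))"
      show "h a \<in> carrier (add_monoid E)" using ab mod_hom_closed[OF h, of a] by (simp add: Pcarr)
      show "h (a \<otimes>\<^bsub>free_Abelian_group (carrier N \<times> carrier V)\<^esub> b) = h a \<otimes>\<^bsub>add_monoid E\<^esub> h b"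
        using ab mod_hom_add[OF h, of a b] by (simp add: Pcarr free_pair_module_simps(3)[OF N V])
    qed
    have h_smult: "h (frag_of (x, r \<odot>\<^bsub>V\<^esub> y)) = r \<odot>\<^bsub>E\<^esub> h (frag_of (x, y))"
      if "r \<in> carrier R" "x \<in> carrier N" "y \<in> carrier V" for r x y
      using mod_hom_smult[OF h that(1) frag[OF that(2,3)]] by (simp add: free_pair_module_simps(4)[OF N V])
    have h_add: "h a = h b \<oplus>\<^bsub>E\<^esub> h d" if "a - b - d \<in> ?K" "a \<in> carrier ?P" "b \<in> carrier ?P" "d \<in> carrier ?P"
      for a b d
      using hom_free_Abelian_group_diff2[OF h_hom E.M.abelian_group_axioms, of a b d] hK[OF that(1)] that(2-)
      by (simp add: Pcarr)
    have h_balanced: "h (frag_of (r \<odot>\<^bsub>N\<^esub> x, y)) = h (frag_of (x, r \<odot>\<^bsub>V\<^esub> y))"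
      if "r \<in> carrier R" "x \<in> carrier N" "y \<in> carrier V" for r x y
    proof -
      have "h (frag_of (r \<odot>\<^bsub>N\<^esub> x, y)) = h (frag_of (x, r \<odot>\<^bsub>V\<^esub> y)) \<oplus>\<^bsub>E\<^esub> h 0"
        using that tensor_kernel_relations(3)[OF N V that(2,3,1)] N(2)
        by (intro h_add) (auto simp: frag, simp add: Pcarr)
      then show ?thesis
        using hK[OF tensor_kernel_closed(1)[OF N V]] that mod_hom_closed[OF h frag[of x "r \<odot>\<^bsub>V\<^esub> y"]] by simp
    qed
    define g where "g = (\<lambda>x\<in>carrier N. \<lambda>y\<in>carrier V. h (frag_of (x, y)))"
    have "g \<in> mod_hom R N (hom_module R V E)"
    proof (rule mod_homI)
      show "g \<in> extensional (carrier N)" by (simp add: g_def)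
    next
      fix x assume x: "x \<in> carrier N"
      have "(\<lambda>y\<in>carrier V. h (frag_of (x, y))) \<in> mod_hom R V E"
        by (rule mod_homI)
          (use x h_add[OF tensor_kernel_relations(2)[OF N V x]] in
            \<open>auto simp: h_smult frag mod_hom_closed[OF h]\<close>)
      then show "g x \<in> carrier (hom_module R V E)" using x by (simp add: g_def)
    next
      fix x x' assume "x \<in> carrier N" "x' \<in> carrier N"
      then show "g (x \<oplus>\<^bsub>N\<^esub> x') = g x \<oplus>\<^bsub>hom_module R V E\<^esub> g x'"
        using h_add[OF tensor_kernel_relations(1)[OF N V]] by (auto simp: g_def frag intro!: restrict_ext)
    next
      fix r x assume "r \<in> carrier R" "x \<in> carrier N"
      then show "g (r \<odot>\<^bsub>N\<^esub> x) = r \<odot>\<^bsub>hom_module R V E\<^esub> g x"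
        using N(2) by (auto simp: g_def h_balanced h_smult intro!: restrict_ext)
    qed
    then have "g c z = \<zero>\<^bsub>E\<^esub>" using no by blast
    then show False using \<phi>(2) c z frag[OF c z] by (simp add: g_def h_def)
  qed
  moreover have "g c z = \<zero>\<^bsub>E\<^esub>"
    if "frag_of (c, z) \<in> ?K" "g \<in> mod_hom R N (hom_module R V E)" for g
    using bilinear_vanishes_on_zero_tensor[OF N V module_E that(1) c z that(2)] .
  ultimately show ?thesis
    using pure_tensor_eq_one_iff[OF N V c z] by blast
qed

end

section \<open>Perfect pairings with values in the injective hull\<close>

text \<open>A reflexive module and its dual, in a form that is symmetric in the two.  Exchanging
  \<open>V\<close> and \<open>W\<close> replaces the transport of structure along the isomorphism with the bidual.\<close>

locale perfect_pairing = matlis_setting R \<mm> E s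
  for R :: "('a, 'r) ring_scheme" and \<mm> and E :: "('a, 'e) module" and s +
  fixes V :: "('a, 'v) module" and W :: "('a, 'w) module" and b :: "'v \<Rightarrow> 'w \<Rightarrow> 'e"
  assumes V: "module R V" and W: "module R W"
    and left: "\<And>y. y \<in> carrier W \<Longrightarrow> (\<lambda>x\<in>carrier V. b x y) \<in> mod_hom R V E"
    and right: "\<And>x. x \<in> carrier V \<Longrightarrow> (\<lambda>y\<in>carrier W. b x y) \<in> mod_hom R W E"
    and represent_left: "\<And>\<phi>. \<phi> \<in> mod_hom R V E \<Longrightarrow> \<exists>y\<in>carrier W. \<forall>x\<in>carrier V. \<phi> x = b x y"
    and represent_right: "\<And>\<psi>. \<psi> \<in> mod_hom R W E \<Longrightarrow> \<exists>x\<in>carrier V. \<forall>y\<in>carrier W. \<psi> y = b x y"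
begin

sublocale V: module R V by (rule V)

sublocale W: module R W by (rule W)

lemma swap: "perfect_pairing R \<mm> E s W V (\<lambda>y x. b x y)"
  by (intro perfect_pairing.intro perfect_pairing_axioms.intro matlis_setting_axioms V W left right
      represent_left represent_right)

lemma pairing_closed: "x \<in> carrier V \<Longrightarrow> y \<in> carrier W \<Longrightarrow> b x y \<in> carrier E"
  using mod_hom_closed[OF left, of y x] by simp

lemma pairing_left:
  assumes "y \<in> carrier W" "x \<in> carrier V"
  shows "x' \<in> carrier V \<Longrightarrow> b (x \<oplus>\<^bsub>V\<^esub> x') y = b x y \<oplus>\<^bsub>E\<^esub> b x' y"
    and "r \<in> carrier R \<Longrightarrow> b (r \<odot>\<^bsub>V\<^esub> x) y = r \<odot>\<^bsub>E\<^esub> b x y"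
    and "b \<zero>\<^bsub>V\<^esub> y = \<zero>\<^bsub>E\<^esub>"
  using mod_hom_add[OF left[OF assms(1)] assms(2)] mod_hom_smult[OF left[OF assms(1)] _ assms(2)]
    mod_hom_zero[OF V module_E left[OF assms(1)]]
    assms(2)
  by simp_all

lemma nondegenerate_right:
  assumes "y \<in> carrier W" "\<And>x. x \<in> carrier V \<Longrightarrow> b x y = \<zero>\<^bsub>E\<^esub>"
  shows "y = \<zero>\<^bsub>W\<^esub>"
proof (rule ccontr)
  assume "y \<noteq> \<zero>\<^bsub>W\<^esub>"
  then obtain \<psi> where "\<psi> \<in> mod_hom R W E" "\<psi> y \<noteq> \<zero>\<^bsub>E\<^esub>" by (rule separation_zero[OF W assms(1)])
  then show False using represent_right[of \<psi>] assms by auto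
qed

lemma pairing_hom:
  "(\<lambda>y\<in>carrier W. \<lambda>x\<in>carrier V. b x y) \<in> mod_hom R W (hom_module R V E)"
proof -
  interpret S: perfect_pairing R \<mm> E s W V "\<lambda>y x. b x y" by (rule swap)
  show ?thesis
    by (rule mod_homI) (use left in \<open>auto simp: S.pairing_left intro!: restrict_ext\<close>)
qed

definition perp :: "'v set \<Rightarrow> 'w set"
  where "perp Z = {y \<in> carrier W. \<forall>x\<in>Z. b x y = \<zero>\<^bsub>E\<^esub>}"

lemma perp_submodule:
  assumes "Z \<subseteq> carrier V"
  shows "submodule (perp Z) R W"
proof -
  have "submodule {y \<in> carrier W. \<forall>x\<in>Z. y \<in> {y \<in> carrier W. (\<lambda>y\<in>carrier W. b x y) y = \<zero>\<^bsub>E\<^esub>}} R W"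
    by (rule submodule_Inter[OF W], rule mod_hom_kernel_submodule[OF W module_E right])
      (use assms in blast)
  moreover have "{y \<in> carrier W. \<forall>x\<in>Z. y \<in> {y \<in> carrier W. (\<lambda>y\<in>carrier W. b x y) y = \<zero>\<^bsub>E\<^esub>}} = perp Z"
    by (auto simp: perp_def)
  ultimately show ?thesis by simp
qed

text \<open>Every submodule is closed for the pairing, because a functional separating \<open>x\<close> from \<open>Z\<close> is
  represented by an element of \<open>W\<close>.\<close>

lemma double_perp:
  assumes Z: "submodule Z R V" and x: "x \<in> carrier V"
  shows "x \<in> Z \<longleftrightarrow> (\<forall>y\<in>perp Z. b x y = \<zero>\<^bsub>E\<^esub>)"
proof
  assume *: "\<forall>y\<in>perp Z. b x y = \<zero>\<^bsub>E\<^esub>"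
  show "x \<in> Z"
  proof (rule ccontr)
    assume "x \<notin> Z"
    then obtain \<phi> where \<phi>: "\<phi> \<in> mod_hom R V E" "\<And>n. n \<in> Z \<Longrightarrow> \<phi> n = \<zero>\<^bsub>E\<^esub>" "\<phi> x \<noteq> \<zero>\<^bsub>E\<^esub>"
      using separation[OF V Z x] by blast
    then obtain y where y: "y \<in> carrier W" "\<And>x. x \<in> carrier V \<Longrightarrow> \<phi> x = b x y"
      using represent_left[of \<phi>] by blast
    then have "y \<in> perp Z" using \<phi>(2) submodule_closed(1)[OF Z] by (simp add: perp_def)
    then show False using * \<phi>(3) y(2)[OF x] by simp
  qed
qed (simp add: perp_def)

text \<open>The inverse of the isomorphism from \<open>W\<close> to the dual of \<open>V\<close>.\<close>

lemma representing_hom: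
  obtains h where "h \<in> mod_hom R (hom_module R V E) W"
    "\<And>\<phi> x. \<phi> \<in> mod_hom R V E \<Longrightarrow> x \<in> carrier V \<Longrightarrow> b x (h \<phi>) = \<phi> x"
proof -
  let ?D = "hom_module R V E"
  define J where "J = (\<lambda>y\<in>carrier W. \<lambda>x\<in>carrier V. b x y)"
  define i where "i = (\<lambda>y\<in>carrier W. y)"
  have D: "module R ?D" by (rule hom_module_module[OF V module_E])
  have J: "J \<in> mod_hom R W ?D" unfolding J_def by (rule pairing_hom)
  have J_app: "J y x = b x y" if "y \<in> carrier W" "x \<in> carrier V" for x y
    using that by (simp add: J_def)
  have i: "i \<in> mod_hom R W W"
    using mod_hom_inclusion[OF W.carrier_is_submodule] by (simp add: i_def)
  have surj: "J ` carrier W = carrier ?D"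
  proof
    show "J ` carrier W \<subseteq> carrier ?D" using mod_hom_closed[OF J] by blast
    show "carrier ?D \<subseteq> J ` carrier W"
    proof
      fix \<phi> assume "\<phi> \<in> carrier ?D"
      then have \<phi>: "\<phi> \<in> mod_hom R V E" by simp
      then obtain y where y: "y \<in> carrier W" "\<And>x. x \<in> carrier V \<Longrightarrow> \<phi> x = b x y"
        using represent_left by blast
      have "J y \<in> mod_hom R V E" using mod_hom_closed[OF J y(1)] by simp
      then have "\<phi> = J y" by (rule mod_hom_eqI[OF \<phi>]) (simp add: y J_app)
      then show "\<phi> \<in> J ` carrier W" using y(1) by (rule image_eqI)
    qed
  qed
  have ker: "i y = \<zero>\<^bsub>W\<^esub>" if y: "y \<in> carrier W" "J y = \<zero>\<^bsub>?D\<^esub>" for y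
  proof -
    have "b x y = \<zero>\<^bsub>E\<^esub>" if "x \<in> carrier V" for x
      using J_app[OF y(1) that] that by (simp add: y(2))
    then show ?thesis using nondegenerate_right y(1) by (simp add: i_def)
  qed
  obtain h where h: "h \<in> mod_hom R ?D W" "\<And>y. y \<in> carrier W \<Longrightarrow> h (J y) = i y"
    using mod_hom_descend[OF W D W J surj i ker] by blast
  show thesis
  proof (rule that[OF h(1)])
    fix \<phi> x assume \<phi>: "\<phi> \<in> mod_hom R V E" and x: "x \<in> carrier V"
    then have "\<phi> \<in> J ` carrier W" by (simp add: surj)
    then obtain y where y: "y \<in> carrier W" "\<phi> = J y" by blast
    then show "b x (h \<phi>) = \<phi> x" using h(2)[OF y(1)] J_app[OF y(1) x] by (simp add: i_def)
  qed
qed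

text \<open>A functional on \<open>V / Z\<close> is a functional on \<open>V\<close> that kills \<open>Z\<close>, that is, an element of
  \<open>perp Z\<close>.\<close>

lemma perp_isomorphic_dual_quotient:
  assumes Z: "submodule Z R V"
  shows "mod_isomorphic R (W\<lparr>carrier := perp Z\<rparr>) (hom_module R (quotient_module V Z) E)"
proof -
  let ?Q = "quotient_module V Z" and ?\<pi> = "\<lambda>x\<in>carrier V. Z +>\<^bsub>V\<^esub> x"
  let ?D = "hom_module R ?Q E" and ?P = "W\<lparr>carrier := perp Z\<rparr>"
  note Q = quotient_by_submodule[OF V Z]
  have D: "module R ?D" by (rule hom_module_module[OF Q(1) module_E])
  have perp: "submodule (perp Z) R W" by (rule perp_submodule) (use submodule_closed(1)[OF Z] in blast)
  have P: "module R ?P" by (rule submodule.submodule_is_module[OF perp W])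
  obtain h where h: "h \<in> mod_hom R (hom_module R V E) W"
    and bh: "\<And>\<phi> x. \<phi> \<in> mod_hom R V E \<Longrightarrow> x \<in> carrier V \<Longrightarrow> b x (h \<phi>) = \<phi> x"
    using representing_hom by blast
  \<comment> \<open>The inverse map \<open>f\<close>: pull a functional back to \<open>V\<close> and represent it by an element of \<open>W\<close>.\<close>
  define p where "p \<psi> = (\<lambda>x\<in>carrier V. \<psi> (?\<pi> x))" for \<psi> :: "'v set \<Rightarrow> 'e"
  have p: "p \<psi> \<in> mod_hom R V E" if "\<psi> \<in> mod_hom R ?Q E" for \<psi>
    unfolding p_def by (rule mod_hom_compose[OF Q(2) that V])
  define f where "f = (\<lambda>\<psi>\<in>mod_hom R ?Q E. h (p \<psi>))"
  have bf: "b x (f \<psi>) = \<psi> (?\<pi> x)" if "\<psi> \<in> mod_hom R ?Q E" "x \<in> carrier V" for \<psi> x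
    using that bh[OF p[OF that(1)] that(2)] by (simp add: f_def p_def)
  have f_perp: "f \<psi> \<in> perp Z" if \<psi>: "\<psi> \<in> mod_hom R ?Q E" for \<psi>
  proof -
    have "f \<psi> \<in> carrier W" using \<psi> mod_hom_closed[OF h, of "p \<psi>"] p by (simp add: f_def)
    moreover have "b x (f \<psi>) = \<zero>\<^bsub>E\<^esub>" if "x \<in> Z" for x
      using bf[OF \<psi>] Q(4)[of x] that submodule_closed(1)[OF Z that] mod_hom_zero[OF Q(1) module_E \<psi>]
      by simp
    ultimately show ?thesis by (simp add: perp_def)
  qed
  have pi_closed: "?\<pi> x \<in> carrier ?Q" if "x \<in> carrier V" for x by (rule mod_hom_closed[OF Q(2) that])
  have p_add: "p (\<psi> \<oplus>\<^bsub>?D\<^esub> \<psi>') = p \<psi> \<oplus>\<^bsub>hom_module R V E\<^esub> p \<psi>'" for \<psi> \<psi>'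
    using pi_closed by (auto simp: p_def intro!: restrict_ext)
  have p_smult: "p (r \<odot>\<^bsub>?D\<^esub> \<psi>) = r \<odot>\<^bsub>hom_module R V E\<^esub> p \<psi>" for r \<psi>
    using pi_closed by (auto simp: p_def intro!: restrict_ext)
  interpret D: module R ?D by (rule D)
  have f: "f \<in> mod_hom R ?D ?P"
  proof (rule mod_homI)
    show "f \<in> extensional (carrier ?D)" by (simp add: f_def)
  next
    fix \<psi> assume "\<psi> \<in> carrier ?D"
    then show "f \<psi> \<in> carrier ?P" using f_perp by simp
  next
    fix \<psi> \<psi>' assume *: "\<psi> \<in> carrier ?D" "\<psi>' \<in> carrier ?D"
    have "f (\<psi> \<oplus>\<^bsub>?D\<^esub> \<psi>') = h (p \<psi> \<oplus>\<^bsub>hom_module R V E\<^esub> p \<psi>')"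
      unfolding p_add[symmetric] f_def using D.a_closed[OF *] by simp
    also have "\<dots> = h (p \<psi>) \<oplus>\<^bsub>W\<^esub> h (p \<psi>')"
      by (rule mod_hom_add[OF h]) (use * p in auto)
    finally show "f (\<psi> \<oplus>\<^bsub>?D\<^esub> \<psi>') = f \<psi> \<oplus>\<^bsub>?P\<^esub> f \<psi>'" using * by (simp add: f_def)
  next
    fix r \<psi> assume *: "r \<in> carrier R" "\<psi> \<in> carrier ?D"
    have "f (r \<odot>\<^bsub>?D\<^esub> \<psi>) = h (r \<odot>\<^bsub>hom_module R V E\<^esub> p \<psi>)"
      unfolding p_smult[symmetric] f_def using D.smult_closed[OF *] by simp
    also have "\<dots> = r \<odot>\<^bsub>W\<^esub> h (p \<psi>)"
      by (rule mod_hom_smult[OF h]) (use * p in auto)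
    finally show "f (r \<odot>\<^bsub>?D\<^esub> \<psi>) = r \<odot>\<^bsub>?P\<^esub> f \<psi>" using * by (simp add: f_def)
  qed
  have "bij_betw f (carrier ?D) (carrier ?P)"
    unfolding bij_betw_def
  proof
    show "inj_on f (carrier ?D)"
    proof (rule inj_onI)
      fix \<psi> \<psi>' assume *: "\<psi> \<in> carrier ?D" "\<psi>' \<in> carrier ?D" "f \<psi> = f \<psi>'"
      then have \<psi>: "\<psi> \<in> mod_hom R ?Q E" "\<psi>' \<in> mod_hom R ?Q E" by simp_all
      show "\<psi> = \<psi>'"
      proof (rule mod_hom_eqI[OF \<psi>])
        fix C assume "C \<in> carrier ?Q"
        then obtain x where x: "x \<in> carrier V" "C = ?\<pi> x" unfolding Q(3)[symmetric] by (rule imageE)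
        show "\<psi> C = \<psi>' C"
          unfolding x(2) using bf[OF \<psi>(1) x(1)] bf[OF \<psi>(2) x(1)] *(3) by simp
      qed
    qed
    show "f ` carrier ?D = carrier ?P"
    proof
      show "f ` carrier ?D \<subseteq> carrier ?P" using f_perp by auto
      show "carrier ?P \<subseteq> f ` carrier ?D"
      proof
        fix y assume "y \<in> carrier ?P"
        then have y: "y \<in> carrier W" "\<And>x. x \<in> Z \<Longrightarrow> b x y = \<zero>\<^bsub>E\<^esub>" by (simp_all add: perp_def)
        have "(\<lambda>x\<in>carrier V. b x y) x = \<zero>\<^bsub>E\<^esub>" if "x \<in> carrier V" "?\<pi> x = \<zero>\<^bsub>?Q\<^esub>" for x
          using that Q(4)[of x] y(2) by simp
        then obtain \<psi> where \<psi>: "\<psi> \<in> mod_hom R ?Q E"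
          "\<And>x. x \<in> carrier V \<Longrightarrow> \<psi> (?\<pi> x) = (\<lambda>x\<in>carrier V. b x y) x"
          using mod_hom_descend[OF V Q(1) module_E Q(2,3) left[OF y(1)]] by blast
        have fy: "f \<psi> \<in> carrier W" using f_perp[OF \<psi>(1)] by (simp add: perp_def)
        have "f \<psi> \<ominus>\<^bsub>W\<^esub> y = \<zero>\<^bsub>W\<^esub>"
        proof (rule nondegenerate_right)
          show "f \<psi> \<ominus>\<^bsub>W\<^esub> y \<in> carrier W" using fy y(1) by simp
          fix x assume x: "x \<in> carrier V"
          have "b x (f \<psi> \<ominus>\<^bsub>W\<^esub> y) = b x (f \<psi>) \<ominus>\<^bsub>E\<^esub> b x y"
            using mod_hom_diff[OF W module_E right[OF x] fy y(1)] fy y(1) by simp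
          then show "b x (f \<psi> \<ominus>\<^bsub>W\<^esub> y) = \<zero>\<^bsub>E\<^esub>"
            using bf[OF \<psi>(1) x] \<psi>(2)[OF x] x pairing_closed[OF x y(1)] by (simp add: E.minus_eq_zero_iff)
        qed
        then have "y = f \<psi>" using fy y(1) by (simp add: W.minus_eq_zero_iff)
        then show "y \<in> f ` carrier ?D" using \<psi>(1) by simp
      qed
    qed
  qed
  then have "mod_isomorphic R ?D ?P" using f by (auto simp: mod_isomorphic_def mod_iso_def)
  then show ?thesis by (rule mod_isomorphic_sym[OF D P])
qed

text \<open>By injectivity of \<open>E\<close> every functional on \<open>perp Z\<close> extends to \<open>W\<close> and is thus represented by
  some \<open>x\<close>, which is unique modulo the double annihilator of \<open>Z\<close>, that is, modulo \<open>Z\<close>.\<close>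

lemma dual_perp_isomorphic_quotient:
  assumes Z: "submodule Z R V"
  shows "mod_isomorphic R (hom_module R (W\<lparr>carrier := perp Z\<rparr>) E) (quotient_module V Z)"
proof -
  let ?P = "W\<lparr>carrier := perp Z\<rparr>" and ?g = "\<lambda>x\<in>carrier V. \<lambda>y\<in>perp Z. b x y"
  have perp: "submodule (perp Z) R W" by (rule perp_submodule) (use submodule_closed(1)[OF Z] in blast)
  have P: "module R ?P" by (rule submodule.submodule_is_module[OF perp W])
  have perpW: "y \<in> carrier W" if "y \<in> perp Z" for y using that by (simp add: perp_def)
  have g_hom: "(\<lambda>y\<in>perp Z. b x y) \<in> mod_hom R ?P E" if "x \<in> carrier V" for x
  proof -
    have "restrict (\<lambda>y\<in>carrier W. b x y) (perp Z) = (\<lambda>y\<in>perp Z. b x y)"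
      using perpW by (intro restrict_ext) simp
    then show ?thesis using mod_hom_restrict[OF right[OF that] perp] by simp
  qed
  have g: "?g \<in> mod_hom R V (hom_module R ?P E)"
    by (rule mod_homI) (use g_hom perpW in \<open>auto simp: pairing_left intro!: restrict_ext\<close>)
  show ?thesis
  proof (rule first_isomorphism[OF V hom_module_module[OF P module_E] Z g])
    show "?g ` carrier V = carrier (hom_module R ?P E)"
    proof
      show "?g ` carrier V \<subseteq> carrier (hom_module R ?P E)" using g_hom by auto
      show "carrier (hom_module R ?P E) \<subseteq> ?g ` carrier V"
      proof
        fix \<phi> assume "\<phi> \<in> carrier (hom_module R ?P E)"
        then have \<phi>: "\<phi> \<in> mod_hom R ?P E" by simp
        have "\<phi> y = \<zero>\<^bsub>E\<^esub>" if "y \<in> carrier ?P" "(\<lambda>y\<in>perp Z. y) y = \<zero>\<^bsub>W\<^esub>" for y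
          using that mod_hom_zero[OF P module_E \<phi>] by simp
        then obtain \<psi> where \<psi>: "\<psi> \<in> mod_hom R W E"
          "\<And>y. y \<in> carrier ?P \<Longrightarrow> \<psi> ((\<lambda>y\<in>perp Z. y) y) = \<phi> y"
          using injective_factor[OF injective P W mod_hom_inclusion[OF perp] \<phi>] by blast
        obtain x where x: "x \<in> carrier V" "\<And>y. y \<in> carrier W \<Longrightarrow> \<psi> y = b x y"
          using represent_right[OF \<psi>(1)] by blast
        have "\<phi> = (\<lambda>y\<in>perp Z. b x y)"
          by (rule mod_hom_eqI[OF \<phi> g_hom[OF x(1)]]) (use \<psi>(2) x(2) perpW in auto)
        then show "\<phi> \<in> ?g ` carrier V" using x(1) by auto
      qed
    qed
    fix x assume x: "x \<in> carrier V"
    have "?g x = \<zero>\<^bsub>hom_module R ?P E\<^esub> \<longleftrightarrow> (\<forall>y\<in>perp Z. b x y = \<zero>\<^bsub>E\<^esub>)"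
      using x by (auto simp: restrict_def fun_eq_iff)
    then show "?g x = \<zero>\<^bsub>hom_module R ?P E\<^esub> \<longleftrightarrow> x \<in> Z" using double_perp[OF Z x] by simp
  qed
qed

end

section \<open>Tight closure and tight interior under a perfect pairing\<close>

lemma frob_module_simps [simp]:
  "carrier (frob_module R p e) = carrier R" "\<zero>\<^bsub>frob_module R p e\<^esub> = \<zero>\<^bsub>R\<^esub>"
  "x \<oplus>\<^bsub>frob_module R p e\<^esub> y = x \<oplus>\<^bsub>R\<^esub> y" "r \<odot>\<^bsub>frob_module R p e\<^esub> x = r [^]\<^bsub>R\<^esub> (p ^ e) \<otimes>\<^bsub>R\<^esub> x"
  by (simp_all add: frob_module_def)

lemma frob_module_abelian_group:
  assumes "cring R"
  shows "abelian_group (frob_module R p e)"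
proof -
  interpret cring R by fact
  show ?thesis
    by (rule abelian_groupI) (auto simp: a_ac intro: bexI[of _ "\<ominus>\<^bsub>R\<^esub> _"] l_neg)
qed

lemma ring_circ_one:
  assumes "cring R"
  shows "\<one>\<^bsub>R\<^esub> \<in> ring_circ R"
proof -
  interpret cring R by fact
  have "\<one>\<^bsub>R\<^esub> \<notin> P" if "primeideal P R" for P
    using ideal.one_imp_carrier[OF primeideal.axioms(1)[OF that]] primeideal.I_notcarr[OF that] by auto
  then show ?thesis by (simp add: ring_circ_def minimal_prime_def)
qed

lemma ring_circ_mult:
  assumes "cring R" "c \<in> ring_circ R" "d \<in> ring_circ R"
  shows "c \<otimes>\<^bsub>R\<^esub> d \<in> ring_circ R"
proof -
  interpret cring R by fact
  show ?thesis
    using assms(2,3) primeideal.I_prime by (fastforce simp: ring_circ_def minimal_prime_def)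
qed

context perfect_pairing
begin

text \<open>Homomorphisms to the dual of \<open>V\<close> are homomorphisms to \<open>W\<close>, so the condition defining tight
  closure on \<open>V\<close> is expressed by the maps defining the tight interior of \<open>W\<close>.\<close>

lemma pure_tensor_zero_iff_pairing:
  assumes c: "c \<in> carrier R" and z: "z \<in> carrier V"
  shows "pure_tensor R (frob_module R p e) V c z = \<one>\<^bsub>tensor_product R (frob_module R p e) V\<^esub>
    \<longleftrightarrow> (\<forall>g\<in>mod_hom R (frob_module R p e) W. b z (g c) = \<zero>\<^bsub>E\<^esub>)"
proof -
  let ?N = "frob_module R p e" and ?D = "hom_module R V E"
  have N: "abelian_group ?N" "\<forall>r\<in>carrier R. \<forall>x\<in>carrier ?N. r \<odot>\<^bsub>?N\<^esub> x \<in> carrier ?N"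
    using frob_module_abelian_group[OF cring] by auto
  obtain h where h: "h \<in> mod_hom R ?D W"
    and bh: "\<And>\<phi> x. \<phi> \<in> mod_hom R V E \<Longrightarrow> x \<in> carrier V \<Longrightarrow> b x (h \<phi>) = \<phi> x"
    using representing_hom by blast
  have "(\<forall>g\<in>mod_hom R ?N ?D. g c z = \<zero>\<^bsub>E\<^esub>) \<longleftrightarrow> (\<forall>g\<in>mod_hom R ?N W. b z (g c) = \<zero>\<^bsub>E\<^esub>)"
  proof
    assume *: "\<forall>g\<in>mod_hom R ?N ?D. g c z = \<zero>\<^bsub>E\<^esub>"
    show "\<forall>g\<in>mod_hom R ?N W. b z (g c) = \<zero>\<^bsub>E\<^esub>"
    proof
      fix g assume g: "g \<in> mod_hom R ?N W"
      have "g c \<in> carrier W" using mod_hom_closed[OF g, of c] c by simp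
      then show "b z (g c) = \<zero>\<^bsub>E\<^esub>" using bspec[OF * mod_hom_comp[OF g pairing_hom N(1)]] N(2) c z by auto
    qed
  next
    assume *: "\<forall>g\<in>mod_hom R ?N W. b z (g c) = \<zero>\<^bsub>E\<^esub>"
    show "\<forall>g\<in>mod_hom R ?N ?D. g c z = \<zero>\<^bsub>E\<^esub>"
    proof
      fix g assume g: "g \<in> mod_hom R ?N ?D"
      have "g c \<in> mod_hom R V E" using mod_hom_closed[OF g, of c] c by simp
      then show "g c z = \<zero>\<^bsub>E\<^esub>" using bspec[OF * mod_hom_comp[OF g h N(1)]] N(2) c bh[OF _ z] by auto
    qed
  qed
  then show ?thesis using pure_tensor_zero_iff[OF N V _ z, of c] c by simp
qed

lemma tight_closure_zero_iff:
  "z \<in> tight_closure_zero R p V \<longleftrightarrow> z \<in> carrier V \<and>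
    (\<exists>c\<in>ring_circ R. \<exists>e\<^sub>0. \<forall>e\<ge>e\<^sub>0. \<forall>g\<in>mod_hom R (frob_module R p e) W. b z (g c) = \<zero>\<^bsub>E\<^esub>)"
proof (cases "z \<in> carrier V")
  case True
  have "(\<forall>\<^sub>F e in sequentially.
      pure_tensor R (frob_module R p e) V c z = \<one>\<^bsub>tensor_product R (frob_module R p e) V\<^esub>) \<longleftrightarrow>
    (\<exists>e\<^sub>0. \<forall>e\<ge>e\<^sub>0. \<forall>g\<in>mod_hom R (frob_module R p e) W. b z (g c) = \<zero>\<^bsub>E\<^esub>)" if "c \<in> ring_circ R" for c
    using pure_tensor_zero_iff_pairing[OF _ True] that by (simp add: eventually_sequentially ring_circ_def)
  then show ?thesis using True by (simp add: tight_closure_zero_def cong: bex_cong)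
qed (simp add: tight_closure_zero_def)

text \<open>For the sum, two multipliers are replaced by their product: multiplication by an element of
  \<open>R\<close> is an endomorphism of \<open>\<^sup>eR\<close>.\<close>

lemma tight_closure_zero_submodule: "submodule (tight_closure_zero R p V) R V"
proof (rule V.submoduleI)
  let ?T = "tight_closure_zero R p V"
  have gW: "g c \<in> carrier W" if "g \<in> mod_hom R (frob_module R p e) W" "c \<in> ring_circ R" for g c e
    using mod_hom_closed[OF that(1), of c] that(2) by (simp add: ring_circ_def)
  show "?T \<subseteq> carrier V" by (auto simp: tight_closure_zero_def)
  show "\<zero>\<^bsub>V\<^esub> \<in> ?T"
    unfolding tight_closure_zero_iff using ring_circ_one[OF cring] gW pairing_left(3) by blast
  show smult: "r \<odot>\<^bsub>V\<^esub> a \<in> ?T" if "r \<in> carrier R" "a \<in> ?T" for r a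
    using that gW pairing_left(2) unfolding tight_closure_zero_iff
    by (metis E.smult_r_null V.smult_closed)
  show "\<ominus>\<^bsub>V\<^esub> a \<in> ?T" if "a \<in> ?T" for a
    using smult[of "\<ominus>\<^bsub>R\<^esub> \<one>\<^bsub>R\<^esub>" a] that by (simp add: V.smult_l_minus tight_closure_zero_iff)
  show "a \<oplus>\<^bsub>V\<^esub> a' \<in> ?T" if a: "a \<in> ?T" "a' \<in> ?T" for a a'
  proof -
    \<comment> \<open>Orthogonality to all \<open>g c\<close> entails that to all \<open>g (d c)\<close>.\<close>
    have mult: "b x (g (d \<otimes>\<^bsub>R\<^esub> c)) = \<zero>\<^bsub>E\<^esub>"
      if "\<forall>g\<in>mod_hom R (frob_module R p e) W. b x (g c) = \<zero>\<^bsub>E\<^esub>"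
        "g \<in> mod_hom R (frob_module R p e) W" "c \<in> ring_circ R" "d \<in> ring_circ R" for x g c d e
    proof -
      have cd: "c \<in> carrier R" "d \<in> carrier R" using that(3,4) by (simp_all add: ring_circ_def)
      have "(\<lambda>u\<in>carrier R. g (d \<otimes>\<^bsub>R\<^esub> u)) \<in> mod_hom R (frob_module R p e) W"
      proof (rule mod_homI)
        fix u v assume "u \<in> carrier (frob_module R p e)" "v \<in> carrier (frob_module R p e)"
        then show "(\<lambda>u\<in>carrier R. g (d \<otimes>\<^bsub>R\<^esub> u)) (u \<oplus>\<^bsub>frob_module R p e\<^esub> v) =
          (\<lambda>u\<in>carrier R. g (d \<otimes>\<^bsub>R\<^esub> u)) u \<oplus>\<^bsub>W\<^esub> (\<lambda>u\<in>carrier R. g (d \<otimes>\<^bsub>R\<^esub> u)) v"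
          using mod_hom_add[OF that(2), of "d \<otimes>\<^bsub>R\<^esub> u" "d \<otimes>\<^bsub>R\<^esub> v"] cd(2) by (simp add: R.r_distr)
      next
        fix r u assume "r \<in> carrier R" "u \<in> carrier (frob_module R p e)"
        then show "(\<lambda>u\<in>carrier R. g (d \<otimes>\<^bsub>R\<^esub> u)) (r \<odot>\<^bsub>frob_module R p e\<^esub> u) =
          r \<odot>\<^bsub>W\<^esub> (\<lambda>u\<in>carrier R. g (d \<otimes>\<^bsub>R\<^esub> u)) u"
          using mod_hom_smult[OF that(2), of r "d \<otimes>\<^bsub>R\<^esub> u"] cd(2) by (simp add: R.m_lcomm)
      qed (use mod_hom_closed[OF that(2)] cd(2) in auto)
      then show ?thesis using bspec[OF that(1)] cd(1) by fastforce
    qed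
    obtain c k where c: "c \<in> ring_circ R"
      "\<And>e. e \<ge> k \<Longrightarrow> \<forall>g\<in>mod_hom R (frob_module R p e) W. b a (g c) = \<zero>\<^bsub>E\<^esub>"
      using a(1) unfolding tight_closure_zero_iff by blast
    obtain c' k' where c': "c' \<in> ring_circ R"
      "\<And>e. e \<ge> k' \<Longrightarrow> \<forall>g\<in>mod_hom R (frob_module R p e) W. b a' (g c') = \<zero>\<^bsub>E\<^esub>"
      using a(2) unfolding tight_closure_zero_iff by blast
    have aV: "a \<in> carrier V" "a' \<in> carrier V" using a by (simp_all add: tight_closure_zero_def)
    have cc': "c' \<otimes>\<^bsub>R\<^esub> c \<in> ring_circ R" by (rule ring_circ_mult[OF cring c'(1) c(1)])
    have "b (a \<oplus>\<^bsub>V\<^esub> a') (g (c' \<otimes>\<^bsub>R\<^esub> c)) = \<zero>\<^bsub>E\<^esub>"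
      if "max k k' \<le> e" "g \<in> mod_hom R (frob_module R p e) W" for e g
    proof -
      have "b a (g (c' \<otimes>\<^bsub>R\<^esub> c)) = \<zero>\<^bsub>E\<^esub>" by (rule mult[OF c(2) that(2) c(1) c'(1)]) (use that(1) in simp)
      moreover have "b a' (g (c \<otimes>\<^bsub>R\<^esub> c')) = \<zero>\<^bsub>E\<^esub>"
        by (rule mult[OF c'(2) that(2) c'(1) c(1)]) (use that(1) in simp)
      moreover have "c \<otimes>\<^bsub>R\<^esub> c' = c' \<otimes>\<^bsub>R\<^esub> c" using c(1) c'(1) by (simp add: ring_circ_def R.m_comm)
      ultimately show ?thesis using pairing_left(1)[OF gW[OF that(2) cc'] aV] by simp
    qed
    then show ?thesis unfolding tight_closure_zero_iff using aV cc' by blast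
  qed
qed

text \<open>Being a submodule, \<open>tight_image\<close> is the annihilator of its own annihilator, and the latter
  consists of the \<open>x\<close> orthogonal to the generators \<open>g c\<close>.\<close>

lemma tight_image_iff:
  assumes c: "c \<in> carrier R" and y: "y \<in> carrier W"
  shows "y \<in> tight_image R p W c e\<^sub>0 \<longleftrightarrow>
    (\<forall>x\<in>carrier V. (\<forall>e\<ge>e\<^sub>0. \<forall>g\<in>mod_hom R (frob_module R p e) W. b x (g c) = \<zero>\<^bsub>E\<^esub>) \<longrightarrow> b x y = \<zero>\<^bsub>E\<^esub>)"
proof -
  interpret S: perfect_pairing R \<mm> E s W V "\<lambda>y x. b x y" by (rule swap)
  let ?G = "\<Union>e\<in>{e\<^sub>0..}. (\<lambda>g. g c) ` mod_hom R (frob_module R p e) W"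
  have G: "?G \<subseteq> carrier W" using c by (auto simp: mod_hom_closed)
  have N: "submodule (tight_image R p W c e\<^sub>0) R W"
    unfolding tight_image_def by (rule submodule_generated_submodule[OF W G])
  have "x \<in> S.perp (tight_image R p W c e\<^sub>0) \<longleftrightarrow>
    (\<forall>e\<ge>e\<^sub>0. \<forall>g\<in>mod_hom R (frob_module R p e) W. b x (g c) = \<zero>\<^bsub>E\<^esub>)" if x: "x \<in> carrier V" for x
  proof
    assume "x \<in> S.perp (tight_image R p W c e\<^sub>0)"
    then show "\<forall>e\<ge>e\<^sub>0. \<forall>g\<in>mod_hom R (frob_module R p e) W. b x (g c) = \<zero>\<^bsub>E\<^esub>"
      using submodule_generated_subset[of ?G R W] by (auto simp: S.perp_def tight_image_def)
  next
    assume *: "\<forall>e\<ge>e\<^sub>0. \<forall>g\<in>mod_hom R (frob_module R p e) W. b x (g c) = \<zero>\<^bsub>E\<^esub>"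
    have "?G \<subseteq> perp {x}" using * G unfolding perp_def by blast
    then have "tight_image R p W c e\<^sub>0 \<subseteq> perp {x}"
      unfolding tight_image_def
      using submodule_generated_least[OF perp_submodule, of "{x}" ?G] x by simp
    then show "x \<in> S.perp (tight_image R p W c e\<^sub>0)" using x by (auto simp: S.perp_def perp_def)
  qed
  then show ?thesis using S.double_perp[OF N y] by (auto simp: S.perp_def)
qed

text \<open>An intersection of annihilators is the annihilator of the union, and \<open>0\<^sup>*\<close> is the union, over
  the multipliers \<open>c\<close> and the bounds \<open>e\<^sub>0\<close>, of the sets occurring in the preceding lemma.\<close>

lemma tight_interior_eq_perp: "tight_interior R p W = perp (tight_closure_zero R p V)"
proof -
  have circ: "c \<in> carrier R" if "c \<in> ring_circ R" for c using that by (simp add: ring_circ_def)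
  have sub: "tight_interior R p W \<subseteq> carrier W"
  proof -
    have "tight_image R p W \<one>\<^bsub>R\<^esub> 0 \<subseteq> carrier W"
      unfolding tight_image_def
      by (rule submodule_generated_least[OF W.carrier_is_submodule]) (auto simp: mod_hom_closed)
    then show ?thesis using ring_circ_one[OF cring] by (auto simp: tight_interior_def)
  qed
  have "y \<in> tight_interior R p W \<longleftrightarrow> y \<in> perp (tight_closure_zero R p V)" if y: "y \<in> carrier W" for y
  proof -
    have "y \<in> tight_interior R p W \<longleftrightarrow> (\<forall>c\<in>ring_circ R. \<forall>e\<^sub>0. y \<in> tight_image R p W c e\<^sub>0)"
      by (simp add: tight_interior_def)
    moreover have "y \<in> perp (tight_closure_zero R p V) \<longleftrightarrow>
      (\<forall>x\<in>tight_closure_zero R p V. b x y = \<zero>\<^bsub>E\<^esub>)"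
      using y by (simp add: perp_def)
    ultimately show ?thesis
      using tight_image_iff[OF circ y] tight_closure_zero_iff[where p = p] by blast
  qed
  then show ?thesis using sub by (auto simp: perp_def)
qed

end

section \<open>Duality between tight closure and tight interior\<close>

theorem corollary3p6:
  fixes R :: "('a, 'r) ring_scheme" and \<mm> :: "'a set" and p :: nat
    and E :: "('a, 'e) module" and L :: "('a, 'l) module"
  assumes "local_ring R \<mm>" and "noetherian_ring R" and "reduced_ring R"
    and "adic_complete R \<mm>"
    and "Factorial_Ring.prime p" and "has_characteristic R p" and "F_finite R p"
    and "injective_hull R (quotient_module (ring_module R) \<mm>) E"
    and "module R L"
    and "artinian_module R L \<or> fin_gen_module R L \<or> matlis_dualizable R E L"
  shows "mod_isomorphic R
           (matlis_dual R E (L\<lparr>carrier := tight_interior R p L\<rparr>))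
           (quotient_module (matlis_dual R E L) (tight_closure_zero R p (matlis_dual R E L)))
       \<and> mod_isomorphic R
           ((matlis_dual R E L)\<lparr>carrier := tight_interior R p (matlis_dual R E L)\<rparr>)
           (matlis_dual R E (quotient_module L (tight_closure_zero R p L)))"
proof -
  obtain s where "matlis_setting R \<mm> E s"
    by (rule injective_hull_matlis_setting[OF assms(1,2,8)])
  then interpret complete_matlis_setting R \<mm> E s
    by (intro complete_matlis_setting.intro complete_matlis_setting_axioms.intro assms(4))
  let ?D = "hom_module R L E"
  have D: "module R ?D" by (rule hom_module_module[OF assms(9) module_E])
  have ev: "evaluation_surjective R E L" by (rule matlis_evaluation_surjective[OF assms(9,10)])
  interpret P: perfect_pairing R \<mm> E s L ?D "\<lambda>x \<phi>. \<phi> x"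
  proof (intro perfect_pairing.intro perfect_pairing_axioms.intro matlis_setting_axioms assms(9) D)
    show "(\<lambda>x\<in>carrier L. \<phi> x) \<in> mod_hom R L E" if "\<phi> \<in> carrier ?D" for \<phi>
      using that mod_hom_extensional[of \<phi> R L E] by (simp add: extensional_restrict)
    show "(\<lambda>\<phi>\<in>carrier ?D. \<phi> x) \<in> mod_hom R ?D E" if "x \<in> carrier L" for x
      using mod_hom_eval[OF assms(9) module_E that] by simp
    show "\<exists>\<psi>\<in>carrier ?D. \<forall>x\<in>carrier L. \<phi> x = \<psi> x" if "\<phi> \<in> mod_hom R L E" for \<phi>
      using that by auto
    show "\<exists>x\<in>carrier L. \<forall>\<phi>\<in>carrier ?D. \<Psi> \<phi> = \<phi> x" if "\<Psi> \<in> mod_hom R ?D E" for \<Psi>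
      using ev that by (simp add: evaluation_surjective_def)
  qed
  interpret S: perfect_pairing R \<mm> E s ?D L "\<lambda>\<phi> x. \<phi> x" by (rule P.swap)
  show ?thesis
    using S.dual_perp_isomorphic_quotient[OF S.tight_closure_zero_submodule, of p]
      P.perp_isomorphic_dual_quotient[OF P.tight_closure_zero_submodule, of p]
    by (simp only: matlis_dual_def S.tight_interior_eq_perp P.tight_interior_eq_perp)
qed

end
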